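(* Let $\mathbf F$ be the endofunctor on $\mathbb N$-indexed families of sets defined by $(\mathbf F X)_n=\sum_{I\in\mathbb N}\big(\prod_{M\in\mathcal M_n}X_{\mathrm{cod}(M)}\big)^I$. Then the family $\big(\mathrm{ob}(\mathrm{OPsh}(\mathcal V_{[n]}))\big)_{n\in\mathbb N}$, equipped with the coalgebra structure sending $S\in\mathrm{OPsh}(\mathcal V_{[n]})$ to the element of $(\mathbf F(\mathrm{ob}\,\mathrm{OPsh}(\mathcal V_{[-]})))_n$ indexed by the finite ordinal $I=S(\mathrm{id}_{[n]})$ whose $i$-th component ($i\in I$) maps each $M\colon[n]\to[n']$ in $\mathcal M_n$ to the presheaf on $\mathcal V_{[n']}$ sending a view $V$ to the fibre over $i$ of $S(V\circ M)\to S(\mathrm{id}_{[n]})$, is a terminal $\mathbf F$-coalgebra.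
   Context: Base category. Let $\mathcal C$ be the category generated by the following graph modulo relations. Objects: $\star$; $[n]$ ($n\in\mathbb N$); for each $n$: $\mathrm{tick}_n,\mathrm{paral}_n,\mathrm{parar}_n,\nu_n,\mathrm{para}_n$; for $1\le i\le n$: $\iota^+_{n,i},\iota^-_{n,i}$; for $n,m$, $1\le i\le n$, $1\le j\le m$: $\tau_{n,i,m,j}$. Arrows: $d_1,\dots,d_n\colon\star\to[n]$; $s,t\colon[n]\to c$ for $c\in\{\mathrm{tick}_n,\mathrm{paral}_n,\mathrm{parar}_n,\iota^\pm_{n,i}\}$; $s\colon[n]\to\nu_n$, $t\colon[n+1]\to\nu_n$; $l\colon\mathrm{paral}_n\to\mathrm{para}_n$, $r\colon\mathrm{parar}_n\to\mathrm{para}_n$; $\epsilon\colon\iota^+_{n,i}\to\tau_{n,i,m,j}$, $\rho\colon\iota^-_{m,j}\to\tau_{n,i,m,j}$. Relations: $s\circ d_i=t\circ d_i$ ($1\le i\le n$) for each pair $s,t$ into a common object; $l\circ s=r\circ s$; $\epsilon\circ s\circ d_i=\rho\circ s\circ d_j$. $\widehat{\mathcal C}=[\mathcal C^{op},\mathbf{Set}]$, objects identified with representables. Positions: finite presheaves empty outside $\star$ and the $[n]$ (channels / players knowing $n$ channels). Basic moves: cospans $[n]\xrightarrow{s}c\xleftarrow{t}[n']$ for $c\in\{\mathrm{tick}_n,\mathrm{paral}_n,\mathrm{parar}_n,\nu_n,\iota^\pm_{n,i}\}$ ($n'=n+1$ for $\nu_n$, else $n$), interface $n\cdot\star$ mapped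 by $[d_1,\dots,d_n]$, up to isomorphism of cospans. Extended moves: pushouts of moves along a morphism from their interface to a position. Views: plays $[n]\hookrightarrow V$ obtained as the colimit (composite in cospans) of a finite, possibly empty chain of extended basic moves. $\mathcal V_{[n]}$: category whose objects are views $Y\hookrightarrow V$ with a morphism $Y\to[n]$, morphisms pairs $(h\colon Y\to Y',k\colon V\to V')$ commuting with inclusions and maps to $[n]$. For a basic move $M\colon[n]\to[n']$ and a view $V$ on $[n']$, $V\circ M$ is the view on $[n]$ obtained by composing the cospans (pushout). $\mathcal M_n$: set of isomorphism classes of basic moves from $[n]$; $\mathrm{cod}(M)$ denotes the index $n'$ of its final position $[n']$. $\mathbf{FinOrd}$ is the category of finite ordinals and monotone maps; finite ordinals are identified with natural numbers. For a category $\mathcal D$, $\mathrm{OPsh}(\mathcal D)=[\mathcal D^{op},\mathbf{FinOrd}]$. *)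

theory Defs
  imports "HOL-Library.FuncSet"
begin

section \<open>Categories and presheaves\<close>

datatype ('o, 'd) arrow = Arrow (src: 'o) (lab: 'd) (tgt: 'o)

record ('o, 'd) cat =
  Obj :: "'o set"
  Arr :: "('o, 'd) arrow set"
  Ide :: "'o \<Rightarrow> ('o, 'd) arrow"
  Comp :: "('o, 'd) arrow \<Rightarrow> ('o, 'd) arrow \<Rightarrow> ('o, 'd) arrow"

definition hom :: "('o, 'd) cat \<Rightarrow> 'o \<Rightarrow> 'o \<Rightarrow> ('o, 'd) arrow set" where
  "hom D x y = {f \<in> Arr D. src f = x \<and> tgt f = y}"

definition iso :: "('o, 'd) cat \<Rightarrow> ('o, 'd) arrow \<Rightarrow> bool" where
  "iso D f \<longleftrightarrow> f \<in> Arr D \<and>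
    (\<exists>g \<in> hom D (tgt f) (src f). Comp D g f = Ide D (src f) \<and> Comp D f g = Ide D (tgt f))"

definition is_pushout ::
  "('o, 'd) cat \<Rightarrow> ('o, 'd) arrow \<Rightarrow> ('o, 'd) arrow \<Rightarrow> ('o, 'd) arrow \<Rightarrow> ('o, 'd) arrow \<Rightarrow> bool" where
  "is_pushout D f g p q \<longleftrightarrow>
    f \<in> Arr D \<and> g \<in> Arr D \<and> p \<in> Arr D \<and> q \<in> Arr D \<and>
    src f = src g \<and> src p = tgt f \<and> src q = tgt g \<and> tgt p = tgt q \<and>
    Comp D p f = Comp D q g \<and>
    (\<forall>b \<in> Arr D. \<forall>c \<in> Arr D.
       src b = tgt f \<and> src c = tgt g \<and> tgt b = tgt c \<and> Comp D b f = Comp D c g \<longrightarrow>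
       (\<exists>!u. u \<in> hom D (tgt p) (tgt b) \<and> Comp D u p = b \<and> Comp D u q = c))"

definition is_coproduct ::
  "('o, 'd) cat \<Rightarrow> 'i set \<Rightarrow> ('i \<Rightarrow> 'o) \<Rightarrow> 'o \<Rightarrow> ('i \<Rightarrow> ('o, 'd) arrow) \<Rightarrow> bool" where
  "is_coproduct D J A P e \<longleftrightarrow>
    P \<in> Obj D \<and> (\<forall>i\<in>J. e i \<in> hom D (A i) P) \<and>
    (\<forall>Q \<in> Obj D. \<forall>g. (\<forall>i\<in>J. g i \<in> hom D (A i) Q) \<longrightarrow>
       (\<exists>!u. u \<in> hom D P Q \<and> (\<forall>i\<in>J. Comp D u (e i) = g i)))"

record ('o, 'd, 'e) psh =
  El :: "'o \<Rightarrow> 'e set"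
  Act :: "('o, 'd) arrow \<Rightarrow> 'e \<Rightarrow> 'e"

text \<open>Values outside the relevant domains are normalised, so that equality of presheaves and of
  natural transformations is equality of terms.\<close>

definition presheaf :: "('o, 'd) cat \<Rightarrow> ('o, 'd, 'e) psh \<Rightarrow> bool" where
  "presheaf D P \<longleftrightarrow>
    (\<forall>x. x \<notin> Obj D \<longrightarrow> El P x = {}) \<and>
    (\<forall>f. f \<notin> Arr D \<longrightarrow> Act P f = (\<lambda>_. undefined)) \<and>
    (\<forall>f \<in> Arr D. Act P f \<in> El P (tgt f) \<rightarrow>\<^sub>E El P (src f)) \<and>
    (\<forall>x \<in> Obj D. \<forall>e \<in> El P x. Act P (Ide D x) e = e) \<and>
    (\<forall>f \<in> Arr D. \<forall>g \<in> Arr D. tgt f = src g \<longrightarrow>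
       (\<forall>e \<in> El P (tgt g). Act P (Comp D g f) e = Act P f (Act P g e)))"

definition nat_trans :: "('o, 'd) cat \<Rightarrow> ('o, 'd, 'e) psh \<Rightarrow> ('o, 'd, 'e) psh \<Rightarrow> ('o \<Rightarrow> 'e \<Rightarrow> 'e) \<Rightarrow> bool" where
  "nat_trans D P Q \<phi> \<longleftrightarrow>
    (\<forall>x. \<phi> x \<in> El P x \<rightarrow>\<^sub>E El Q x) \<and>
    (\<forall>f \<in> Arr D. \<forall>e \<in> El P (tgt f). \<phi> (src f) (Act P f e) = Act Q f (\<phi> (tgt f) e))"

definition Psh :: "('o, 'd) cat \<Rightarrow> (('o, 'd, 'e) psh, 'o \<Rightarrow> 'e \<Rightarrow> 'e) cat" where
  "Psh D = \<lparr>
     Obj = {P. presheaf D P},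
     Arr = {Arrow P \<phi> Q | P \<phi> Q. presheaf D P \<and> presheaf D Q \<and> nat_trans D P Q \<phi>},
     Ide = (\<lambda>P. Arrow P (\<lambda>x. \<lambda>e \<in> El P x. e) P),
     Comp = (\<lambda>\<beta> \<alpha>. Arrow (src \<alpha>) (\<lambda>x. compose (El (src \<alpha>) x) (lab \<beta> x) (lab \<alpha> x)) (tgt \<beta>)) \<rparr>"

definition yo :: "('o, 'd) cat \<Rightarrow> 'o \<Rightarrow> ('o, 'd, ('o, 'd) arrow) psh" where
  "yo D c = \<lparr>
     El = (\<lambda>x. hom D x c),
     Act = (\<lambda>f. if f \<in> Arr D then (\<lambda>g \<in> hom D (tgt f) c. Comp D g f) else (\<lambda>_. undefined)) \<rparr>"

definition yo_map :: "('o, 'd) cat \<Rightarrow> ('o, 'd) arrow \<Rightarrow>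
    (('o, 'd, ('o, 'd) arrow) psh, 'o \<Rightarrow> ('o, 'd) arrow \<Rightarrow> ('o, 'd) arrow) arrow" where
  "yo_map D g = Arrow (yo D (src g)) (\<lambda>x. \<lambda>f \<in> hom D x (src g). Comp D g f) (yo D (tgt g))"

text \<open>The finite ordinal \<open>n\<close> is the initial segment \<open>{..<n}\<close> of the natural numbers, so
  the category of finite ordinals is skeletal and isomorphic presheaves are equal.\<close>

definition OPsh :: "('o, 'd) cat \<Rightarrow> ('o, 'd, nat) psh set" where
  "OPsh D = {S. presheaf D S \<and>
     (\<forall>x \<in> Obj D. \<exists>n. El S x = {..<n}) \<and>
     (\<forall>f \<in> Arr D. mono_on (El S (tgt f)) (Act S f))}"


section \<open>The base category\<close>

datatype cobj =
    Star
  | Pl nat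
  | Tick nat | ParL nat | ParR nat | Nu nat | Para nat
  | IotaP nat nat | IotaM nat nat
  | Tau nat nat nat nat

fun cobj_ok :: "cobj \<Rightarrow> bool" where
  "cobj_ok (IotaP n i) \<longleftrightarrow> 1 \<le> i \<and> i \<le> n"
| "cobj_ok (IotaM n i) \<longleftrightarrow> 1 \<le> i \<and> i \<le> n"
| "cobj_ok (Tau n i m j) \<longleftrightarrow> 1 \<le> i \<and> i \<le> n \<and> 1 \<le> j \<and> j \<le> m"
| "cobj_ok _ \<longleftrightarrow> True"

text \<open>\<open>basic n c n'\<close>: there are arrows \<open>s: [n] \<rightarrow> c\<close> and \<open>t: [n'] \<rightarrow> c\<close>.\<close>

inductive basic :: "nat \<Rightarrow> cobj \<Rightarrow> nat \<Rightarrow> bool" where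
  "basic n (Tick n) n"
| "basic n (ParL n) n"
| "basic n (ParR n) n"
| "basic n (Nu n) (Suc n)"
| "1 \<le> i \<Longrightarrow> i \<le> n \<Longrightarrow> basic n (IotaP n i) n"
| "1 \<le> i \<Longrightarrow> i \<le> n \<Longrightarrow> basic n (IotaM n i) n"

datatype gen =
    Gd nat nat
  | Gs cobj | Gt cobj
  | Gl nat | Gr nat
  | Geps nat nat nat nat | Grho nat nat nat nat

inductive edge :: "gen \<Rightarrow> cobj \<Rightarrow> cobj \<Rightarrow> bool" where
  "1 \<le> i \<Longrightarrow> i \<le> n \<Longrightarrow> edge (Gd n i) Star (Pl n)"
| "basic n c n' \<Longrightarrow> edge (Gs c) (Pl n) c"
| "basic n c n' \<Longrightarrow> edge (Gt c) (Pl n') c"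
| "edge (Gl n) (ParL n) (Para n)"
| "edge (Gr n) (ParR n) (Para n)"
| "cobj_ok (Tau n i m j) \<Longrightarrow> edge (Geps n i m j) (IotaP n i) (Tau n i m j)"
| "cobj_ok (Tau n i m j) \<Longrightarrow> edge (Grho n i m j) (IotaM m j) (Tau n i m j)"

text \<open>Paths are listed in the order of composition: \<open>[g, f]\<close> stands for \<open>g \<circ> f\<close>.\<close>

inductive path :: "cobj \<Rightarrow> gen list \<Rightarrow> cobj \<Rightarrow> bool" where
  "cobj_ok x \<Longrightarrow> path x [] x"
| "path x p y \<Longrightarrow> edge g y z \<Longrightarrow> path x (g # p) z"

inductive crel :: "cobj \<Rightarrow> cobj \<Rightarrow> gen list \<Rightarrow> gen list \<Rightarrow> bool" where
  "basic n c n' \<Longrightarrow> 1 \<le> i \<Longrightarrow> i \<le> n \<Longrightarrow> crel Star c [Gs c, Gd n i] [Gt c, Gd n' i]"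
| "crel (Pl n) (Para n) [Gl n, Gs (ParL n)] [Gr n, Gs (ParR n)]"
| "cobj_ok (Tau n i m j) \<Longrightarrow>
     crel Star (Tau n i m j) [Geps n i m j, Gs (IotaP n i), Gd n i] [Grho n i m j, Gs (IotaM m j), Gd m j]"

inductive ceq :: "cobj \<Rightarrow> cobj \<Rightarrow> gen list \<Rightarrow> gen list \<Rightarrow> bool" where
  "crel x y p q \<Longrightarrow> ceq x y p q"
| "path x p y \<Longrightarrow> ceq x y p p"
| "ceq x y p q \<Longrightarrow> ceq x y q p"
| "ceq x y p q \<Longrightarrow> ceq x y q r \<Longrightarrow> ceq x y p r"
| "path w a x \<Longrightarrow> ceq x y p q \<Longrightarrow> path y b z \<Longrightarrow> ceq w z (b @ p @ a) (b @ q @ a)"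

type_synonym carrow = "(cobj, gen list set) arrow"

definition carr :: "cobj \<Rightarrow> gen list \<Rightarrow> cobj \<Rightarrow> carrow" where
  "carr x p y = Arrow x {q. ceq x y p q} y"

definition \<C> :: "(cobj, gen list set) cat" where
  "\<C> = \<lparr>
     Obj = {x. cobj_ok x},
     Arr = {carr x p y | x p y. path x p y},
     Ide = (\<lambda>x. carr x [] x),
     Comp = (\<lambda>g f. Arrow (src f) {r. \<exists>p \<in> lab f. \<exists>q \<in> lab g. ceq (src f) (tgt g) (q @ p) r} (tgt g)) \<rparr>"

text \<open>Presheaves take their elements in the type of arrows of \<open>\<C>\<close>. This contains the
  representables on the nose, and since the type is infinite every finite presheaf (in particular
  every position and every view) is isomorphic to one of this form.\<close>

type_synonym cpsh = "(cobj, gen list set, carrow) psh"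
type_synonym cmor = "(cpsh, cobj \<Rightarrow> carrow \<Rightarrow> carrow) arrow"

abbreviation Chat :: "(cpsh, cobj \<Rightarrow> carrow \<Rightarrow> carrow) cat" where
  "Chat \<equiv> Psh \<C>"

abbreviation ccomp :: "cmor \<Rightarrow> cmor \<Rightarrow> cmor" (infixr "\<odot>" 70) where
  "g \<odot> f \<equiv> Comp Chat g f"

abbreviation player :: "nat \<Rightarrow> cpsh" where
  "player n \<equiv> yo \<C> (Pl n)"

definition d_map :: "nat \<Rightarrow> nat \<Rightarrow> cmor" where
  "d_map n i = yo_map \<C> (carr Star [Gd n i] (Pl n))"

definition position :: "cpsh \<Rightarrow> bool" where
  "position P \<longleftrightarrow> presheaf \<C> P \<and> finite (SIGMA x:UNIV. El P x) \<and>
    (\<forall>x. El P x \<noteq> {} \<longrightarrow> x = Star \<or> (\<exists>n. x = Pl n))"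


section \<open>Moves, plays and views\<close>

text \<open>A cospan \<open>X \<rightarrow> U \<leftarrow> Y\<close> is the pair of its legs, the one from the initial position first.\<close>

type_synonym cospan = "cmor \<times> cmor"

definition cospan_iso :: "cospan \<Rightarrow> cospan \<Rightarrow> bool" where
  "cospan_iso K K' \<longleftrightarrow>
    fst K \<in> Arr Chat \<and> snd K \<in> Arr Chat \<and> tgt (fst K) = tgt (snd K) \<and>
    (\<exists>u. iso Chat u \<and> src u = tgt (fst K) \<and> tgt u = tgt (fst K') \<and>
         u \<odot> fst K = fst K' \<and> u \<odot> snd K = snd K')"

definition basic_cospan :: "nat \<Rightarrow> cobj \<Rightarrow> nat \<Rightarrow> cospan" where
  "basic_cospan n c n' = (yo_map \<C> (carr (Pl n) [Gs c] c), yo_map \<C> (carr (Pl n') [Gt c] c))"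

definition Moves :: "nat \<Rightarrow> cospan set set" where
  "Moves n = {{K. cospan_iso K (basic_cospan n c n')} | c n'. basic n c n'}"

definition move_cod :: "cospan set \<Rightarrow> nat" where
  "move_cod M = (THE n'. \<exists>K \<in> M. src (snd K) = player n')"

text \<open>The interface \<open>n \<cdot> \<star>\<close> is \<open>J\<close>, with coprojections \<open>e\<close>, mapped by \<open>\<delta>\<close> and \<open>\<delta>'\<close> to the
  initial and final positions; the initial position, the move and the final position are pushed
  out along \<open>z: J \<rightarrow> Z\<close>, and \<open>l\<close>, \<open>r\<close> are the induced legs.\<close>

definition extended_move :: "cospan \<Rightarrow> bool" where
  "extended_move K \<longleftrightarrow> (\<exists>n c n' s t J e \<delta> \<delta>' z x x' m m' y y'.
     basic n c n' \<and> basic_cospan n c n' = (s, t) \<and>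
     is_coproduct Chat {1..n} (\<lambda>_. yo \<C> Star) J e \<and>
     \<delta> \<in> hom Chat J (player n) \<and> (\<forall>i \<in> {1..n}. \<delta> \<odot> e i = d_map n i) \<and>
     \<delta>' \<in> hom Chat J (player n') \<and> (\<forall>i \<in> {1..n}. \<delta>' \<odot> e i = d_map n' i) \<and>
     z \<in> Arr Chat \<and> src z = J \<and> position (tgt z) \<and>
     is_pushout Chat \<delta> z x x' \<and>
     is_pushout Chat (s \<odot> \<delta>) z m m' \<and>
     is_pushout Chat \<delta>' z y y' \<and>
     fst K \<in> hom Chat (tgt x) (tgt m) \<and> fst K \<odot> x = m \<odot> s \<and> fst K \<odot> x' = m' \<and>
     snd K \<in> hom Chat (tgt y) (tgt m) \<and> snd K \<odot> y = m \<odot> t \<and> snd K \<odot> y' = m')"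

inductive basic_play :: "cospan \<Rightarrow> bool" where
  empty: "iso Chat l \<Longrightarrow> position (src l) \<Longrightarrow> basic_play (l, l)"
| step: "basic_play (l, r) \<Longrightarrow> extended_move (l', r') \<Longrightarrow> is_pushout Chat r l' p q \<Longrightarrow>
    basic_play (p \<odot> l, q \<odot> r')"

definition view :: "cmor \<Rightarrow> bool" where
  "view i \<longleftrightarrow> (\<exists>n r. src i = player n \<and> basic_play (i, r))"

text \<open>An object of \<open>\<V>\<^bsub>[n]\<^esub>\<close> is a pair of a view \<open>Y \<rightarrow> V\<close> and a morphism \<open>Y \<rightarrow> [n]\<close>.\<close>

type_synonym vobj = "cmor \<times> cmor"

definition \<V> :: "nat \<Rightarrow> (vobj, cmor \<times> cmor) cat" where
  "\<V> n = (let ob = {(i, f). view i \<and> f \<in> hom Chat (src i) (player n)} in \<lparr>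
     Obj = ob,
     Arr = {Arrow (i, f) (h, k) (i', f') | i f h k i' f'.
              (i, f) \<in> ob \<and> (i', f') \<in> ob \<and>
              h \<in> hom Chat (src i) (src i') \<and> k \<in> hom Chat (tgt i) (tgt i') \<and>
              k \<odot> i = i' \<odot> h \<and> f' \<odot> h = f},
     Ide = (\<lambda>v. Arrow v (Ide Chat (src (fst v)), Ide Chat (tgt (fst v))) v),
     Comp = (\<lambda>b a. Arrow (src a) (fst (lab b) \<odot> fst (lab a), snd (lab b) \<odot> snd (lab a)) (tgt b)) \<rparr>)"

definition id_view :: "nat \<Rightarrow> vobj" where
  "id_view n = (Ide Chat (player n), Ide Chat (player n))"

text \<open>Composition of a view with a move: \<open>V \<circ> M\<close> is computed with a chosen representative of \<open>M\<close>
  and a chosen pushout.\<close>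

definition rep :: "cospan set \<Rightarrow> cospan" where
  "rep M = (SOME K. K \<in> M)"

definition po :: "cospan set \<Rightarrow> vobj \<Rightarrow> cmor \<times> cmor" where
  "po M v = (SOME pq. is_pushout Chat (snd (rep M) \<odot> snd v) (fst v) (fst pq) (snd pq))"

definition vcomp :: "vobj \<Rightarrow> cospan set \<Rightarrow> vobj" where
  "vcomp v M = (fst (po M v) \<odot> fst (rep M), Ide Chat (src (fst (rep M))))"

definition vcomp_arr :: "(vobj, cmor \<times> cmor) arrow \<Rightarrow> cospan set \<Rightarrow> (vobj, cmor \<times> cmor) arrow" where
  "vcomp_arr a M =
    (let (p, q) = po M (src a); (p', q') = po M (tgt a) in
     Arrow (vcomp (src a) M)
       (Ide Chat (src (fst (rep M))),
        THE u. u \<in> hom Chat (tgt p) (tgt p') \<and> u \<odot> p = p' \<and> u \<odot> q = q' \<odot> snd (lab a))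
       (vcomp (tgt a) M))"

text \<open>The morphism \<open>id\<^bsub>[n]\<^esub> \<rightarrow> w\<close> of \<open>\<V>\<^bsub>[n]\<^esub>\<close> given by the inclusion of the initial position,
  for \<open>w\<close> with initial position \<open>[n]\<close> mapped identically to \<open>[n]\<close>.\<close>

definition from_id :: "nat \<Rightarrow> vobj \<Rightarrow> (vobj, cmor \<times> cmor) arrow" where
  "from_id n w = Arrow (id_view n) (Ide Chat (player n), fst w) w"


section \<open>The functor and the coalgebra of strategies\<close>

definition FF :: "(nat \<Rightarrow> 'x set) \<Rightarrow> nat \<Rightarrow> (nat \<times> (nat \<Rightarrow> cospan set \<Rightarrow> 'x)) set" where
  "FF X n = (SIGMA I:UNIV. {..<I} \<rightarrow>\<^sub>E (\<Pi>\<^sub>E M \<in> Moves n. X (move_cod M)))"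

definition FF_map :: "(nat \<Rightarrow> 'x \<Rightarrow> 'y) \<Rightarrow> nat \<Rightarrow>
    nat \<times> (nat \<Rightarrow> cospan set \<Rightarrow> 'x) \<Rightarrow> nat \<times> (nat \<Rightarrow> cospan set \<Rightarrow> 'y)" where
  "FF_map f n = (\<lambda>(I, \<phi>). (I, \<lambda>i \<in> {..<I}. \<lambda>M \<in> Moves n. f (move_cod M) (\<phi> i M)))"

definition coalgebra ::
  "(nat \<Rightarrow> 'x set) \<Rightarrow> (nat \<Rightarrow> 'x \<Rightarrow> nat \<times> (nat \<Rightarrow> cospan set \<Rightarrow> 'x)) \<Rightarrow> bool" where
  "coalgebra X \<gamma> \<longleftrightarrow> (\<forall>n. \<gamma> n \<in> X n \<rightarrow> FF X n)"

definition coalgebra_hom ::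
  "(nat \<Rightarrow> 'x set) \<Rightarrow> (nat \<Rightarrow> 'x \<Rightarrow> nat \<times> (nat \<Rightarrow> cospan set \<Rightarrow> 'x)) \<Rightarrow>
   (nat \<Rightarrow> 'y set) \<Rightarrow> (nat \<Rightarrow> 'y \<Rightarrow> nat \<times> (nat \<Rightarrow> cospan set \<Rightarrow> 'y)) \<Rightarrow>
   (nat \<Rightarrow> 'x \<Rightarrow> 'y) \<Rightarrow> bool" where
  "coalgebra_hom X \<gamma> Y \<delta> f \<longleftrightarrow>
    (\<forall>n. f n \<in> X n \<rightarrow>\<^sub>E Y n) \<and> (\<forall>n. \<forall>x \<in> X n. \<delta> n (f n x) = FF_map f n (\<gamma> n x))"

text \<open>As an ordered set, a finite set \<open>A\<close> of naturals is the ordinal \<open>card A\<close>; \<open>nth_in A\<close> and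
  \<open>rank_in A\<close> are the mutually inverse order isomorphisms between \<open>{..<card A}\<close> and \<open>A\<close>.\<close>

definition nth_in :: "nat set \<Rightarrow> nat \<Rightarrow> nat" where
  "nth_in A j = sorted_list_of_set A ! j"

definition rank_in :: "nat set \<Rightarrow> nat \<Rightarrow> nat" where
  "rank_in A x = card {y \<in> A. y < x}"

type_synonym strategy = "(vobj, cmor \<times> cmor, nat) psh"

definition Strat :: "nat \<Rightarrow> strategy set" where
  "Strat n = OPsh (\<V> n)"

definition fibre :: "nat \<Rightarrow> strategy \<Rightarrow> nat \<Rightarrow> cospan set \<Rightarrow> vobj \<Rightarrow> nat set" where
  "fibre n S i M v = {x \<in> El S (vcomp v M). Act S (from_id n (vcomp v M)) x = i}"

definition residual :: "nat \<Rightarrow> strategy \<Rightarrow> nat \<Rightarrow> cospan set \<Rightarrow> strategy" where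
  "residual n S i M = \<lparr>
     El = (\<lambda>v. if v \<in> Obj (\<V> (move_cod M)) then {..<card (fibre n S i M v)} else {}),
     Act = (\<lambda>a. if a \<in> Arr (\<V> (move_cod M))
       then (\<lambda>j \<in> {..<card (fibre n S i M (tgt a))}.
               rank_in (fibre n S i M (src a)) (Act S (vcomp_arr a M) (nth_in (fibre n S i M (tgt a)) j)))
       else (\<lambda>_. undefined)) \<rparr>"

definition strat_str :: "nat \<Rightarrow> strategy \<Rightarrow> nat \<times> (nat \<Rightarrow> cospan set \<Rightarrow> strategy)" where
  "strat_str n S =
    (let I = card (El S (id_view n)) in (I, \<lambda>i \<in> {..<I}. \<lambda>M \<in> Moves n. residual n S i M))"

end

theory Submission
  imports Defs "HOL-Library.List_Lexorder" "HOL-Library.Sublist"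
begin

text \<open>A view on \<open>[n]\<close> glues a chain of basic moves end to end, so it represents runs: a morphism from it to
  a presheaf \<open>W\<close> is a player of \<open>W\<close> together with a chain of moves of \<open>W\<close>, of the types prescribed by a
  word, that starts at this player. Pushing out along a move appends or prepends a letter. In a view
  distinct moves have distinct initial players, so a run is determined by its word; hence the
  category of views on \<open>[n]\<close> is a preorder, equivalent to words of moves under the prefix order.

  By monotonicity, a presheaf \<open>S\<close> of finite ordinals on this preorder has as value at \<open>c w\<close> the ordinal
  sum, over \<open>i\<close> in the value at the empty word, of the fibres over \<open>i\<close>, which are the values at \<open>w\<close> of the
  residuals. So \<open>S\<close> is determined by its residuals, letter by letter. Conversely, the sequences of choices along a
  word in an arbitrary coalgebra, ordered lexicographically and truncated along prefixes, form a strategy.\<close>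


section \<open>Categories\<close>

text \<open>Plays are built from chosen pushouts and chosen representatives of moves, so views are
  determined only up to isomorphism. Two facts absorb the coherence this would cost. Views are
  handled through a universal property, \<open>represents\<close>, which does not depend on choices;
  and the category of views turns out thin, so an equation between arrows reduces to comparing
  endpoints. On the side of values, finite ordinals are skeletal and have no order automorphism but
  the identity, so isomorphic views receive equal values and a strategy may be computed on any view
  with the given word.

  An extended move may be pushed out along any map from its interface to a position, which could add
  players or merge channels. In a play that starts from a player this is impossible, since by
  adhesivity nothing can be added without changing the initial position.

  The order is what makes the coalgebra terminal: the sizes of the fibres determine a monotone map
  between finite ordinals, whereas a map of bare sets would be determined only up to a
  permutation.\<close>

locale category =
  fixes D :: "('o, 'd) cat"
  assumes arr_obj: "f \<in> hom D x y \<Longrightarrow> x \<in> Obj D \<and> y \<in> Obj D"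
    and ide_hom: "x \<in> Obj D \<Longrightarrow> Ide D x \<in> hom D x x"
    and comp_hom: "f \<in> hom D x y \<Longrightarrow> g \<in> hom D y z \<Longrightarrow> Comp D g f \<in> hom D x z"
    and ide_comp: "f \<in> hom D x y \<Longrightarrow> Comp D (Ide D y) f = f"
    and comp_ide: "f \<in> hom D x y \<Longrightarrow> Comp D f (Ide D x) = f"
    and comp_assoc: "f \<in> hom D x y \<Longrightarrow> g \<in> hom D y z \<Longrightarrow> h \<in> hom D z w \<Longrightarrow>
      Comp D (Comp D h g) f = Comp D h (Comp D g f)"

lemma hom_iff: "f \<in> hom D x y \<longleftrightarrow> f \<in> Arr D \<and> src f = x \<and> tgt f = y"
  by (auto simp: hom_def)

lemma pushoutI:
  assumes "f \<in> hom D a b" "g \<in> hom D a c" "p \<in> hom D b d" "q \<in> hom D c d"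
    "Comp D p f = Comp D q g"
    and univ: "\<And>e u v. u \<in> hom D b e \<Longrightarrow> v \<in> hom D c e \<Longrightarrow> Comp D u f = Comp D v g \<Longrightarrow>
       \<exists>!w. w \<in> hom D d e \<and> Comp D w p = u \<and> Comp D w q = v"
  shows "is_pushout D f g p q"
proof -
  have "\<exists>!w. w \<in> hom D (tgt p) (tgt u) \<and> Comp D w p = u \<and> Comp D w q = v"
    if "u \<in> Arr D" "v \<in> Arr D" "src u = tgt f" "src v = tgt g" "tgt u = tgt v" "Comp D u f = Comp D v g"
    for u v
    using univ[of u "tgt u" v] that assms(1-4) by (simp add: hom_iff)
  with assms(1-5) show ?thesis
    unfolding is_pushout_def by (simp add: hom_iff)
qed

lemma pushoutE:
  assumes "is_pushout D f g p q"
  obtains a b c d where "f \<in> hom D a b" "g \<in> hom D a c" "p \<in> hom D b d" "q \<in> hom D c d"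
    "Comp D p f = Comp D q g"
  by (rule that[of "src f" "tgt f" "tgt g" "tgt p"]) (use assms in \<open>auto simp: is_pushout_def hom_iff\<close>)

lemma pushout_univ:
  assumes po: "is_pushout D f g p q" and f: "f \<in> hom D a b" and g: "g \<in> hom D a c" and p: "p \<in> hom D b d"
    and u: "u \<in> hom D b e" and v: "v \<in> hom D c e" and uv: "Comp D u f = Comp D v g"
  shows "\<exists>!w. w \<in> hom D d e \<and> Comp D w p = u \<and> Comp D w q = v"
proof -
  have "u \<in> Arr D" "v \<in> Arr D" "src u = tgt f \<and> src v = tgt g \<and> tgt u = tgt v \<and> Comp D u f = Comp D v g"
    and e: "e = tgt u" "d = tgt p"
    using f g p u v uv by (auto simp: hom_iff)
  then show ?thesis using po unfolding is_pushout_def e by blast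
qed

lemma ex1_unique: "\<exists>!x. P x \<Longrightarrow> P a \<Longrightarrow> P b \<Longrightarrow> a = b"
  by blast

lemma hom_unique: "f \<in> hom D x y \<Longrightarrow> f \<in> hom D x' y' \<Longrightarrow> x = x' \<and> y = y'"
  by (auto simp: hom_def)

lemma isoI:
  "f \<in> hom D x y \<Longrightarrow> g \<in> hom D y x \<Longrightarrow> Comp D g f = Ide D x \<Longrightarrow> Comp D f g = Ide D y \<Longrightarrow> iso D f"
  unfolding iso_def by (auto simp: hom_iff)

lemma iso_inverseE:
  assumes "iso D f" "f \<in> hom D x y"
  obtains g where "g \<in> hom D y x" "Comp D g f = Ide D x" "Comp D f g = Ide D y" "iso D g"
proof -
  from assms(1) obtain g where "g \<in> hom D y x" "Comp D g f = Ide D x" "Comp D f g = Ide D y"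
    using assms(2) unfolding iso_def by (auto simp: hom_iff)
  with assms(2) show ?thesis using that isoI by metis
qed

context category begin

lemma iso_ide: "x \<in> Obj D \<Longrightarrow> iso D (Ide D x)"
  using isoI[OF ide_hom ide_hom] ide_comp[OF ide_hom] by blast

lemma iso_comp:
  assumes "iso D f" "iso D g" "f \<in> hom D x y" "g \<in> hom D y z"
  shows "iso D (Comp D g f)"
proof -
  obtain f' where f': "f' \<in> hom D y x" "Comp D f' f = Ide D x" "Comp D f f' = Ide D y"
    using iso_inverseE[OF assms(1,3)] by blast
  obtain g' where g': "g' \<in> hom D z y" "Comp D g' g = Ide D y" "Comp D g g' = Ide D z"
    using iso_inverseE[OF assms(2,4)] by blast
  show ?thesis
  proof (rule isoI)
    show "Comp D g f \<in> hom D x z" "Comp D f' g' \<in> hom D z x"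
      using assms f' g' comp_hom by blast+
    show "Comp D (Comp D f' g') (Comp D g f) = Ide D x"
      using comp_assoc[OF comp_hom[OF assms(3,4)] g'(1) f'(1)] comp_assoc[OF assms(3,4) g'(1)]
        ide_comp[OF assms(3)] f'(2) g'(2) by simp
    show "Comp D (Comp D g f) (Comp D f' g') = Ide D z"
      using comp_assoc[OF comp_hom[OF g'(1) f'(1)] assms(3,4)] comp_assoc[OF g'(1) f'(1) assms(3)]
        ide_comp[OF g'(1)] f'(3) g'(3) by simp
  qed
qed

lemma iso_epi:
  assumes "iso D f" "f \<in> hom D x y" "g \<in> hom D y z" "h \<in> hom D y w" "Comp D g f = Comp D h f"
  shows "g = h"
proof -
  obtain f' where f': "f' \<in> hom D y x" "Comp D f f' = Ide D y"
    using iso_inverseE[OF assms(1,2)] by blast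
  show ?thesis
    using comp_assoc[OF f'(1) assms(2,3)] comp_assoc[OF f'(1) assms(2,4)]
    unfolding f'(2) comp_ide[OF assms(3)] comp_ide[OF assms(4)] assms(5) by (rule trans[OF sym])
qed

section \<open>Pushouts and isomorphisms\<close>

text \<open>This serves to show that plays are closed under isomorphism of the presheaf in which
  they live.\<close>

lemma pushout_iso_target:
  assumes po: "is_pushout D f g p q" and u: "iso D u" "u \<in> hom D (tgt p) y"
  shows "is_pushout D f g (Comp D u p) (Comp D u q)"
  using po
proof (rule pushoutE)
  fix a b c d
  assume f: "f \<in> hom D a b" and g: "g \<in> hom D a c" and p: "p \<in> hom D b d" and q: "q \<in> hom D c d"
    and sq: "Comp D p f = Comp D q g"
  note univ = pushout_univ[OF po f g p]
  have u': "u \<in> hom D d y" using u p by (simp add: hom_iff)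
  obtain k where k: "k \<in> hom D y d" "Comp D k u = Ide D d" "Comp D u k = Ide D y"
    using iso_inverseE[OF u(1) u'] by metis
  show ?thesis
  proof (rule pushoutI[OF f g comp_hom[OF p u'] comp_hom[OF q u']])
    show "Comp D (Comp D u p) f = Comp D (Comp D u q) g"
      by (simp add: comp_assoc[OF f p u'] comp_assoc[OF g q u'] sq)
    fix e s t assume s: "s \<in> hom D b e" and t: "t \<in> hom D c e" and st: "Comp D s f = Comp D t g"
    obtain w where w: "w \<in> hom D d e" "Comp D w p = s" "Comp D w q = t"
      and uniq: "\<And>w'. w' \<in> hom D d e \<Longrightarrow> Comp D w' p = s \<Longrightarrow> Comp D w' q = t \<Longrightarrow> w' = w"
      using univ[OF s t st] by blast
    show "\<exists>!w. w \<in> hom D y e \<and> Comp D w (Comp D u p) = s \<and> Comp D w (Comp D u q) = t"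
    proof (rule ex1I[of _ "Comp D w k"])
      have "Comp D (Comp D w k) u = w"
        by (metis comp_assoc[OF u' k(1) w(1)] k(2) comp_ide[OF w(1)])
      then show "Comp D w k \<in> hom D y e \<and> Comp D (Comp D w k) (Comp D u p) = s \<and>
         Comp D (Comp D w k) (Comp D u q) = t"
        using w comp_hom[OF k(1) w(1)] comp_assoc[OF p u' comp_hom[OF k(1) w(1)]]
          comp_assoc[OF q u' comp_hom[OF k(1) w(1)]] by simp
    next
      fix v assume v: "v \<in> hom D y e \<and> Comp D v (Comp D u p) = s \<and> Comp D v (Comp D u q) = t"
      then have v1: "v \<in> hom D y e" by blast
      have "Comp D v u = w"
        using uniq[OF comp_hom[OF u' v1]] comp_assoc[OF p u' v1] comp_assoc[OF q u' v1] v by simp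
      then show "v = Comp D w k"
        using comp_assoc[OF k(1) u' v1] k(3) comp_ide[OF v1] by simp
    qed
  qed
qed

lemma pushout_unique:
  assumes po: "is_pushout D f g p q" and po': "is_pushout D f g p' q'"
  obtains u where "iso D u" "u \<in> hom D (tgt p) (tgt p')" "Comp D u p = p'" "Comp D u q = q'"
  using po
proof (rule pushoutE)
  fix a b c d
  assume f: "f \<in> hom D a b" and g: "g \<in> hom D a c" and p: "p \<in> hom D b d" and q: "q \<in> hom D c d"
    and sq: "Comp D p f = Comp D q g"
  note univ = pushout_univ[OF po f g p]
  show ?thesis
    using po'
  proof (rule pushoutE)
    fix a' b' c' d'
    assume "f \<in> hom D a' b'" "g \<in> hom D a' c'" and pp: "p' \<in> hom D b' d'" "q' \<in> hom D c' d'"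
      and sq': "Comp D p' f = Comp D q' g"
    then have eq: "a' = a" "b' = b" "c' = c" using f g by (auto simp: hom_iff)
    note p' = pp[unfolded eq] and univ' = pushout_univ[OF po' f g pp(1)[unfolded eq]]
    obtain w where w: "w \<in> hom D d d'" "Comp D w p = p'" "Comp D w q = q'"
      using univ[OF p' sq'] by blast
    obtain k where k: "k \<in> hom D d' d" "Comp D k p' = p" "Comp D k q' = q"
      using univ'[OF p q sq] by blast
    have d: "d \<in> Obj D" "d' \<in> Obj D" using w arr_obj by blast+
    have 1: "Comp D k w = Ide D d"
    proof -
      have "Comp D k w \<in> hom D d d" "Comp D (Comp D k w) p = p" "Comp D (Comp D k w) q = q"
        using w k comp_hom[OF w(1) k(1)] comp_assoc[OF p w(1) k(1)] comp_assoc[OF q w(1) k(1)] by simp_all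
      then show ?thesis
        by (intro ex1_unique[OF univ[OF p q sq]])
          (simp_all add: ide_hom[OF d(1)] ide_comp[OF p] ide_comp[OF q])
    qed
    have 2: "Comp D w k = Ide D d'"
    proof -
      have "Comp D w k \<in> hom D d' d'" "Comp D (Comp D w k) p' = p'" "Comp D (Comp D w k) q' = q'"
        using w k comp_hom[OF k(1) w(1)] comp_assoc[OF p'(1) k(1) w(1)] comp_assoc[OF p'(2) k(1) w(1)]
        by simp_all
      then show ?thesis
        by (intro ex1_unique[OF univ'[OF p' sq']])
          (simp_all add: ide_hom[OF d(2)] ide_comp[OF p'(1)] ide_comp[OF p'(2)])
    qed
    show ?thesis
      using that[OF isoI[OF w(1) k(1) 1 2]] w p p' by (simp add: hom_iff)
  qed
qed

lemma pushout_of_ide: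
  assumes f: "f \<in> hom D a b"
  shows "is_pushout D f (Ide D a) (Ide D b) f"
proof -
  have ab: "a \<in> Obj D" "b \<in> Obj D" using f arr_obj by blast+
  show ?thesis
  proof (rule pushoutI[OF f ide_hom[OF ab(1)] ide_hom[OF ab(2)] f])
    show "Comp D (Ide D b) f = Comp D f (Ide D a)" using ide_comp comp_ide f by metis
    fix e u v assume u: "u \<in> hom D b e" and v: "v \<in> hom D a e" and uv: "Comp D u f = Comp D v (Ide D a)"
    show "\<exists>!w. w \<in> hom D b e \<and> Comp D w (Ide D b) = u \<and> Comp D w f = v"
    proof (rule ex1I[of _ u])
      show "u \<in> hom D b e \<and> Comp D u (Ide D b) = u \<and> Comp D u f = v"
        using u uv comp_ide[OF u] comp_ide[OF v] by simp
    qed (auto simp: comp_ide)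
  qed
qed

lemma pushout_of_iso:
  assumes po: "is_pushout D f g p q" and g: "iso D g"
  shows "iso D p"
  using po
proof (rule pushoutE)
  fix a b c d
  assume f: "f \<in> hom D a b" and ga: "g \<in> hom D a c" and p: "p \<in> hom D b d" and q: "q \<in> hom D c d"
    and sq: "Comp D p f = Comp D q g"
  note univ = pushout_univ[OF po f ga p]
  obtain k where k: "k \<in> hom D c a" "Comp D k g = Ide D a" "Comp D g k = Ide D c"
    using iso_inverseE[OF g ga] by metis
  have ob: "a \<in> Obj D" "b \<in> Obj D" "d \<in> Obj D" using f p arr_obj by blast+
  have fk: "Comp D f k \<in> hom D c b" using comp_hom k(1) f by blast
  \<comment> \<open>The inverse of \<open>p\<close> is the map induced by the identity of
    \<open>b\<close> and by \<open>f\<close> after the inverse of \<open>g\<close>.\<close>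
  have "Comp D (Ide D b) f = Comp D (Comp D f k) g"
    by (metis comp_assoc[OF ga k(1) f] k(2) comp_ide[OF f] ide_comp[OF f])
  then obtain w where w: "w \<in> hom D d b" "Comp D w p = Ide D b" "Comp D w q = Comp D f k"
    using univ[OF ide_hom[OF ob(2)] fk] by blast
  have pw: "Comp D p w \<in> hom D d d" using comp_hom w(1) p by blast
  have 1: "Comp D (Comp D p w) p = p"
    by (metis comp_assoc[OF p w(1) p] w(2) comp_ide[OF p])
  have 2: "Comp D (Comp D p w) q = q"
    by (metis comp_assoc[OF q w(1) p] w(3) comp_assoc[OF k(1) f p] sq comp_assoc[OF k(1) ga q] k(3)
        comp_ide[OF q])
  have "Comp D p w = Ide D d"
    by (rule ex1_unique[OF univ[OF p q sq]])
      (simp_all add: pw 1 2 ide_hom[OF ob(3)] ide_comp[OF p] ide_comp[OF q])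
  then show ?thesis using isoI[OF p w(1) w(2)] by blast
qed

lemma pushout_sym:
  assumes po: "is_pushout D f g p q"
  shows "is_pushout D g f q p"
  using po
proof (rule pushoutE)
  fix a b c d
  assume f: "f \<in> hom D a b" and g: "g \<in> hom D a c" and p: "p \<in> hom D b d" and q: "q \<in> hom D c d"
    and sq: "Comp D p f = Comp D q g"
  show ?thesis
    by (rule pushoutI[OF g f q p sq[symmetric]]) (use pushout_univ[OF po f g p] in \<open>simp add: conj_commute\<close>)
qed

lemma pushout_iso_source:
  assumes po: "is_pushout D f g p q" and x: "iso D x" "x \<in> hom D a' (src f)"
  shows "is_pushout D (Comp D f x) (Comp D g x) p q"
  using po
proof (rule pushoutE)
  fix a b c d
  assume f: "f \<in> hom D a b" and g: "g \<in> hom D a c" and p: "p \<in> hom D b d" and q: "q \<in> hom D c d"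
    and sq: "Comp D p f = Comp D q g"
  note univ = pushout_univ[OF po f g p]
  have x': "x \<in> hom D a' a" using x(2) f by (simp add: hom_iff)
  show ?thesis
  proof (rule pushoutI[OF comp_hom[OF x' f] comp_hom[OF x' g] p q])
    show "Comp D p (Comp D f x) = Comp D q (Comp D g x)"
      using comp_assoc[OF x' f p] comp_assoc[OF x' g q] sq by simp
    fix e u v assume u: "u \<in> hom D b e" and v: "v \<in> hom D c e" and "Comp D u (Comp D f x) = Comp D v (Comp D g x)"
    then have "Comp D (Comp D u f) x = Comp D (Comp D v g) x"
      using comp_assoc[OF x' f u] comp_assoc[OF x' g v] by simp
    then have "Comp D u f = Comp D v g" by (rule iso_epi[OF x(1) x' comp_hom[OF f u] comp_hom[OF g v]])
    then show "\<exists>!w. w \<in> hom D d e \<and> Comp D w p = u \<and> Comp D w q = v" by (rule univ[OF u v])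
  qed
qed

text \<open>A representative of a move differs from the cospan of representables by an isomorphism
  \<open>k\<close>. Moving \<open>k\<close> from the span to the cocone turns a pushout along an
  arbitrary representative into one along the leg \<open>t\<close> between representables.\<close>

lemma pushout_iso_span:
  assumes po: "is_pushout D (Comp D k t) i p q" and k: "iso D k" "k \<in> hom D b b'" and t: "t \<in> hom D a b"
  shows "is_pushout D t i (Comp D p k) q"
  using po
proof (rule pushoutE)
  fix a0 b0 c d
  assume kt: "Comp D k t \<in> hom D a0 b0" and "i \<in> hom D a0 c" and "p \<in> hom D b0 d" and q: "q \<in> hom D c d"
    and sq: "Comp D p (Comp D k t) = Comp D q i"
  moreover have e: "a0 = a" "b0 = b'" using hom_unique[OF kt comp_hom[OF t k(2)]] by auto
  ultimately have i: "i \<in> hom D a c" and p: "p \<in> hom D b' d" by auto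
  note univ = pushout_univ[OF po kt[unfolded e] i p]
  obtain h where h: "h \<in> hom D b' b" "Comp D h k = Ide D b" "Comp D k h = Ide D b'"
    using iso_inverseE[OF k] by metis
  show ?thesis
  proof (rule pushoutI[OF t i comp_hom[OF k(2) p] q])
    show "Comp D (Comp D p k) t = Comp D q i" using sq comp_assoc[OF t k(2) p] by simp
    fix e u v assume u: "u \<in> hom D b e" and v: "v \<in> hom D c e" and uv: "Comp D u t = Comp D v i"
    have uh: "Comp D u h \<in> hom D b' e" using comp_hom h u by blast
    have uhk: "Comp D (Comp D u h) k = u"
      by (metis comp_assoc[OF k(2) h(1) u] h(2) comp_ide[OF u])
    have "Comp D (Comp D u h) (Comp D k t) = Comp D v i"
      using comp_assoc[OF t k(2) uh] uhk uv by simp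
    then have "\<exists>!w. w \<in> hom D d e \<and> Comp D w p = Comp D u h \<and> Comp D w q = v"
      using univ[OF uh v] by blast
    moreover have "Comp D w p = Comp D u h \<longleftrightarrow> Comp D w (Comp D p k) = u" if w: "w \<in> hom D d e" for w
    proof
      assume "Comp D w p = Comp D u h"
      then show "Comp D w (Comp D p k) = u" using comp_assoc[OF k(2) p w] uhk by simp
    next
      assume "Comp D w (Comp D p k) = u"
      then show "Comp D w p = Comp D u h"
        using comp_assoc[OF k(2) p w] comp_assoc[OF h(1) k(2) comp_hom[OF p w]] h(3)
          comp_ide[OF comp_hom[OF p w]] by simp
    qed
    ultimately show "\<exists>!w. w \<in> hom D d e \<and> Comp D w (Comp D p k) = u \<and> Comp D w q = v"
      by (simp cong: conj_cong)
  qed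
qed

end


section \<open>Presheaves\<close>

lemma Psh_hom_iff: "f \<in> hom (Psh D) P Q \<longleftrightarrow>
    presheaf D P \<and> presheaf D Q \<and> nat_trans D P Q (lab f) \<and> src f = P \<and> tgt f = Q"
  by (cases f) (auto simp: Psh_def hom_iff)

lemma Psh_obj [simp]: "P \<in> Obj (Psh D) \<longleftrightarrow> presheaf D P"
  by (simp add: Psh_def)

lemma Psh_homI:
  assumes "presheaf D P" "presheaf D Q"
    "\<And>x e. e \<in> El P x \<Longrightarrow> \<phi> x e \<in> El Q x"
    "\<And>h x y e. h \<in> hom D x y \<Longrightarrow> e \<in> El P y \<Longrightarrow> \<phi> x (Act P h e) = Act Q h (\<phi> y e)"
  shows "Arrow P (\<lambda>x. restrict (\<phi> x) (El P x)) Q \<in> hom (Psh D) P Q"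
proof -
  have "Act P h e \<in> El P (src h)" if "h \<in> Arr D" "e \<in> El P (tgt h)" for h e
    using assms(1) that by (auto simp: presheaf_def PiE_iff)
  then show ?thesis
    unfolding Psh_hom_iff nat_trans_def using assms by (auto simp: hom_iff)
qed

lemma lab_in: "f \<in> hom (Psh D) P Q \<Longrightarrow> e \<in> El P x \<Longrightarrow> lab f x e \<in> El Q x"
  by (auto simp: Psh_hom_iff nat_trans_def PiE_iff)

lemma lab_Act: "f \<in> hom (Psh D) P Q \<Longrightarrow> h \<in> hom D x y \<Longrightarrow> e \<in> El P y \<Longrightarrow>
    lab f x (Act P h e) = Act Q h (lab f y e)"
  unfolding Psh_hom_iff nat_trans_def by (auto simp: hom_iff)

lemma lab_comp: "f \<in> hom (Psh D) P Q \<Longrightarrow> e \<in> El P x \<Longrightarrow>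
    lab (Comp (Psh D) g f) x e = lab g x (lab f x e)"
  by (auto simp: Psh_def hom_iff compose_def)

lemma lab_ide: "e \<in> El P x \<Longrightarrow> lab (Ide (Psh D) P) x e = e"
  by (simp add: Psh_def)

text \<open>Agreement on elements suffices because \<open>nat_trans\<close> makes each component
  extensional, hence \<open>undefined\<close> off the elements.\<close>

lemma Psh_ext:
  assumes "f \<in> hom (Psh D) P Q" "g \<in> hom (Psh D) P Q"
    "\<And>x e. e \<in> El P x \<Longrightarrow> lab f x e = lab g x e"
  shows "f = g"
proof -
  have "lab f x = lab g x" for x
    by (rule extensionalityI[of _ "El P x"])
      (use assms in \<open>auto simp: Psh_hom_iff nat_trans_def PiE_iff\<close>)
  then show ?thesis using assms(1,2) by (cases f; cases g) (auto simp: Psh_hom_iff)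
qed

lemma Act_in: "presheaf D P \<Longrightarrow> h \<in> hom D x y \<Longrightarrow> e \<in> El P y \<Longrightarrow> Act P h e \<in> El P x"
  by (auto simp: presheaf_def hom_iff PiE_iff)

lemma Act_ide: "presheaf D P \<Longrightarrow> e \<in> El P x \<Longrightarrow> Act P (Ide D x) e = e"
  unfolding presheaf_def by blast

lemma Act_comp: "presheaf D P \<Longrightarrow> f \<in> hom D x y \<Longrightarrow> g \<in> hom D y z \<Longrightarrow> e \<in> El P z \<Longrightarrow>
    Act P (Comp D g f) e = Act P f (Act P g e)"
  by (auto simp: presheaf_def hom_iff)

lemma El_obj: "presheaf D P \<Longrightarrow> e \<in> El P x \<Longrightarrow> x \<in> Obj D"
  by (auto simp: presheaf_def)

lemma Psh_hom_presheaf: "f \<in> hom (Psh D) P Q \<Longrightarrow> presheaf D P \<and> presheaf D Q"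
  by (simp add: Psh_hom_iff)

context category begin

lemma presheafI:
  assumes "\<And>x. x \<notin> Obj D \<Longrightarrow> El P x = {}" "\<And>f. f \<notin> Arr D \<Longrightarrow> Act P f = (\<lambda>_. undefined)"
    "\<And>f. f \<in> Arr D \<Longrightarrow> Act P f \<in> extensional (El P (tgt f))"
    "\<And>f x y e. f \<in> hom D x y \<Longrightarrow> e \<in> El P y \<Longrightarrow> Act P f e \<in> El P x"
    "\<And>x e. e \<in> El P x \<Longrightarrow> Act P (Ide D x) e = e"
    "\<And>f g x y z e. f \<in> hom D x y \<Longrightarrow> g \<in> hom D y z \<Longrightarrow> e \<in> El P z \<Longrightarrow>
       Act P (Comp D g f) e = Act P f (Act P g e)"
  shows "presheaf D P"
  unfolding presheaf_def using assms by (auto simp: hom_iff PiE_iff)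

lemma Psh_ide_hom: "presheaf D P \<Longrightarrow> Ide (Psh D) P \<in> hom (Psh D) P P"
  using Psh_homI[of D P P "\<lambda>x e. e"] by (simp add: Psh_def)

lemma Psh_comp_hom:
  assumes f: "f \<in> hom (Psh D) P Q" and g: "g \<in> hom (Psh D) Q R"
  shows "Comp (Psh D) g f \<in> hom (Psh D) P R"
proof -
  have "Comp (Psh D) g f = Arrow P (\<lambda>x. restrict (\<lambda>e. lab g x (lab f x e)) (El P x)) R"
    using f g by (simp add: Psh_def compose_def hom_iff)
  also have "\<dots> \<in> hom (Psh D) P R"
  proof (rule Psh_homI)
    show "lab g x (lab f x e) \<in> El R x" if "e \<in> El P x" for x e
      using lab_in[OF g lab_in[OF f that]] .
    show "lab g x (lab f x (Act P h e)) = Act R h (lab g y (lab f y e))"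
      if "h \<in> hom D x y" "e \<in> El P y" for h x y e
      using lab_Act[OF f that] lab_Act[OF g that(1) lab_in[OF f that(2)]] by simp
  qed (use f g in \<open>simp_all add: Psh_hom_iff\<close>)
  finally show ?thesis .
qed

lemma Psh_ide_comp:
  assumes f: "f \<in> hom (Psh D) P Q"
  shows "Comp (Psh D) (Ide (Psh D) Q) f = f"
proof (rule Psh_ext[OF Psh_comp_hom[OF f Psh_ide_hom] f])
  show "lab (Comp (Psh D) (Ide (Psh D) Q) f) x e = lab f x e" if "e \<in> El P x" for x e
    using lab_comp[OF f that] lab_ide[OF lab_in[OF f that]] by simp
qed (use f in \<open>simp add: Psh_hom_iff\<close>)

lemma Psh_comp_ide:
  assumes f: "f \<in> hom (Psh D) P Q"
  shows "Comp (Psh D) f (Ide (Psh D) P) = f"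
proof -
  have i: "Ide (Psh D) P \<in> hom (Psh D) P P"
    using Psh_ide_hom Psh_hom_presheaf[OF f] by blast
  show ?thesis
    by (rule Psh_ext[OF Psh_comp_hom[OF i f] f]) (simp add: lab_comp[OF i] lab_ide)
qed

lemma Psh_comp_assoc:
  assumes f: "f \<in> hom (Psh D) P Q" and g: "g \<in> hom (Psh D) Q R" and h: "h \<in> hom (Psh D) R T"
  shows "Comp (Psh D) (Comp (Psh D) h g) f = Comp (Psh D) h (Comp (Psh D) g f)"
proof (rule Psh_ext[OF Psh_comp_hom[OF f Psh_comp_hom[OF g h]] Psh_comp_hom[OF Psh_comp_hom[OF f g] h]])
  fix x e assume e: "e \<in> El P x"
  show "lab (Comp (Psh D) (Comp (Psh D) h g) f) x e = lab (Comp (Psh D) h (Comp (Psh D) g f)) x e"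
    unfolding lab_comp[OF f e] lab_comp[OF g lab_in[OF f e]] lab_comp[OF Psh_comp_hom[OF f g] e] ..
qed

lemma category_Psh: "category (Psh D)"
  apply (rule category.intro)
       apply (simp add: Psh_hom_presheaf)
      apply (simp add: Psh_ide_hom)
     apply (erule (1) Psh_comp_hom)
    apply (erule Psh_ide_comp)
   apply (erule Psh_comp_ide)
  apply (erule (2) Psh_comp_assoc)
  done

lemma iso_bij:
  assumes f: "iso (Psh D) f" "f \<in> hom (Psh D) P Q"
  shows "bij_betw (lab f x) (El P x) (El Q x)"
proof -
  obtain g where g: "g \<in> hom (Psh D) Q P" "Comp (Psh D) g f = Ide (Psh D) P" "Comp (Psh D) f g = Ide (Psh D) Q"
    using iso_inverseE[OF f] by blast
  show ?thesis
  proof (rule bij_betw_byWitness[of _ "lab g x"])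
    show "\<forall>a\<in>El P x. lab g x (lab f x a) = a" using lab_comp[OF f(2)] g(2) lab_ide by metis
    show "\<forall>a\<in>El Q x. lab f x (lab g x a) = a" using lab_comp[OF g(1)] g(3) lab_ide by metis
  qed (use lab_in[OF f(2)] lab_in[OF g(1)] in auto)
qed

lemma bij_iso:
  assumes f: "f \<in> hom (Psh D) P Q" and bij: "\<And>x. bij_betw (lab f x) (El P x) (El Q x)"
  shows "iso (Psh D) f"
proof -
  define k where "k x = inv_into (El P x) (lab f x)" for x
  define g where "g = Arrow Q (\<lambda>x. restrict (k x) (El Q x)) P"
  have k: "k x e \<in> El P x" "lab f x (k x e) = e" if "e \<in> El Q x" for x e
    using bij_betw_inv_into_right[OF bij that] bij_betwE[OF bij_betw_inv_into[OF bij]] that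
    by (auto simp: k_def)
  have kf: "k x (lab f x e) = e" if "e \<in> El P x" for x e
    using bij_betw_inv_into_left[OF bij that] by (simp add: k_def)
  have p: "presheaf D P" "presheaf D Q" using f by (auto simp: Psh_hom_iff)
  have g: "g \<in> hom (Psh D) Q P"
    unfolding g_def
  proof (rule Psh_homI[OF p(2,1) k(1)])
    fix h x y e assume h: "h \<in> hom D x y" "e \<in> El Q y"
    have "Act Q h e = lab f x (Act P h (k y e))"
      using lab_Act[OF f h(1) k(1)] k(2) h(2) by simp
    then show "k x (Act Q h e) = Act P h (k y e)"
      using kf Act_in[OF p(1) h(1)] k(1) h(2) by simp
  qed
  have lg: "lab g x e = k x e" if "e \<in> El Q x" for x e using that by (simp add: g_def)
  show ?thesis
  proof (rule isoI[OF f g])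
    show "Comp (Psh D) g f = Ide (Psh D) P"
      by (rule Psh_ext[OF Psh_comp_hom[OF f g] Psh_ide_hom])
        (use p in \<open>auto simp: lab_comp[OF f] lab_ide lg lab_in[OF f] kf\<close>)
    show "Comp (Psh D) f g = Ide (Psh D) Q"
      by (rule Psh_ext[OF Psh_comp_hom[OF g f] Psh_ide_hom])
        (use p in \<open>auto simp: lab_comp[OF g] lab_ide lg k\<close>)
  qed
qed

subsection \<open>The Yoneda lemma\<close>

lemma El_yo [simp]: "El (yo D c) x = hom D x c"
  by (simp add: yo_def)

lemma Act_yo: "f \<in> hom D x y \<Longrightarrow> g \<in> hom D y c \<Longrightarrow> Act (yo D c) f g = Comp D g f"
  by (simp add: yo_def hom_iff)

lemma presheaf_yo: "presheaf D (yo D c)"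
proof (rule presheafI)
  show "El (yo D c) x = {}" if "x \<notin> Obj D" for x
    using that arr_obj by auto
  show "Act (yo D c) f = (\<lambda>_. undefined)" if "f \<notin> Arr D" for f
    using that by (simp add: yo_def)
  show "Act (yo D c) f \<in> extensional (El (yo D c) (tgt f))" if "f \<in> Arr D" for f
    using that by (simp add: yo_def)
  show "Act (yo D c) f e \<in> El (yo D c) x" if "f \<in> hom D x y" "e \<in> El (yo D c) y" for f x y e
    using that by (simp add: Act_yo comp_hom)
  show "Act (yo D c) (Ide D x) e = e" if "e \<in> El (yo D c) x" for x e
    using that arr_obj[of e] Act_yo[OF ide_hom, of x e c] comp_ide by simp
  show "Act (yo D c) (Comp D g f) e = Act (yo D c) f (Act (yo D c) g e)"
    if f: "f \<in> hom D x y" and g: "g \<in> hom D y z" and "e \<in> El (yo D c) z" for f g x y z e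
  proof -
    have e: "e \<in> hom D z c" using that by simp
    show ?thesis
      using Act_yo[OF comp_hom[OF f g] e] Act_yo[OF g e] Act_yo[OF f comp_hom[OF g e]] comp_assoc[OF f g e]
      by simp
  qed
qed

text \<open>The morphism out of a representable that corresponds to the element \<open>w\<close>
  under the Yoneda lemma.\<close>

definition elem_map :: "'o \<Rightarrow> ('o, 'd, ('o, 'd) arrow) psh \<Rightarrow> ('o, 'd) arrow \<Rightarrow>
    (('o, 'd, ('o, 'd) arrow) psh, 'o \<Rightarrow> ('o, 'd) arrow \<Rightarrow> ('o, 'd) arrow) arrow" where
  "elem_map c W w = Arrow (yo D c) (\<lambda>x. \<lambda>f \<in> El (yo D c) x. Act W f w) W"

lemma elem_map_hom:
  assumes W: "presheaf D W" and w: "w \<in> El W c"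
  shows "elem_map c W w \<in> hom (Psh D) (yo D c) W"
  unfolding elem_map_def
proof (rule Psh_homI[OF presheaf_yo W])
  show "Act W e w \<in> El W x" if "e \<in> El (yo D c) x" for x e
    using Act_in[OF W _ w] that by simp
  show "Act W (Act (yo D c) h e) w = Act W h (Act W e w)"
    if h: "h \<in> hom D x y" and e: "e \<in> El (yo D c) y" for h x y e
    using Act_comp[OF W h _ w, of e] Act_yo[OF h, of e] e by simp
qed

lemma lab_elem_map: "g \<in> hom D x c \<Longrightarrow> lab (elem_map c W w) x g = Act W g w"
  by (simp add: elem_map_def)

lemma lab_elem_map_ide: "presheaf D W \<Longrightarrow> w \<in> El W c \<Longrightarrow> lab (elem_map c W w) c (Ide D c) = w"
  using lab_elem_map[OF ide_hom[OF El_obj]] Act_ide by metis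

lemma lab_yo_hom:
  assumes f: "f \<in> hom (Psh D) (yo D c) W" and g: "g \<in> hom D x c"
  shows "lab f x g = Act W g (lab f c (Ide D c))"
proof -
  have c: "c \<in> Obj D" using g arr_obj by blast
  have "Act (yo D c) g (Ide D c) = g" using Act_yo[OF g ide_hom[OF c]] ide_comp[OF g] by simp
  then show ?thesis using lab_Act[OF f g, of "Ide D c"] ide_hom[OF c] by simp
qed

lemma yo_hom_eqI:
  assumes "f \<in> hom (Psh D) (yo D c) W" "g \<in> hom (Psh D) (yo D c) W"
    "lab f c (Ide D c) = lab g c (Ide D c)"
  shows "f = g"
  by (rule Psh_ext[OF assms(1,2)]) (simp add: lab_yo_hom[OF assms(1)] lab_yo_hom[OF assms(2)] assms(3))

lemma yo_map_hom:
  assumes g: "g \<in> hom D x y"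
  shows "yo_map D g \<in> hom (Psh D) (yo D x) (yo D y)"
proof -
  have "yo_map D g = elem_map x (yo D y) g"
    using g by (auto simp: yo_map_def elem_map_def hom_iff Act_yo intro!: ext restrict_ext)
  then show ?thesis using elem_map_hom[OF presheaf_yo, of g y x] g by simp
qed

lemma lab_yo_map: "g \<in> hom D x y \<Longrightarrow> f \<in> hom D z x \<Longrightarrow> lab (yo_map D g) z f = Comp D g f"
  by (simp add: yo_map_def hom_iff)

lemma lab_comp_yo_map:
  assumes f: "f \<in> hom (Psh D) (yo D y) W" and g: "g \<in> hom D x y"
  shows "lab (Comp (Psh D) f (yo_map D g)) x (Ide D x) = Act W g (lab f y (Ide D y))"
proof -
  have "Ide D x \<in> hom D x x" using g arr_obj ide_hom by blast
  then show ?thesis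
    using lab_comp[OF yo_map_hom[OF g]] lab_yo_map[OF g] comp_ide[OF g] lab_yo_hom[OF f g] by simp
qed

end


subsection \<open>Pushouts of presheaves\<close>

text \<open>The universal property of the quotient by the equivalence relation that \<open>R\<close>
  generates, in the form used to define maps out of pushouts.\<close>

lemma symmetric_closure_respects:
  assumes "(u, v) \<in> (R \<union> R\<inverse>)\<^sup>*" "\<And>a b. (a, b) \<in> R \<Longrightarrow> F a = F b"
  shows "F u = F v"
  using assms(1) by (induction rule: rtrancl_induct) (auto simp: assms(2))

text \<open>Pushouts are computed pointwise, the injection of the sum of two copies of the element type
  into itself making room for the quotient of the coproduct. The last two conjuncts are the
  adhesivity of sets, at those stages where the first leg of the span is injective.\<close>

lemma (in category) pushout_exists:
  fixes j :: "'e + 'e \<Rightarrow> 'e" and A B C :: "('o, 'd, 'e) psh"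
  assumes j: "inj j" and f: "f \<in> hom (Psh D) A B" and g: "g \<in> hom (Psh D) A C"
  shows "\<exists>p q. is_pushout (Psh D) f g p q \<and>
    (\<forall>x. El (tgt p) x \<subseteq> lab p x ` El B x \<union> lab q x ` El C x) \<and>
    (\<forall>x. inj_on (lab f x) (El A x) \<longrightarrow> inj_on (lab q x) (El C x) \<and>
      (\<forall>b \<in> El B x. \<forall>c \<in> El C x. lab p x b = lab q x c \<longrightarrow>
         (\<exists>a \<in> El A x. b = lab f x a \<and> c = lab g x a)))"
proof -
  have psh: "presheaf D A" "presheaf D B" "presheaf D C" using f g by (auto simp: Psh_hom_iff)
  define U where "U x = El B x <+> El C x" for x
  have U: "b \<in> El B x \<Longrightarrow> Inl b \<in> U x" "c \<in> El C x \<Longrightarrow> Inr c \<in> U x" for x b c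
    by (auto simp: U_def)
  define R :: "'o \<Rightarrow> (('e + 'e) \<times> ('e + 'e)) set" where
    "R x = {(Inl (lab f x a), Inr (lab g x a)) | a. a \<in> El A x}" for x
  define E where "E x = (R x \<union> (R x)\<inverse>)\<^sup>*" for x
  have sym: "(v, u) \<in> E x" if "(u, v) \<in> E x" for x u v
    using that unfolding E_def by (rule symD[OF sym_rtrancl[OF sym_Un_converse]])
  have trans: "(u, w) \<in> E x" if "(u, v) \<in> E x" "(v, w) \<in> E x" for x u v w
    using that unfolding E_def by (rule rtrancl_trans)
  define k where "k x u = j (SOME v. (u, v) \<in> E x)" for x u
  have some: "(u, SOME v. (u, v) \<in> E x) \<in> E x" for u x
    by (rule someI[of _ u]) (simp add: E_def)
  have k_eq: "k x u = k x v \<longleftrightarrow> (u, v) \<in> E x" for x u v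
  proof
    assume "k x u = k x v"
    then have "(SOME w. (u, w) \<in> E x) = (SOME w. (v, w) \<in> E x)"
      using j by (auto simp: k_def dest: injD)
    then show "(u, v) \<in> E x" using trans[OF some[of u x]] sym[OF some[of v x]] by simp
  next
    assume "(u, v) \<in> E x"
    then have "(\<lambda>w. (u, w) \<in> E x) = (\<lambda>w. (v, w) \<in> E x)" by (intro ext iffI) (rule trans[OF sym], assumption+, rule trans)
    then show "k x u = k x v" by (simp add: k_def)
  qed
  define au where "au h = map_sum (Act B h) (Act C h)" for h
  have au_U: "au h u \<in> U x" if "h \<in> hom D x y" "u \<in> U y" for h x y u
    using that Act_in[OF psh(2)] Act_in[OF psh(3)] by (auto simp: U_def au_def)
  have R_k: "k x (Inl (lab f x a)) = k x (Inr (lab g x a))" if "a \<in> El A x" for x a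
    unfolding k_eq E_def using that by (auto simp: R_def)
  have au_k: "k x (au h u) = k x (au h v)" if h: "h \<in> hom D x y" and uv: "k y u = k y v" for h x y u v
  proof (rule symmetric_closure_respects[of u v "R y"])
    show "(u, v) \<in> (R y \<union> (R y)\<inverse>)\<^sup>*" using uv k_eq E_def by blast
    have "k x (au h (Inl (lab f y a))) = k x (au h (Inr (lab g y a)))" if a: "a \<in> El A y" for a
      using R_k[OF Act_in[OF psh(1) h a]] lab_Act[OF f h a] lab_Act[OF g h a] by (simp add: au_def)
    then show "k x (au h b) = k x (au h c)" if "(b, c) \<in> R y" for b c using that by (auto simp: R_def)
  qed
  \<comment> \<open>The action of \<open>Q\<close> and the maps out of \<open>Q\<close> are defined
    on representatives picked here; \<open>au_k\<close> and \<open>cp_k\<close> make them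
    independent of the choice.\<close>
  define pick where "pick x e = (SOME u. u \<in> U x \<and> k x u = e)" for x e
  have pick: "pick x (k x u) \<in> U x" "k x (pick x (k x u)) = k x u" if "u \<in> U x" for x u
    using someI[of "\<lambda>v. v \<in> U x \<and> k x v = k x u" u] that by (auto simp: pick_def)
  define Q :: "('o, 'd, 'e) psh" where "Q = \<lparr>El = \<lambda>x. k x ` U x,
     Act = \<lambda>h. if h \<in> Arr D then \<lambda>e \<in> k (tgt h) ` U (tgt h). k (src h) (au h (pick (tgt h) e))
       else (\<lambda>_. undefined)\<rparr>"
  have Q_El: "El Q x = k x ` U x" for x by (simp add: Q_def)
  have Q_Act: "Act Q h (k y u) = k x (au h u)" if h: "h \<in> hom D x y" and u: "u \<in> U y" for h x y u
    using h u au_k[OF h pick(2)[OF u]] by (simp add: Q_def hom_iff)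
  have Q: "presheaf D Q"
  proof (rule presheafI)
    show "El Q x = {}" if "x \<notin> Obj D" for x
      using that psh by (auto simp: Q_El U_def dest: El_obj)
    show "Act Q h = (\<lambda>_. undefined)" if "h \<notin> Arr D" for h using that by (simp add: Q_def)
    show "Act Q h \<in> extensional (El Q (tgt h))" if "h \<in> Arr D" for h using that by (simp add: Q_def)
    show "Act Q h e \<in> El Q x" if h: "h \<in> hom D x y" and "e \<in> El Q y" for h x y e
      using that Q_Act[OF h] au_U[OF h] by (auto simp: Q_El)
    show "Act Q (Ide D x) e = e" if e: "e \<in> El Q x" for x e
    proof -
      obtain u where u: "u \<in> U x" "e = k x u" using e by (auto simp: Q_El)
      then have x: "x \<in> Obj D" using psh by (auto simp: U_def dest: El_obj)
      have "au (Ide D x) u = u" using u psh by (auto simp: au_def U_def Act_ide)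
      then show ?thesis using Q_Act[OF ide_hom[OF x] u(1)] u by simp
    qed
    show "Act Q (Comp D h' h) e = Act Q h (Act Q h' e)"
      if h: "h \<in> hom D x y" and h': "h' \<in> hom D y z" and e: "e \<in> El Q z" for h h' x y z e
    proof -
      obtain u where u: "u \<in> U z" "e = k z u" using e by (auto simp: Q_El)
      have "au (Comp D h' h) u = au h (au h' u)"
        using u Act_comp[OF psh(2) h h'] Act_comp[OF psh(3) h h'] by (auto simp: au_def U_def)
      then show ?thesis
        using Q_Act[OF comp_hom[OF h h'] u(1)] Q_Act[OF h' u(1)] Q_Act[OF h au_U[OF h' u(1)]] u(2) by simp
    qed
  qed
  define p where "p = Arrow B (\<lambda>x. restrict (\<lambda>b. k x (Inl b)) (El B x)) Q"
  define q where "q = Arrow C (\<lambda>x. restrict (\<lambda>c. k x (Inr c)) (El C x)) Q"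
  have lp: "lab p x b = k x (Inl b)" if "b \<in> El B x" for x b using that by (simp add: p_def)
  have lq: "lab q x c = k x (Inr c)" if "c \<in> El C x" for x c using that by (simp add: q_def)
  have p: "p \<in> hom (Psh D) B Q" unfolding p_def
  proof (rule Psh_homI[OF psh(2) Q])
    show "k x (Inl (Act B h e)) = Act Q h (k y (Inl e))" if "h \<in> hom D x y" "e \<in> El B y" for h x y e
      using Q_Act[OF that(1) U(1)[OF that(2)]] by (simp add: au_def)
  qed (auto simp: Q_El U_def)
  have q: "q \<in> hom (Psh D) C Q" unfolding q_def
  proof (rule Psh_homI[OF psh(3) Q])
    show "k x (Inr (Act C h e)) = Act Q h (k y (Inr e))" if "h \<in> hom D x y" "e \<in> El C y" for h x y e
      using Q_Act[OF that(1) U(2)[OF that(2)]] by (simp add: au_def)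
  qed (auto simp: Q_El U_def)
  have cover: "El Q x \<subseteq> lab p x ` El B x \<union> lab q x ` El C x" for x
  proof
    fix e assume "e \<in> El Q x"
    then obtain u where "u \<in> U x" "e = k x u" by (auto simp: Q_El)
    then show "e \<in> lab p x ` El B x \<union> lab q x ` El C x"
      by (auto simp: U_def lp[symmetric] lq[symmetric])
  qed
  have po: "is_pushout (Psh D) f g p q"
  proof (rule pushoutI[OF f g p q])
    show "Comp (Psh D) p f = Comp (Psh D) q g"
      by (rule Psh_ext[OF Psh_comp_hom[OF f p] Psh_comp_hom[OF g q]])
        (simp add: lab_comp[OF f] lab_comp[OF g] lp lq lab_in[OF f] lab_in[OF g] R_k)
    fix T s t assume s: "s \<in> hom (Psh D) B T" and t: "t \<in> hom (Psh D) C T"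
      and st: "Comp (Psh D) s f = Comp (Psh D) t g"
    define cp where "cp x = case_sum (lab s x) (lab t x)" for x
    have T: "presheaf D T" using s by (simp add: Psh_hom_iff)
    have cp_k: "cp x u = cp x v" if "k x u = k x v" for x u v
    proof (rule symmetric_closure_respects[of u v "R x"])
      show "(u, v) \<in> (R x \<union> (R x)\<inverse>)\<^sup>*" using that k_eq E_def by blast
      have "cp x (Inl (lab f x a)) = cp x (Inr (lab g x a))" if "a \<in> El A x" for a
        using lab_comp[OF f that] lab_comp[OF g that] st by (metis cp_def sum.case)
      then show "cp x b = cp x c" if "(b, c) \<in> R x" for b c using that by (auto simp: R_def)
    qed
    define w where "w = Arrow Q (\<lambda>x. restrict (\<lambda>e. cp x (pick x e)) (El Q x)) T"
    have pk: "cp x (pick x (k x u)) = cp x u" if "u \<in> U x" for x u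
      using cp_k pick(2)[OF that] by blast
    have lw: "lab w x (k x u) = cp x u" if "u \<in> U x" for x u
      using that pk[OF that] by (simp add: w_def Q_El)
    have w: "w \<in> hom (Psh D) Q T" unfolding w_def
    proof (rule Psh_homI[OF Q T])
      show "cp x (pick x e) \<in> El T x" if e: "e \<in> El Q x" for x e
      proof -
        obtain u where u: "u \<in> U x" "e = k x u" using e by (auto simp: Q_El)
        then show ?thesis using pk[OF u(1)] lab_in[OF s] lab_in[OF t] by (auto simp: U_def cp_def)
      qed
      show "cp x (pick x (Act Q h e)) = Act T h (cp y (pick y e))"
        if h: "h \<in> hom D x y" and e: "e \<in> El Q y" for h x y e
      proof -
        obtain u where u: "u \<in> U y" "e = k y u" using e by (auto simp: Q_El)
        have "cp x (au h u) = Act T h (cp y u)"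
          using u lab_Act[OF s h] lab_Act[OF t h] by (auto simp: U_def cp_def au_def)
        then show ?thesis using u Q_Act[OF h u(1)] pk[OF au_U[OF h u(1)]] pk[OF u(1)] by simp
      qed
    qed
    have wp: "Comp (Psh D) w p = s"
      by (rule Psh_ext[OF Psh_comp_hom[OF p w] s]) (simp add: lab_comp[OF p] lp lw U cp_def)
    have wq: "Comp (Psh D) w q = t"
      by (rule Psh_ext[OF Psh_comp_hom[OF q w] t]) (simp add: lab_comp[OF q] lq lw U cp_def)
    show "\<exists>!w. w \<in> hom (Psh D) Q T \<and> Comp (Psh D) w p = s \<and> Comp (Psh D) w q = t"
    proof (rule ex1I[of _ w])
      fix v assume "v \<in> hom (Psh D) Q T \<and> Comp (Psh D) v p = s \<and> Comp (Psh D) v q = t"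
      then have v: "v \<in> hom (Psh D) Q T" "Comp (Psh D) v p = s" "Comp (Psh D) v q = t" by auto
      show "v = w"
      proof (rule Psh_ext[OF v(1) w])
        fix x e assume "e \<in> El Q x"
        then consider b where "b \<in> El B x" "e = lab p x b" | c where "c \<in> El C x" "e = lab q x c"
          using cover by blast
        then show "lab v x e = lab w x e"
          using lab_comp[OF p] lab_comp[OF q] v(2,3) wp wq by cases metis+
      qed
    qed (use w wp wq in simp)
  qed
  have amalg: "inj_on (lab q x) (El C x) \<and>
      (\<forall>b \<in> El B x. \<forall>c \<in> El C x. lab p x b = lab q x c \<longrightarrow> (\<exists>a \<in> El A x. b = lab f x a \<and> c = lab g x a))"
    if inj: "inj_on (lab f x) (El A x)" for x
  proof -
    \<comment> \<open>A normal form for classes: as \<open>f\<close> is injective at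
      \<open>x\<close>, an element of \<open>B\<close> in its image can be moved back to
      \<open>A\<close> and on to \<open>C\<close>. \<open>F\<close> is constant on classes and
      injective on the copy of \<open>C\<close>, and it sends \<open>Inl b\<close> into that copy
      only for \<open>b\<close> in the image of \<open>f\<close>; the two claims follow.\<close>
    define F :: "'e + 'e \<Rightarrow> 'e + 'e" where "F = case_sum
      (\<lambda>b. if b \<in> lab f x ` El A x then Inr (lab g x (inv_into (El A x) (lab f x) b)) else Inl b) Inr"
    have F: "F u = F v" if "k x u = k x v" for u v
    proof (rule symmetric_closure_respects[of u v "R x"])
      show "(u, v) \<in> (R x \<union> (R x)\<inverse>)\<^sup>*" using that k_eq E_def by blast
      have "F (Inl (lab f x a)) = F (Inr (lab g x a))" if "a \<in> El A x" for a
        using that inj by (simp add: F_def)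
      then show "F b = F c" if "(b, c) \<in> R x" for b c using that by (auto simp: R_def)
    qed
    have "c = c'" if "c \<in> El C x" "c' \<in> El C x" "lab q x c = lab q x c'" for c c'
    proof -
      have "F (Inr c) = F (Inr c')" by (rule F) (use that in \<open>simp add: lq\<close>)
      then show ?thesis by (simp add: F_def)
    qed
    moreover have "\<exists>a \<in> El A x. b = lab f x a \<and> c = lab g x a"
      if "b \<in> El B x" "c \<in> El C x" "lab p x b = lab q x c" for b c
    proof -
      have e: "F (Inl b) = F (Inr c)" by (rule F) (use that in \<open>simp add: lp lq\<close>)
      then have b: "b \<in> lab f x ` El A x" by (auto simp: F_def split: if_splits)
      then obtain a where a: "a \<in> El A x" "b = lab f x a" by blast
      then have "F (Inl b) = Inr (lab g x a)" using inj by (simp add: F_def)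
      with e have "c = lab g x a" by (simp add: F_def)
      with a show ?thesis by blast
    qed
    ultimately show ?thesis by (auto intro!: inj_onI)
  qed
  show ?thesis using po cover amalg by (intro exI[of _ p] exI[of _ q]) (simp add: p_def)
qed

text \<open>The construction has these properties for one pushout; the comparison isomorphism is
  bijective at every stage and carries them over to any other.\<close>

lemma (in category) pushout_structure:
  fixes j :: "'e + 'e \<Rightarrow> 'e" and A B C :: "('o, 'd, 'e) psh"
  assumes j: "inj j" and po: "is_pushout (Psh D) f g p q"
    and f: "f \<in> hom (Psh D) A B" and g: "g \<in> hom (Psh D) A C"
  shows "El (tgt p) x \<subseteq> lab p x ` El B x \<union> lab q x ` El C x"
    and "inj_on (lab f x) (El A x) \<Longrightarrow> inj_on (lab q x) (El C x)"
    and "inj_on (lab f x) (El A x) \<Longrightarrow> b \<in> El B x \<Longrightarrow> c \<in> El C x \<Longrightarrow> lab p x b = lab q x c \<Longrightarrow>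
      \<exists>a \<in> El A x. b = lab f x a \<and> c = lab g x a"
proof -
  obtain p' q' where po': "is_pushout (Psh D) f g p' q'"
    and cover: "\<And>x. El (tgt p') x \<subseteq> lab p' x ` El B x \<union> lab q' x ` El C x"
    and am: "\<And>x. inj_on (lab f x) (El A x) \<Longrightarrow> inj_on (lab q' x) (El C x)"
      "\<And>x b c. inj_on (lab f x) (El A x) \<Longrightarrow> b \<in> El B x \<Longrightarrow> c \<in> El C x \<Longrightarrow> lab p' x b = lab q' x c \<Longrightarrow>
         \<exists>a \<in> El A x. b = lab f x a \<and> c = lab g x a"
    using pushout_exists[OF j f g] by metis
  obtain u where u: "iso (Psh D) u" "u \<in> hom (Psh D) (tgt p') (tgt p)" "Comp (Psh D) u p' = p" "Comp (Psh D) u q' = q"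
    using category.pushout_unique[OF category_Psh po' po] by metis
  have p': "p' \<in> hom (Psh D) B (tgt p')" and q': "q' \<in> hom (Psh D) C (tgt p')"
    using po' f g by (auto simp: is_pushout_def hom_iff)
  have bij: "bij_betw (lab u x) (El (tgt p') x) (El (tgt p) x)" by (rule iso_bij[OF u(1,2)])
  have lp: "lab p x b = lab u x (lab p' x b)" if "b \<in> El B x" for b
    using lab_comp[OF p' that] u(3) by metis
  have lq: "lab q x c = lab u x (lab q' x c)" if "c \<in> El C x" for c
    using lab_comp[OF q' that] u(4) by metis
  show "El (tgt p) x \<subseteq> lab p x ` El B x \<union> lab q x ` El C x"
  proof
    fix e assume "e \<in> El (tgt p) x"
    then obtain e' where "e' \<in> El (tgt p') x" "e = lab u x e'"
      using bij by (auto simp: bij_betw_def)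
    then show "e \<in> lab p x ` El B x \<union> lab q x ` El C x"
      using cover[of x] lp lq by force
  qed
  show "inj_on (lab q x) (El C x)" if i: "inj_on (lab f x) (El A x)"
  proof (rule inj_onI)
    fix c c' assume "c \<in> El C x" "c' \<in> El C x" "lab q x c = lab q x c'"
    then show "c = c'"
      using lq am(1)[OF i] bij lab_in[OF q'] by (metis bij_betw_imp_inj_on inj_on_eq_iff)
  qed
  show "\<exists>a \<in> El A x. b = lab f x a \<and> c = lab g x a"
    if "inj_on (lab f x) (El A x)" "b \<in> El B x" "c \<in> El C x" "lab p x b = lab q x c"
  proof (rule am(2)[OF that(1-3)])
    show "lab p' x b = lab q' x c"
      using lp[OF that(2)] lq[OF that(3)] that(4) bij lab_in[OF q' that(3)] lab_in[OF p' that(2)]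
      by (metis bij_betw_imp_inj_on inj_on_eq_iff)
  qed
qed


section \<open>The base category\<close>

lemma basic_det: "basic n c n' \<Longrightarrow> basic m c m' \<Longrightarrow> m = n \<and> m' = n'"
  by (auto elim!: basic.cases)

lemma basic_ok: "basic n c n' \<Longrightarrow> cobj_ok c \<and> c \<noteq> Star \<and> (\<forall>m. c \<noteq> Pl m)"
  by (auto elim!: basic.cases)

lemma edge_ok: "edge g x y \<Longrightarrow> cobj_ok x \<and> cobj_ok y"
  by (auto elim!: edge.cases dest: basic_ok)

lemma path_ok: "path x p y \<Longrightarrow> cobj_ok x \<and> cobj_ok y"
  by (induction rule: path.induct) (auto dest: edge_ok)

lemma path_append: "path y b z \<Longrightarrow> path x a y \<Longrightarrow> path x (b @ a) z"
  by (induction rule: path.induct) (auto intro: path.intros)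

lemma edge_path: "edge g x y \<Longrightarrow> path x [g] y"
  by (auto intro: path.intros dest: edge_ok)

lemma path_Cons_iff: "path x (g # p) z \<longleftrightarrow> (\<exists>y. path x p y \<and> edge g y z)"
  by (auto intro: path.intros elim: path.cases)

lemma path_Nil_iff: "path x [] y \<longleftrightarrow> x = y \<and> cobj_ok x"
  by (auto intro: path.intros elim: path.cases)

lemma basic_le: "basic n c n' \<Longrightarrow> i \<le> n \<Longrightarrow> i \<le> n'"
  by (auto elim!: basic.cases)

lemma crel_path: "crel x y p q \<Longrightarrow> path x p y \<and> path x q y"
proof (induction rule: crel.induct)
  case (1 n c n' i)
  have "edge (Gd n i) Star (Pl n)" "edge (Gd n' i) Star (Pl n')"
    using 1 basic_le[OF 1(1,3)] edge.intros(1) by blast+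
  then show ?case
    using edge.intros(2,3)[OF 1(1)] path_append[OF edge_path edge_path] by fastforce
next
  case (2 n)
  show ?case
    using path_append[OF edge_path[OF edge.intros(4)] edge_path[OF edge.intros(2)[OF basic.intros(2)]]]
      path_append[OF edge_path[OF edge.intros(5)] edge_path[OF edge.intros(2)[OF basic.intros(3)]]] by simp
next
  case (3 n i m j)
  then have ij: "1 \<le> i" "i \<le> n" "1 \<le> j" "j \<le> m" by auto
  show ?case
    using path_append[OF edge_path[OF edge.intros(6)[OF 3]]
        path_append[OF edge_path[OF edge.intros(2)[OF basic.intros(5)[OF ij(1,2)]]]
          edge_path[OF edge.intros(1)[OF ij(1,2)]]]]
      path_append[OF edge_path[OF edge.intros(7)[OF 3]]
        path_append[OF edge_path[OF edge.intros(2)[OF basic.intros(6)[OF ij(3,4)]]]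
          edge_path[OF edge.intros(1)[OF ij(3,4)]]]]
    by simp
qed

lemma ceq_path: "ceq x y p q \<Longrightarrow> path x p y \<and> path x q y"
  by (induction rule: ceq.induct) (auto dest: crel_path intro!: path_append)

lemma ceq_append:
  assumes "ceq y z q q'" "ceq x y p p'"
  shows "ceq x z (q @ p) (q' @ p')"
proof -
  have "ceq x z ([] @ q @ p) ([] @ q' @ p)"
    using assms ceq_path path_ok by (intro ceq.intros(5)) (blast intro: path.intros)+
  moreover have "ceq x z (q' @ p @ []) (q' @ p' @ [])"
    using assms ceq_path path_ok by (intro ceq.intros(5)) (blast intro: path.intros)+
  ultimately show ?thesis using ceq.intros(4) by simp
qed

lemma carr_eq_iff: "path x p y \<Longrightarrow> carr x p y = carr x' q y' \<longleftrightarrow> x = x' \<and> y = y' \<and> ceq x y p q"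
  unfolding carr_def by (auto intro: ceq.intros)

lemma src_carr [simp]: "src (carr x p y) = x" and tgt_carr [simp]: "tgt (carr x p y) = y"
  by (simp_all add: carr_def)

lemma C_hom: "hom \<C> x y = {carr x p y | p. path x p y}"
  by (auto simp: hom_iff \<C>_def; blast)

lemma C_obj [simp]: "x \<in> Obj \<C> \<longleftrightarrow> cobj_ok x"
  by (simp add: \<C>_def)

lemma C_ide: "Ide \<C> x = carr x [] x"
  by (simp add: \<C>_def)

lemma C_comp:
  assumes "path x p y" "path y q z"
  shows "Comp \<C> (carr y q z) (carr x p y) = carr x (q @ p) z"
proof -
  have "(\<exists>p'\<in>{r. ceq x y p r}. \<exists>q'\<in>{r. ceq y z q r}. ceq x z (q' @ p') r) \<longleftrightarrow> ceq x z (q @ p) r" for r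
  proof
    assume "\<exists>p'\<in>{r. ceq x y p r}. \<exists>q'\<in>{r. ceq y z q r}. ceq x z (q' @ p') r"
    then obtain p' q' where "ceq x y p p'" "ceq y z q q'" "ceq x z (q' @ p') r" by blast
    then show "ceq x z (q @ p) r" using ceq_append ceq.intros(4) by blast
  qed (use assms ceq.intros(2) in blast)
  then show ?thesis by (simp add: \<C>_def carr_def)
qed

global_interpretation C: category \<C>
proof (rule category.intro)
  fix f g h x y z w
  show "x \<in> Obj \<C> \<and> y \<in> Obj \<C>" if "f \<in> hom \<C> x y" using that path_ok by (auto simp: C_hom)
  show "Ide \<C> x \<in> hom \<C> x x" if "x \<in> Obj \<C>" using that by (auto simp: C_hom C_ide intro: path.intros)
  show "Comp \<C> g f \<in> hom \<C> x z" if "f \<in> hom \<C> x y" "g \<in> hom \<C> y z"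
    using that C_comp path_append by (fastforce simp: C_hom)
  show "Comp \<C> (Ide \<C> y) f = f" if "f \<in> hom \<C> x y"
  proof -
    obtain p where p: "path x p y" "f = carr x p y" using \<open>f \<in> hom \<C> x y\<close> by (auto simp: C_hom)
    then have "path y [] y" using path_ok path.intros by blast
    then show ?thesis using C_comp[OF p(1)] p by (simp add: C_ide)
  qed
  show "Comp \<C> f (Ide \<C> x) = f" if "f \<in> hom \<C> x y"
  proof -
    obtain p where p: "path x p y" "f = carr x p y" using \<open>f \<in> hom \<C> x y\<close> by (auto simp: C_hom)
    then have "path x [] x" using path_ok path.intros by blast
    then show ?thesis using C_comp[OF _ p(1)] p by (simp add: C_ide)
  qed
  show "Comp \<C> (Comp \<C> h g) f = Comp \<C> h (Comp \<C> g f)"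
    if "f \<in> hom \<C> x y" "g \<in> hom \<C> y z" "h \<in> hom \<C> z w"
  proof -
    obtain p q r where p: "path x p y" "f = carr x p y" and q: "path y q z" "g = carr y q z"
      and r: "path z r w" "h = carr z r w"
      using \<open>f \<in> hom \<C> x y\<close> \<open>g \<in> hom \<C> y z\<close> \<open>h \<in> hom \<C> z w\<close> by (auto simp: C_hom)
    then show ?thesis
      using C_comp[OF q(1) r(1)] C_comp[OF p(1) q(1)] C_comp[OF p(1) path_append[OF r(1) q(1)]]
        C_comp[OF path_append[OF q(1) p(1)] r(1)] by simp
  qed
qed

global_interpretation Ch: category Chat
  by (rule C.category_Psh)

lemma ide_yo: "Ide Chat (yo \<C> a) \<in> hom Chat (yo \<C> a) (yo \<C> a)" "iso Chat (Ide Chat (yo \<C> a))"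
  by (simp_all add: Ch.ide_hom Ch.iso_ide C.presheaf_yo)

text \<open>An injection of two copies of the element type into one, as the construction of pushouts
  requires. Prefixing every path with a dummy generator frees the empty path, whose presence tags
  the second copy.\<close>

definition pack :: "carrow + carrow \<Rightarrow> carrow" where
  "pack = case_sum (\<lambda>f. Arrow (src f) ((#) (Gl 0) ` lab f) (tgt f))
     (\<lambda>f. Arrow (src f) (insert [] ((#) (Gl 0) ` lab f)) (tgt f))"

lemma inj_pack: "inj pack"
proof (rule injI)
  fix u v assume e: "pack u = pack v"
  have i: "A = B" if "(#) (Gl 0) ` A = (#) (Gl 0) ` B" for A B :: "gen list set"
    using that by (simp add: inj_image_eq_iff)
  have n: "[] \<notin> (#) (Gl 0) ` A" for A by auto
  have i': "A = B" if "insert [] ((#) (Gl 0) ` A) = insert [] ((#) (Gl 0) ` B)" for A B :: "gen list set"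
    by (rule i) (use that insert_ident[OF n n] in simp)
  have ne: "(#) (Gl 0) ` A \<noteq> insert [] B" "insert [] B \<noteq> (#) (Gl 0) ` A" for A B :: "gen list set"
    using n[of A] by (metis insertI1)+
  show "u = v"
  proof (cases u; cases v)
    fix f g assume "u = Inl f" "v = Inl g"
    then show ?thesis using e i[of "lab f" "lab g"] by (simp add: pack_def arrow.expand)
  next
    fix f g assume "u = Inr f" "v = Inr g"
    then show ?thesis using e i'[of "lab f" "lab g"] by (simp add: pack_def arrow.expand)
  qed (use e ne in \<open>auto simp: pack_def\<close>)
qed

lemmas pushout_cover = C.pushout_structure(1)[OF inj_pack]
  and pushout_inj = C.pushout_structure(2)[OF inj_pack]
  and pushout_amalg = C.pushout_structure(3)[OF inj_pack]

lemma pushout_ex: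
  assumes "f \<in> hom Chat A B" "g \<in> hom Chat A C"
  obtains p q where "is_pushout Chat f g p q"
  using C.pushout_exists[OF inj_pack assms] by blast

subsection \<open>Hom-sets of the base category\<close>

lemma path_to_Star: "path x p Star \<longleftrightarrow> x = Star \<and> p = []"
proof
  show "path x p Star \<Longrightarrow> x = Star \<and> p = []"
    by (cases p) (auto simp: path_Nil_iff path_Cons_iff elim!: edge.cases dest: basic_ok)
qed (auto intro: path.intros)

lemma path_to_Pl:
  "path x p (Pl n) \<Longrightarrow> x = Pl n \<and> p = [] \<or> x = Star \<and> (\<exists>i. 1 \<le> i \<and> i \<le> n \<and> p = [Gd n i])"
  by (cases p) (auto simp: path_Nil_iff path_Cons_iff path_to_Star elim!: edge.cases dest: basic_ok)

lemma path_to_basic: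
  assumes "path x p c" "basic n c n'"
  shows "x = c \<and> p = [] \<or> (\<exists>p'. p = Gs c # p' \<and> path x p' (Pl n)) \<or> (\<exists>p'. p = Gt c # p' \<and> path x p' (Pl n'))"
proof (cases p)
  case (Cons g p')
  then obtain y where y: "path x p' y" "edge g y c" using assms(1) by (auto simp: path_Cons_iff)
  show ?thesis
    using y(2) assms(2) y(1) Cons
    by (cases rule: edge.cases) (auto dest: basic_det basic_ok elim: basic.cases)
qed (use assms(1) in \<open>simp add: path_Nil_iff\<close>)

lemma crel_target: "crel x y p q \<Longrightarrow> y \<noteq> Star \<and> (\<forall>n. y \<noteq> Pl n)"
  by (auto elim!: crel.cases dest: basic_ok)

text \<open>No relation ends in \<open>Star\<close> or in a player, and a path into a player passes
  only through such objects, so no relation can be applied inside it: the hom-sets into players are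
  free.\<close>

lemma ceq_Pl: "ceq x y p q \<Longrightarrow> y = Pl n \<Longrightarrow> p = q"
proof (induction arbitrary: n rule: ceq.induct)
  case (5 w a x y p q b z)
  consider "y = Pl n" "b = []" | "y = Star" using path_to_Pl 5 by blast
  then show ?case
  proof cases
    case 2
    then have "path x p Star" "path x q Star" using 5 ceq_path by blast+
    then show ?thesis by (simp add: path_to_Star)
  qed (use 5 in simp)
qed (auto dest: crel_target)

text \<open>An invariant that separates \<open>s\<close> from \<open>t\<close>: the relations that
  exchange them all start at \<open>Star\<close>, and the one relation starting elsewhere,
  \<open>l s = r s\<close>, contains no \<open>t\<close>.\<close>

lemma ceq_Gt: "ceq x y p q \<Longrightarrow> x \<noteq> Star \<Longrightarrow> (\<exists>c. Gt c \<in> set p) \<longleftrightarrow> (\<exists>c. Gt c \<in> set q)"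
proof (induction rule: ceq.induct)
  case (5 w a x y p q b z)
  then have "x \<noteq> Star" using path_to_Star by blast
  then show ?case using 5 by auto
qed (auto elim: crel.cases)

definition sarr :: "nat \<Rightarrow> cobj \<Rightarrow> carrow" where
  "sarr n c = carr (Pl n) [Gs c] c"

definition tarr :: "nat \<Rightarrow> cobj \<Rightarrow> carrow" where
  "tarr n c = carr (Pl n) [Gt c] c"

lemma sarr_hom: "basic n c n' \<Longrightarrow> sarr n c \<in> hom \<C> (Pl n) c"
  by (auto simp: sarr_def C_hom intro!: exI edge_path edge.intros)

lemma tarr_hom: "basic n c n' \<Longrightarrow> tarr n' c \<in> hom \<C> (Pl n') c"
  by (auto simp: tarr_def C_hom intro!: exI edge_path edge.intros)

abbreviation smap :: "nat \<Rightarrow> cobj \<Rightarrow> cmor" where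
  "smap n c \<equiv> yo_map \<C> (sarr n c)"

abbreviation tmap :: "nat \<Rightarrow> cobj \<Rightarrow> cmor" where
  "tmap n c \<equiv> yo_map \<C> (tarr n c)"

lemma smap_hom: "basic n c n' \<Longrightarrow> smap n c \<in> hom Chat (player n) (yo \<C> c)"
  by (rule C.yo_map_hom[OF sarr_hom])

lemma tmap_hom: "basic n c n' \<Longrightarrow> tmap n' c \<in> hom Chat (player n') (yo \<C> c)"
  by (rule C.yo_map_hom[OF tarr_hom])

text \<open>This keeps the initial and the final player of a move apart even when both know equally
  many channels; the rigidity of views rests on it.\<close>

lemma sarr_neq_tarr:
  assumes "basic n c n'"
  shows "sarr n c \<noteq> tarr n' c"
proof
  assume e: "sarr n c = tarr n' c"
  have "path (Pl n) [Gs c] c" using assms by (auto intro!: edge_path edge.intros)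
  then have "ceq (Pl n) c [Gs c] [Gt c]" using e carr_eq_iff unfolding sarr_def tarr_def by blast
  then show False using ceq_Gt by fastforce
qed

lemma hom_Pl: "f \<in> hom \<C> x (Pl n) \<Longrightarrow> x \<noteq> Star \<Longrightarrow> x = Pl n \<and> f = Ide \<C> (Pl n)"
  using path_to_Pl by (fastforce simp: C_hom C_ide)

lemma hom_basic:
  assumes "f \<in> hom \<C> x c" "basic n c n'" "x \<noteq> Star"
  shows "x = c \<and> f = Ide \<C> c \<or> x = Pl n \<and> f = sarr n c \<or> x = Pl n' \<and> f = tarr n' c"
proof -
  obtain p where p: "path x p c" "f = carr x p c" using assms(1) by (auto simp: C_hom)
  show ?thesis
    using path_to_basic[OF p(1) assms(2)] p(2) assms(3) path_to_Pl
    by (auto simp: C_ide sarr_def tarr_def)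
qed

lemma hom_to_Star: "f \<in> hom \<C> x Star \<Longrightarrow> x = Star \<and> f = Ide \<C> Star"
  by (auto simp: C_hom C_ide path_to_Star)

lemma hom_Star_Pl: "hom \<C> Star (Pl n) = (\<lambda>i. carr Star [Gd n i] (Pl n)) ` {1..n}"
proof -
  have "path Star [Gd n i] (Pl n)" if "1 \<le> i" "i \<le> n" for i
    using that by (intro edge_path edge.intros)
  then show ?thesis using path_to_Pl by (fastforce simp: C_hom)
qed

lemma inj_Gd: "inj_on (\<lambda>i. carr Star [Gd n i] (Pl n)) {1..n}"
proof (rule inj_onI)
  fix i j assume "i \<in> {1..n}" "j \<in> {1..n}" "carr Star [Gd n i] (Pl n) = carr Star [Gd n j] (Pl n)"
  moreover from this have "path Star [Gd n i] (Pl n)" by (auto intro!: edge_path edge.intros)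
  ultimately have "ceq Star (Pl n) [Gd n i] [Gd n j]" using carr_eq_iff by blast
  then show "i = j" using ceq_Pl by fastforce
qed


section \<open>Runs\<close>

abbreviation pt :: "nat \<Rightarrow> carrow" where
  "pt n \<equiv> Ide \<C> (Pl n)"

lemma pt_in: "pt n \<in> El (player n) (Pl n)"
  using C.ide_hom[of "Pl n"] by simp

fun valid :: "nat \<Rightarrow> cobj list \<Rightarrow> nat \<Rightarrow> bool" where
  "valid n [] m \<longleftrightarrow> m = n"
| "valid n (c # w) m \<longleftrightarrow> (\<exists>n'. basic n c n' \<and> valid n' w m)"

text \<open>\<open>run W n x w ys m z\<close>: starting from the player \<open>x\<close>, the moves \<open>ys\<close> of \<open>W\<close>, of the types
  listed in \<open>w\<close>, can be played one after the other, leading to the player \<open>z\<close>.\<close>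

fun run :: "cpsh \<Rightarrow> nat \<Rightarrow> carrow \<Rightarrow> cobj list \<Rightarrow> carrow list \<Rightarrow> nat \<Rightarrow> carrow \<Rightarrow> bool" where
  "run W n x [] ys m z \<longleftrightarrow> ys = [] \<and> m = n \<and> z = x"
| "run W n x (c # w) ys m z \<longleftrightarrow> (\<exists>y ys' n'. ys = y # ys' \<and> basic n c n' \<and> y \<in> El W c \<and>
     Act W (sarr n c) y = x \<and> run W n' (Act W (tarr n' c) y) w ys' m z)"

lemma run_length: "run W n x w ys m z \<Longrightarrow> length ys = length w"
  by (induction w arbitrary: n x ys) auto

lemma run_valid: "run W n x w ys m z \<Longrightarrow> valid n w m"
  by (induction w arbitrary: n x ys) auto

lemma valid_append: "valid n (w @ w') m \<longleftrightarrow> (\<exists>k. valid n w k \<and> valid k w' m)"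
  by (induction w arbitrary: n) auto

lemma valid_det: "valid n w m \<Longrightarrow> valid n w m' \<Longrightarrow> m = m'"
  by (induction w arbitrary: n) (auto dest: basic_det)

lemma run_append: "run W n x (w @ w') ys m z \<longleftrightarrow>
    (\<exists>ys1 ys2 k v. ys = ys1 @ ys2 \<and> run W n x w ys1 k v \<and> run W k v w' ys2 m z)"
proof (induction w arbitrary: n x ys)
  case (Cons c w)
  show ?case
  proof
    assume "run W n x ((c # w) @ w') ys m z"
    then obtain y ys' n' where 1: "ys = y # ys'" "basic n c n'" "y \<in> El W c" "Act W (sarr n c) y = x"
      "run W n' (Act W (tarr n' c) y) (w @ w') ys' m z" by auto
    then obtain ys1 ys2 k v where "ys' = ys1 @ ys2" "run W n' (Act W (tarr n' c) y) w ys1 k v" "run W k v w' ys2 m z"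
      using Cons by blast
    with 1 show "\<exists>ys1 ys2 k v. ys = ys1 @ ys2 \<and> run W n x (c # w) ys1 k v \<and> run W k v w' ys2 m z"
      by (intro exI[of _ "y # ys1"] exI[of _ ys2] exI[of _ k] exI[of _ v]) auto
  next
    assume "\<exists>ys1 ys2 k v. ys = ys1 @ ys2 \<and> run W n x (c # w) ys1 k v \<and> run W k v w' ys2 m z"
    then show "run W n x ((c # w) @ w') ys m z" using Cons by fastforce
  qed
qed simp

lemma run_det: "run W n x w ys m z \<Longrightarrow> run W n x w ys m' z' \<Longrightarrow> m = m' \<and> z = z'"
proof (induction w arbitrary: n x ys)
  case (Cons c w)
  from Cons.prems obtain y ys' n1 where 1: "ys = y # ys'" "basic n c n1" "run W n1 (Act W (tarr n1 c) y) w ys' m z"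
    by auto
  from Cons.prems(2) 1(1) obtain n2 where 2: "basic n c n2" "run W n2 (Act W (tarr n2 c) y) w ys' m' z'"
    by auto
  have "n2 = n1" using basic_det[OF 1(2) 2(1)] by simp
  then show ?case using Cons.IH 1(3) 2(2) by simp
qed simp

lemma run_map:
  assumes \<phi>: "\<phi> \<in> hom Chat W W'"
  shows "run W n x w ys m z \<Longrightarrow> x \<in> El W (Pl n) \<Longrightarrow>
    run W' n (lab \<phi> (Pl n) x) w (map2 (lab \<phi>) w ys) m (lab \<phi> (Pl m) z)"
proof (induction w arbitrary: n x ys)
  case (Cons c w)
  from Cons.prems obtain y ys' n1 where 1: "ys = y # ys'" "basic n c n1" "y \<in> El W c" "Act W (sarr n c) y = x"
    "run W n1 (Act W (tarr n1 c) y) w ys' m z" by auto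
  have W: "presheaf \<C> W" using \<phi> Psh_hom_presheaf by blast
  have "run W' n1 (lab \<phi> (Pl n1) (Act W (tarr n1 c) y)) w (map2 (lab \<phi>) w ys') m (lab \<phi> (Pl m) z)"
    using Cons.IH[OF 1(5)] Act_in[OF W tarr_hom[OF 1(2)] 1(3)] by blast
  then show ?case
    using 1 lab_Act[OF \<phi> sarr_hom[OF 1(2)] 1(3)] lab_Act[OF \<phi> tarr_hom[OF 1(2)] 1(3)] lab_in[OF \<phi> 1(3)]
    by auto
qed simp

lemma run_elems: "run W n x w ys m z \<Longrightarrow> (c, y) \<in> set (zip w ys) \<Longrightarrow> y \<in> El W c"
  by (induction w arbitrary: n x ys) auto

lemma map2_comp:
  assumes \<phi>: "\<phi> \<in> hom Chat W W'" and "run W n x w ys m z"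
  shows "map2 (lab (\<psi> \<odot> \<phi>)) w ys = map2 (lab \<psi>) w (map2 (lab \<phi>) w ys)"
proof (rule nth_equalityI)
  have l: "length ys = length w" using run_length assms(2) by blast
  then show "length (map2 (lab (\<psi> \<odot> \<phi>)) w ys) = length (map2 (lab \<psi>) w (map2 (lab \<phi>) w ys))" by simp
  fix i assume "i < length (map2 (lab (\<psi> \<odot> \<phi>)) w ys)"
  then have i: "i < length w" by simp
  then have "(w ! i, ys ! i) \<in> set (zip w ys)" using l by (auto simp: in_set_zip)
  then show "map2 (lab (\<psi> \<odot> \<phi>)) w ys ! i = map2 (lab \<psi>) w (map2 (lab \<phi>) w ys) ! i"
    using i l lab_comp[OF \<phi> run_elems[OF assms(2)]] by simp
qed

lemma map2_ide:
  assumes "run W n x w ys m z"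
  shows "map2 (lab (Ide Chat W)) w ys = ys"
proof (rule nth_equalityI)
  have l: "length ys = length w" using run_length assms by blast
  then show "length (map2 (lab (Ide Chat W)) w ys) = length ys" by simp
  fix i assume "i < length (map2 (lab (Ide Chat W)) w ys)"
  then have i: "i < length w" by simp
  then have "(w ! i, ys ! i) \<in> set (zip w ys)" using l by (auto simp: in_set_zip)
  then show "map2 (lab (Ide Chat W)) w ys ! i = ys ! i"
    using i l lab_ide[OF run_elems[OF assms]] by simp
qed

section \<open>Objects representing runs\<close>

text \<open>\<open>(x, zs)\<close> is a universal element of the functor that sends \<open>W\<close>
  to its runs along \<open>w\<close>. This property takes the place of the iterated pushouts that
  define a view.\<close>

definition represents :: "nat \<Rightarrow> cobj list \<Rightarrow> cpsh \<Rightarrow> carrow \<Rightarrow> carrow list \<Rightarrow> bool" where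
  "represents n w V x zs \<longleftrightarrow> presheaf \<C> V \<and> x \<in> El V (Pl n) \<and> (\<exists>m z. run V n x w zs m z) \<and>
    (\<forall>W x' ys m z. presheaf \<C> W \<longrightarrow> x' \<in> El W (Pl n) \<longrightarrow> run W n x' w ys m z \<longrightarrow>
       (\<exists>!\<phi>. \<phi> \<in> hom Chat V W \<and> lab \<phi> (Pl n) x = x' \<and> map2 (lab \<phi>) w zs = ys))"

lemma representsD:
  assumes "represents n w V x zs"
  shows "presheaf \<C> V" "x \<in> El V (Pl n)" "\<exists>m z. run V n x w zs m z"
    "\<And>W x' ys m z. presheaf \<C> W \<Longrightarrow> x' \<in> El W (Pl n) \<Longrightarrow> run W n x' w ys m z \<Longrightarrow>
       \<exists>!\<phi>. \<phi> \<in> hom Chat V W \<and> lab \<phi> (Pl n) x = x' \<and> map2 (lab \<phi>) w zs = ys"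
  using assms unfolding represents_def by blast+

lemma represents_unique:
  assumes r: "represents n w V x zs" and r': "represents n w V' x' zs'"
  obtains u where "iso Chat u" "u \<in> hom Chat V V'" "lab u (Pl n) x = x'" "map2 (lab u) w zs = zs'"
proof -
  note d = representsD[OF r] and d' = representsD[OF r']
  obtain m z where run: "run V n x w zs m z" using d(3) by blast
  obtain m' z' where run': "run V' n x' w zs' m' z'" using d'(3) by blast
  obtain u where u: "u \<in> hom Chat V V'" "lab u (Pl n) x = x'" "map2 (lab u) w zs = zs'"
    using d(4)[OF d'(1,2) run'] by blast
  obtain v where v: "v \<in> hom Chat V' V" "lab v (Pl n) x' = x" "map2 (lab v) w zs' = zs"
    using d'(4)[OF d(1,2) run] by blast
  have 1: "v \<odot> u = Ide Chat V"
    by (rule ex1_unique[OF d(4)[OF d(1,2) run]])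
      (use d(1,2) u v in \<open>simp_all add: Ch.comp_hom[OF u(1) v(1)] C.Psh_ide_hom lab_comp[OF u(1)] lab_ide
        map2_comp[OF u(1) run] map2_ide[OF run]\<close>)
  have 2: "u \<odot> v = Ide Chat V'"
    by (rule ex1_unique[OF d'(4)[OF d'(1,2) run']])
      (use d'(1,2) u v in \<open>simp_all add: Ch.comp_hom[OF v(1) u(1)] C.Psh_ide_hom lab_comp[OF v(1)] lab_ide
        map2_comp[OF v(1) run'] map2_ide[OF run']\<close>)
  show ?thesis using that[OF isoI[OF u(1) v(1) 1 2]] u by blast
qed

text \<open>The Yoneda lemma: a run along the empty word is just a player. An isomorphism
  \<open>l\<close> is allowed instead of the identity because empty plays allow it.\<close>

lemma represents_Nil:
  assumes l: "iso Chat l" "l \<in> hom Chat (player n) V"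
  shows "represents n [] V (lab l (Pl n) (pt n)) []"
  unfolding represents_def
proof (intro conjI allI impI)
  show "presheaf \<C> V" using l Psh_hom_presheaf by blast
  show "lab l (Pl n) (pt n) \<in> El V (Pl n)" using lab_in[OF l(2) pt_in] .
  fix W x' ys m z assume W: "presheaf \<C> W" and x': "x' \<in> El W (Pl n)" and "run W n x' [] ys m z"
  then have ys: "ys = []" by simp
  obtain k where k: "k \<in> hom Chat V (player n)" "k \<odot> l = Ide Chat (player n)" "l \<odot> k = Ide Chat V"
    using iso_inverseE[OF l] by metis
  have e: "C.elem_map (Pl n) W x' \<in> hom Chat (player n) W" using C.elem_map_hom[OF W x'] .
  have kl: "lab k (Pl n) (lab l (Pl n) (pt n)) = pt n"
    using lab_comp[OF l(2) pt_in, of k] k(2) lab_ide[OF pt_in] by simp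
  show "\<exists>!\<phi>. \<phi> \<in> hom Chat V W \<and> lab \<phi> (Pl n) (lab l (Pl n) (pt n)) = x' \<and> map2 (lab \<phi>) [] [] = ys"
  proof (rule ex1I[of _ "C.elem_map (Pl n) W x' \<odot> k"])
    show "C.elem_map (Pl n) W x' \<odot> k \<in> hom Chat V W \<and>
      lab (C.elem_map (Pl n) W x' \<odot> k) (Pl n) (lab l (Pl n) (pt n)) = x' \<and>
      map2 (lab (C.elem_map (Pl n) W x' \<odot> k)) [] [] = ys"
      using Ch.comp_hom[OF k(1) e] lab_comp[OF k(1) lab_in[OF l(2) pt_in]] kl
        C.lab_elem_map_ide[OF W x'] ys by simp
  next
    fix \<phi> assume \<phi>: "\<phi> \<in> hom Chat V W \<and> lab \<phi> (Pl n) (lab l (Pl n) (pt n)) = x' \<and> map2 (lab \<phi>) [] [] = ys"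
    then have h: "\<phi> \<in> hom Chat V W" by blast
    have "\<phi> \<odot> l = C.elem_map (Pl n) W x'"
      by (rule C.yo_hom_eqI[OF Ch.comp_hom[OF l(2) h] e])
        (use \<phi> in \<open>simp add: lab_comp[OF l(2) pt_in] C.lab_elem_map_ide[OF W x']\<close>)
    then show "\<phi> = C.elem_map (Pl n) W x' \<odot> k"
      using Ch.comp_assoc[OF k(1) l(2) h] k(3) Ch.comp_ide[OF h] by simp
  qed
qed (metis run.simps(1))

text \<open>The universal property of the pushout with the Yoneda lemma built in: a map out of the
  pushout is a map out of \<open>V\<close> with an element at \<open>c\<close> whose restriction
  along \<open>g\<close> is the prescribed one.\<close>

lemma pushout_yo:
  assumes po: "is_pushout Chat (yo_map \<C> g) i a b" and g: "g \<in> hom \<C> x c" and i: "i \<in> hom Chat (yo \<C> x) V"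
  defines "y0 \<equiv> lab a c (Ide \<C> c)"
  shows "a \<in> hom Chat (yo \<C> c) (tgt a)" "b \<in> hom Chat V (tgt a)" "y0 \<in> El (tgt a) c"
    "Act (tgt a) g y0 = lab b x (lab i x (Ide \<C> x))"
    "\<And>W y \<phi>. y \<in> El W c \<Longrightarrow> \<phi> \<in> hom Chat V W \<Longrightarrow> Act W g y = lab \<phi> x (lab i x (Ide \<C> x)) \<Longrightarrow>
      \<exists>!\<psi>. \<psi> \<in> hom Chat (tgt a) W \<and> lab \<psi> c y0 = y \<and> \<psi> \<odot> b = \<phi>"
proof -
  have yg: "yo_map \<C> g \<in> hom Chat (yo \<C> x) (yo \<C> c)" using C.yo_map_hom[OF g] .
  show a: "a \<in> hom Chat (yo \<C> c) (tgt a)" and b: "b \<in> hom Chat V (tgt a)"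
    using po yg i by (auto simp: is_pushout_def hom_iff)
  have c: "c \<in> Obj \<C>" "x \<in> Obj \<C>" using g C.arr_obj by blast+
  have idx: "Ide \<C> x \<in> El (yo \<C> x) x" "Ide \<C> c \<in> El (yo \<C> c) c" using C.ide_hom c by auto
  show y0: "y0 \<in> El (tgt a) c" unfolding y0_def using lab_in[OF a idx(2)] .
  have sq: "a \<odot> yo_map \<C> g = b \<odot> i" using po by (simp add: is_pushout_def)
  show "Act (tgt a) g y0 = lab b x (lab i x (Ide \<C> x))"
    using C.lab_comp_yo_map[OF a g] sq lab_comp[OF i idx(1)] by (simp add: y0_def)
  fix W y \<phi> assume y: "y \<in> El W c" and \<phi>: "\<phi> \<in> hom Chat V W" and eq: "Act W g y = lab \<phi> x (lab i x (Ide \<C> x))"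
  have W: "presheaf \<C> W" using \<phi> Psh_hom_presheaf by blast
  have e: "C.elem_map c W y \<in> hom Chat (yo \<C> c) W" using C.elem_map_hom[OF W y] .
  have "C.elem_map c W y \<odot> yo_map \<C> g = \<phi> \<odot> i"
    by (rule C.yo_hom_eqI[OF Ch.comp_hom[OF yg e] Ch.comp_hom[OF i \<phi>]])
      (simp add: C.lab_comp_yo_map[OF e g] C.lab_elem_map_ide[OF W y] lab_comp[OF i idx(1)] eq)
  then have "\<exists>!\<psi>. \<psi> \<in> hom Chat (tgt a) W \<and> \<psi> \<odot> a = C.elem_map c W y \<and> \<psi> \<odot> b = \<phi>"
    by (rule pushout_univ[OF po yg i a e \<phi>])
  moreover have "\<psi> \<odot> a = C.elem_map c W y \<longleftrightarrow> lab \<psi> c y0 = y" if \<psi>: "\<psi> \<in> hom Chat (tgt a) W" for \<psi>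
  proof
    assume "\<psi> \<odot> a = C.elem_map c W y"
    then show "lab \<psi> c y0 = y"
      using lab_comp[OF a idx(2), of \<psi>] C.lab_elem_map_ide[OF W y] by (simp add: y0_def)
  next
    assume "lab \<psi> c y0 = y"
    then show "\<psi> \<odot> a = C.elem_map c W y"
      by (intro C.yo_hom_eqI[OF Ch.comp_hom[OF a \<psi>] e])
        (simp add: lab_comp[OF a idx(2)] C.lab_elem_map_ide[OF W y] y0_def)
  qed
  ultimately show "\<exists>!\<psi>. \<psi> \<in> hom Chat (tgt a) W \<and> lab \<psi> c y0 = y \<and> \<psi> \<odot> b = \<phi>"
    by (simp cong: conj_cong)
qed

text \<open>A run along \<open>w @ [c]\<close> is a run along \<open>w\<close> with a move that
  starts at its end, and by \<open>pushout_yo\<close> this is what a map out of \<open>tgt a\<close>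
  amounts to. Plays grow in this way.\<close>

lemma represents_snoc:
  assumes r: "represents n w V x zs" and run: "run V n x w zs m z" and c: "basic m c m'"
    and i: "i \<in> hom Chat (player m) V" "lab i (Pl m) (pt m) = z"
    and po: "is_pushout Chat (smap m c) i a b"
  defines "zs' \<equiv> map2 (lab b) w zs @ [lab a c (Ide \<C> c)]"
  shows "represents n (w @ [c]) (tgt a) (lab b (Pl n) x) zs'"
    and "run (tgt a) n (lab b (Pl n) x) (w @ [c]) zs' m' (lab a (Pl m') (tarr m' c))"
proof -
  note d = representsD[OF r]
  note P = pushout_yo[OF po sarr_hom[OF c] i(1), unfolded i(2)]
  let ?y = "lab a c (Ide \<C> c)"
  have len: "length zs = length w" using run_length[OF run] .
  have ta: "Act (tgt a) (tarr m' c) ?y = lab a (Pl m') (tarr m' c)"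
    using C.lab_yo_hom[OF P(1) tarr_hom[OF c]] by simp
  show run': "run (tgt a) n (lab b (Pl n) x) (w @ [c]) zs' m' (lab a (Pl m') (tarr m' c))"
    unfolding zs'_def run_append using run_map[OF P(2) run d(2)] c P(3,4) ta
    by (rule_tac exI[of _ "map2 (lab b) w zs"], rule_tac exI[of _ "[?y]"], rule_tac exI[of _ m],
        rule_tac exI[of _ "lab b (Pl m) z"]) auto
  show "represents n (w @ [c]) (tgt a) (lab b (Pl n) x) zs'"
    unfolding represents_def
  proof (intro conjI allI impI)
    show "presheaf \<C> (tgt a)" using P(1) Psh_hom_presheaf by blast
    show "lab b (Pl n) x \<in> El (tgt a) (Pl n)" using lab_in[OF P(2) d(2)] .
    show "\<exists>m z. run (tgt a) n (lab b (Pl n) x) (w @ [c]) zs' m z" using run' by blast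
    fix W x' ys m1 z1 assume W: "presheaf \<C> W" and x': "x' \<in> El W (Pl n)" and "run W n x' (w @ [c]) ys m1 z1"
    then obtain ys1 y k v where ys: "ys = ys1 @ [y]" "run W n x' w ys1 k v" "y \<in> El W c" "Act W (sarr k c) y = v"
      unfolding run_append by auto
    have k: "k = m" using valid_det[OF run_valid[OF ys(2)] run_valid[OF run]] .
    obtain \<phi> where \<phi>: "\<phi> \<in> hom Chat V W" "lab \<phi> (Pl n) x = x'" "map2 (lab \<phi>) w zs = ys1"
      and u\<phi>: "\<And>\<phi>'. \<phi>' \<in> hom Chat V W \<Longrightarrow> lab \<phi>' (Pl n) x = x' \<Longrightarrow> map2 (lab \<phi>') w zs = ys1 \<Longrightarrow> \<phi>' = \<phi>"
      using d(4)[OF W x' ys(2)] by blast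
    \<comment> \<open>A run's moves determine its end, so \<open>\<phi>\<close> maps the end of the
      universal run to the end of the given one, where the last move \<open>y\<close>
      starts.\<close>
    have "lab \<phi> (Pl m) z = v" using run_det[OF run_map[OF \<phi>(1) run d(2), unfolded \<phi>(2,3)] ys(2)] by (rule conjunct2)
    then have eq: "Act W (sarr m c) y = lab \<phi> (Pl m) z" using ys(4) k by simp
    obtain \<psi> where \<psi>: "\<psi> \<in> hom Chat (tgt a) W" "lab \<psi> c ?y = y" "\<psi> \<odot> b = \<phi>"
      and u\<psi>: "\<And>\<psi>'. \<psi>' \<in> hom Chat (tgt a) W \<Longrightarrow> lab \<psi>' c ?y = y \<Longrightarrow> \<psi>' \<odot> b = \<phi> \<Longrightarrow> \<psi>' = \<psi>"
      using P(5)[OF ys(3) \<phi>(1) eq] by blast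
    have m2: "map2 (lab \<chi>) (w @ [c]) zs' = map2 (lab (\<chi> \<odot> b)) w zs @ [lab \<chi> c ?y]" for \<chi>
      using len by (simp add: zs'_def map2_comp[OF P(2) run])
    show "\<exists>!\<phi>. \<phi> \<in> hom Chat (tgt a) W \<and> lab \<phi> (Pl n) (lab b (Pl n) x) = x' \<and> map2 (lab \<phi>) (w @ [c]) zs' = ys"
    proof (rule ex1I[of _ \<psi>])
      show "\<psi> \<in> hom Chat (tgt a) W \<and> lab \<psi> (Pl n) (lab b (Pl n) x) = x' \<and> map2 (lab \<psi>) (w @ [c]) zs' = ys"
        using \<psi> \<phi> lab_comp[OF P(2) d(2), of \<psi>] by (simp only: m2) (simp add: ys(1))
      fix \<chi> assume "\<chi> \<in> hom Chat (tgt a) W \<and> lab \<chi> (Pl n) (lab b (Pl n) x) = x' \<and> map2 (lab \<chi>) (w @ [c]) zs' = ys"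
      then have \<chi>: "\<chi> \<in> hom Chat (tgt a) W" "lab \<chi> (Pl n) (lab b (Pl n) x) = x'"
        "map2 (lab (\<chi> \<odot> b)) w zs = ys1" "lab \<chi> c ?y = y"
        unfolding m2 ys(1) by simp_all
      have "\<chi> \<odot> b = \<phi>" using u\<phi>[OF Ch.comp_hom[OF P(2) \<chi>(1)]] \<chi> lab_comp[OF P(2) d(2), of \<chi>] by simp
      then show "\<chi> = \<psi>" using u\<psi> \<chi> by blast
    qed
  qed
qed

text \<open>A run along \<open>c # w\<close> is a move with a run along \<open>w\<close> from its
  final player, so the gluing takes place along \<open>tmap\<close>. This is how composition with a
  move extends a view.\<close>

lemma represents_Cons:
  assumes r: "represents n' w V x zs" and c: "basic n c n'"
    and i: "i \<in> hom Chat (player n') V" "lab i (Pl n') (pt n') = x"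
    and po: "is_pushout Chat (tmap n' c) i a b"
  shows "represents n (c # w) (tgt a) (lab a (Pl n) (sarr n c)) (lab a c (Ide \<C> c) # map2 (lab b) w zs)"
proof -
  note d = representsD[OF r]
  note P = pushout_yo[OF po tarr_hom[OF c] i(1), unfolded i(2)]
  let ?y = "lab a c (Ide \<C> c)"
  obtain m z where run: "run V n' x w zs m z" using d(3) by blast
  have sa: "Act (tgt a) (sarr n c) ?y = lab a (Pl n) (sarr n c)"
    using C.lab_yo_hom[OF P(1) sarr_hom[OF c]] by simp
  have Pp: "presheaf \<C> (tgt a)" using P(1) Psh_hom_presheaf by blast
  show ?thesis
    unfolding represents_def
  proof (intro conjI allI impI)
    show "presheaf \<C> (tgt a)" by (rule Pp)
    show "lab a (Pl n) (sarr n c) \<in> El (tgt a) (Pl n)"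
      using lab_in[OF P(1), of "sarr n c"] sarr_hom[OF c] by simp
    show "\<exists>m z. run (tgt a) n (lab a (Pl n) (sarr n c)) (c # w) (?y # map2 (lab b) w zs) m z"
      using run_map[OF P(2) run d(2)] c P(3,4) sa by fastforce
    fix W x' ys m1 z1 assume W: "presheaf \<C> W" and x': "x' \<in> El W (Pl n)" and "run W n x' (c # w) ys m1 z1"
    then obtain y ys1 n1 where ys0: "ys = y # ys1" "y \<in> El W c" "Act W (sarr n c) y = x'" "basic n c n1"
       "run W n1 (Act W (tarr n1 c) y) w ys1 m1 z1"
      by auto
    have "n1 = n'" using basic_det[OF c ys0(4)] by simp
    note ys = ys0(1-3) ys0(5)[unfolded this]
    obtain \<phi> where \<phi>: "\<phi> \<in> hom Chat V W" "lab \<phi> (Pl n') x = Act W (tarr n' c) y" "map2 (lab \<phi>) w zs = ys1"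
      and u\<phi>: "\<And>\<phi>'. \<phi>' \<in> hom Chat V W \<Longrightarrow> lab \<phi>' (Pl n') x = Act W (tarr n' c) y \<Longrightarrow>
         map2 (lab \<phi>') w zs = ys1 \<Longrightarrow> \<phi>' = \<phi>"
      using d(4)[OF W Act_in[OF W tarr_hom[OF c] ys(2)] ys(4)] by blast
    obtain \<psi> where \<psi>: "\<psi> \<in> hom Chat (tgt a) W" "lab \<psi> c ?y = y" "\<psi> \<odot> b = \<phi>"
      and u\<psi>: "\<And>\<psi>'. \<psi>' \<in> hom Chat (tgt a) W \<Longrightarrow> lab \<psi>' c ?y = y \<Longrightarrow> \<psi>' \<odot> b = \<phi> \<Longrightarrow> \<psi>' = \<psi>"
      using P(5)[OF ys(2) \<phi>(1) \<phi>(2)[symmetric]] by blast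
    have m2: "map2 (lab \<chi>) (c # w) (?y # map2 (lab b) w zs) = lab \<chi> c ?y # map2 (lab (\<chi> \<odot> b)) w zs" for \<chi>
      by (simp add: map2_comp[OF P(2) run])
    show "\<exists>!\<phi>. \<phi> \<in> hom Chat (tgt a) W \<and> lab \<phi> (Pl n) (lab a (Pl n) (sarr n c)) = x' \<and>
      map2 (lab \<phi>) (c # w) (?y # map2 (lab b) w zs) = ys"
    proof (rule ex1I[of _ \<psi>])
      have "lab \<psi> (Pl n) (lab a (Pl n) (sarr n c)) = x'"
        using lab_Act[OF \<psi>(1) sarr_hom[OF c] P(3)] sa \<psi>(2) ys(3) by simp
      then show "\<psi> \<in> hom Chat (tgt a) W \<and> lab \<psi> (Pl n) (lab a (Pl n) (sarr n c)) = x' \<and>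
         map2 (lab \<psi>) (c # w) (?y # map2 (lab b) w zs) = ys"
        using \<psi> \<phi> by (simp only: m2) (simp add: ys(1))
      fix \<chi> assume "\<chi> \<in> hom Chat (tgt a) W \<and> lab \<chi> (Pl n) (lab a (Pl n) (sarr n c)) = x' \<and>
         map2 (lab \<chi>) (c # w) (?y # map2 (lab b) w zs) = ys"
      then have \<chi>: "\<chi> \<in> hom Chat (tgt a) W" "map2 (lab (\<chi> \<odot> b)) w zs = ys1" "lab \<chi> c ?y = y"
        unfolding m2 ys(1) by simp_all
      have "lab (\<chi> \<odot> b) (Pl n') x = Act W (tarr n' c) y"
        using lab_comp[OF P(2) d(2), of \<chi>] P(4) lab_Act[OF \<chi>(1) tarr_hom[OF c] P(3)] \<chi>(3) by simp
      then have "\<chi> \<odot> b = \<phi>" using u\<phi>[OF Ch.comp_hom[OF P(2) \<chi>(1)]] \<chi> by simp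
      then show "\<chi> = \<psi>" using u\<psi> \<chi> by blast
    qed
  qed
qed


subsection \<open>Runs in views are unique\<close>

text \<open>The types are compared as well, so that a player can start neither two moves of one type
  nor moves of two types.\<close>

definition deterministic :: "cpsh \<Rightarrow> bool" where
  "deterministic V \<longleftrightarrow> (\<forall>n c n' c' n'' y y'. basic n c n' \<longrightarrow> basic n c' n'' \<longrightarrow> y \<in> El V c \<longrightarrow> y' \<in> El V c' \<longrightarrow>
     Act V (sarr n c) y = Act V (sarr n c') y' \<longrightarrow> c = c' \<and> y = y')"

lemma deterministicD:
  "deterministic V \<Longrightarrow> basic n c n' \<Longrightarrow> basic n c' n'' \<Longrightarrow> y \<in> El V c \<Longrightarrow> y' \<in> El V c' \<Longrightarrow>
     Act V (sarr n c) y = Act V (sarr n c') y' \<Longrightarrow> c = c' \<and> y = y'"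
  unfolding deterministic_def by blast

lemma deterministicI:
  assumes "\<And>n c n' c' n'' y y'. basic n c n' \<Longrightarrow> basic n c' n'' \<Longrightarrow> y \<in> El V c \<Longrightarrow> y' \<in> El V c' \<Longrightarrow>
     Act V (sarr n c) y = Act V (sarr n c') y' \<Longrightarrow> c = c' \<and> y = y'"
  shows "deterministic V"
  unfolding deterministic_def by (intro allI impI) (rule assms)

lemma deterministic_inj:
  assumes V: "deterministic V" and v: "v \<in> hom Chat V' V" and inj: "\<And>x. inj_on (lab v x) (El V' x)"
  shows "deterministic V'"
proof (rule deterministicI)
  fix n c n' c' n'' y y'
  assume h: "basic n c n'" "basic n c' n''" "y \<in> El V' c" "y' \<in> El V' c'"
    "Act V' (sarr n c) y = Act V' (sarr n c') y'"
  then have "Act V (sarr n c) (lab v c y) = Act V (sarr n c') (lab v c' y')"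
    using lab_Act[OF v sarr_hom[OF h(1)] h(3)] lab_Act[OF v sarr_hom[OF h(2)] h(4)] by simp
  then have e: "c = c' \<and> lab v c y = lab v c' y'"
    using deterministicD[OF V h(1,2) lab_in[OF v h(3)] lab_in[OF v h(4)]] by blast
  then show "c = c' \<and> y = y'" using inj_onD[OF inj, of c' y y'] h(3,4) by blast
qed

lemma run_unique:
  assumes V: "deterministic V"
  shows "run V n x w ys m z \<Longrightarrow> run V n x w ys' m' z' \<Longrightarrow> ys = ys'"
proof (induction w arbitrary: n x ys ys')
  case (Cons c w)
  from Cons.prems(1) obtain y us n1 where 1: "ys = y # us" "basic n c n1" "y \<in> El V c" "Act V (sarr n c) y = x"
    "run V n1 (Act V (tarr n1 c) y) w us m z" by auto
  from Cons.prems(2) obtain y' us' n2 where 2: "ys' = y' # us'" "basic n c n2" "y' \<in> El V c" "Act V (sarr n c) y' = x"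
    "run V n2 (Act V (tarr n2 c) y') w us' m' z'" by auto
  have "n2 = n1" using basic_det[OF 1(2) 2(2)] by simp
  moreover have "y = y'" using deterministicD[OF V 1(2) 2(2) 1(3) 2(3)] 1(4) 2(4) by simp
  ultimately show ?case using Cons.IH[OF 1(5)] 1(1) 2(1,5) by simp
qed simp

text \<open>Runs from \<open>x\<close> cannot leave \<open>w\<close>: next to the run along
  \<open>w\<close> itself there are only its initial segments.\<close>

definition rigid :: "nat \<Rightarrow> cobj list \<Rightarrow> cpsh \<Rightarrow> carrow \<Rightarrow> bool" where
  "rigid n w V x \<longleftrightarrow> deterministic V \<and> (\<forall>w' ys m z. run V n x w' ys m z \<longrightarrow> prefix w' w)"

text \<open>Prepending letters makes the induction work: a pushout along \<open>tmap\<close> adds a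
  single move, and its initial player is new, so it neither competes with a move of \<open>V\<close>
  nor can be reached from one.\<close>

lemma ex_rigid_representation:
  "valid n w m \<Longrightarrow> \<exists>V x zs. represents n w V x zs \<and> rigid n w V x"
proof (induction w arbitrary: n)
  case Nil
  have no: "El (player n) c = {}" if "basic k c k'" for k c k'
    using hom_Pl[of _ c n] basic_ok[OF that] by auto
  have "deterministic (player n)" by (rule deterministicI) (use no in blast)
  moreover have "w' = []" if "run (player n) n x w' ys m z" for w' x ys m z
    using that no by (cases w') auto
  ultimately have "rigid n [] (player n) (lab (Ide Chat (player n)) (Pl n) (pt n))"
    unfolding rigid_def by auto
  moreover have "represents n [] (player n) (lab (Ide Chat (player n)) (Pl n) (pt n)) []"
    by (rule represents_Nil[OF ide_yo(2,1)])
  ultimately show ?case by blast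
next
  case (Cons c w)
  then obtain n' where c: "basic n c n'" "valid n' w m" by auto
  from Cons.IH[OF this(2)] obtain V x zs where r: "represents n' w V x zs" and rig: "rigid n' w V x" by blast
  note d = representsD[OF r]
  define i where "i = C.elem_map (Pl n') V x"
  have i: "i \<in> hom Chat (player n') V" "lab i (Pl n') (pt n') = x"
    unfolding i_def using C.elem_map_hom[OF d(1,2)] C.lab_elem_map_ide[OF d(1,2)] by auto
  note t = tmap_hom[OF c(1)]
  obtain a b where po: "is_pushout Chat (tmap n' c) i a b"
    using pushout_ex[OF t i(1)] by blast
  note P = pushout_yo[OF po tarr_hom[OF c(1)] i(1), unfolded i(2)]
  let ?y = "lab a c (Ide \<C> c)"
  \<comment> \<open>Off \<open>Star\<close> a player has no element but its identity, so
    \<open>tmap\<close> is injective there and adhesivity applies.\<close>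
  have inj: "inj_on (lab (tmap n' c) y) (El (player n') y)" if "y \<noteq> Star" for y
  proof (rule inj_onI)
    fix f g assume "f \<in> El (player n') y" "g \<in> El (player n') y"
    then show "f = g" using hom_Pl[of f y n'] hom_Pl[of g y n'] that by simp
  qed
  \<comment> \<open>At the stage of a move type, the representable of \<open>c\<close> contributes
    at most the identity, since \<open>s\<close> and \<open>t\<close> live at players. So a move of
    the pushout is either the new one or comes from \<open>V\<close>.\<close>
  have elems: "c' = c \<and> e = ?y \<or> (\<exists>f \<in> El V c'. e = lab b c' f)"
    if c': "basic k c' k'" and e: "e \<in> El (tgt a) c'" for e k c' k'
  proof -
    consider g where "g \<in> hom \<C> c' c" "e = lab a c' g" | f where "f \<in> El V c'" "e = lab b c' f"
      using pushout_cover[OF po t i(1), of c'] e by auto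
    then show ?thesis
      using hom_basic[OF _ c(1)] basic_ok[OF c'] by cases blast+
  qed
  have sa: "Act (tgt a) (sarr n c) ?y = lab a (Pl n) (sarr n c)"
    using C.lab_yo_hom[OF P(1) sarr_hom[OF c(1)]] by simp
  \<comment> \<open>A player of \<open>V\<close> that equals the initial player of the new move
    would, by adhesivity, come from the glued player; then \<open>s\<close> would equal
    \<open>t\<close>.\<close>
  have apart: "Act (tgt a) (sarr n c) ?y \<noteq> lab b (Pl n) f" if f: "f \<in> El V (Pl n)" for f
  proof
    assume "Act (tgt a) (sarr n c) ?y = lab b (Pl n) f"
    then obtain g where g: "g \<in> hom \<C> (Pl n) (Pl n')" "sarr n c = lab (tmap n' c) (Pl n) g"
      using pushout_amalg[OF po t i(1) inj, of "Pl n" "sarr n c" f] sa sarr_hom[OF c(1)] f by auto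
    then have n: "n = n'" "g = Ide \<C> (Pl n')" using hom_Pl by blast+
    then have "sarr n c = tarr n' c"
      using g(2) C.lab_yo_map[OF tarr_hom[OF c(1)]] C.comp_ide[OF tarr_hom[OF c(1)]] pt_in[of n'] by simp
    then show False using sarr_neq_tarr[OF c(1)] by blast
  qed
  have b_inj: "inj_on (lab b y) (El V y)" if "y \<noteq> Star" for y
    by (rule pushout_inj[OF po t i(1) inj[OF that]])
  have V: "deterministic V" using rig by (simp add: rigid_def)
  have actb: "Act (tgt a) (sarr k c') (lab b c' f) = lab b (Pl k) (Act V (sarr k c') f)"
      "Act V (sarr k c') f \<in> El V (Pl k)"
    if "basic k c' k'" "f \<in> El V c'" for k c' k' f
    using lab_Act[OF P(2) sarr_hom[OF that(1)] that(2)] Act_in[OF d(1) sarr_hom[OF that(1)] that(2)] by auto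
  have det: "deterministic (tgt a)"
  proof (rule deterministicI)
    fix k c1 k1 c2 k2 y1 y2
    assume h: "basic k c1 k1" "basic k c2 k2" "y1 \<in> El (tgt a) c1" "y2 \<in> El (tgt a) c2"
      and eq: "Act (tgt a) (sarr k c1) y1 = Act (tgt a) (sarr k c2) y2"
    from elems[OF h(1,3)] elems[OF h(2,4)]
    consider "c1 = c" "y1 = ?y" "c2 = c" "y2 = ?y"
      | f where "c1 = c" "y1 = ?y" "f \<in> El V c2" "y2 = lab b c2 f"
      | f where "c2 = c" "y2 = ?y" "f \<in> El V c1" "y1 = lab b c1 f"
      | f1 f2 where "f1 \<in> El V c1" "y1 = lab b c1 f1" "f2 \<in> El V c2" "y2 = lab b c2 f2" by blast
    then show "c1 = c2 \<and> y1 = y2"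
    proof cases
      case (2 f)
      then have "k = n" using basic_det h(1) c(1) by blast
      then show ?thesis
        using apart[of "Act V (sarr n c2) f"] actb[OF h(2) 2(3)] eq 2 by simp
    next
      case (3 f)
      then have "k = n" using basic_det h(2) c(1) by blast
      then show ?thesis
        using apart[of "Act V (sarr n c1) f"] actb[OF h(1) 3(3)] eq 3 by simp
    next
      case (4 f1 f2)
      then have "Act V (sarr k c1) f1 = Act V (sarr k c2) f2"
        using eq actb[OF h(1) 4(1)] actb[OF h(2) 4(3)] inj_onD[OF b_inj[of "Pl k"]] by simp
      then show ?thesis using deterministicD[OF V h(1,2) 4(1,3)] 4 by auto
    qed simp
  qed
  \<comment> \<open>A run that starts in \<open>V\<close> stays in \<open>V\<close>, because the new
    move starts at a player outside \<open>V\<close>.\<close>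
  have descend: "\<exists>us z'. run V k f w' us l z'" if "run (tgt a) k (lab b (Pl k) f) w' ys l z" "f \<in> El V (Pl k)"
    for k f w' ys l z
    using that
  proof (induction w' arbitrary: k f ys)
    case (Cons c' w')
    from Cons.prems(1) obtain y ys' k' where 1: "basic k c' k'" "y \<in> El (tgt a) c'"
      "Act (tgt a) (sarr k c') y = lab b (Pl k) f" "run (tgt a) k' (Act (tgt a) (tarr k' c') y) w' ys' l z"
      by auto
    have "\<not> (c' = c \<and> y = ?y)" using apart Cons.prems(2) 1(1,3) basic_det[OF c(1)] by metis
    then obtain g where g: "g \<in> El V c'" "y = lab b c' g" using elems[OF 1(1,2)] by blast
    have "Act V (sarr k c') g = f"
      using inj_onD[OF b_inj[of "Pl k"]] actb[OF 1(1) g(1)] 1(3) g(2) Cons.prems(2) by simp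
    moreover have "\<exists>us z'. run V k' (Act V (tarr k' c') g) w' us l z'"
      using Cons.IH[of k' "Act V (tarr k' c') g" ys'] 1(4) g lab_Act[OF P(2) tarr_hom[OF 1(1)] g(1)]
        Act_in[OF d(1) tarr_hom[OF 1(1)] g(1)] by simp
    ultimately show ?case using 1(1) g(1) by fastforce
  qed (metis run.simps(1))
  have "prefix w' (c # w)" if "run (tgt a) n (lab a (Pl n) (sarr n c)) w' ys l z" for w' ys l z
  proof (cases w')
    case (Cons c' w1)
    with that obtain y ys' n1 where 1: "basic n c' n1" "y \<in> El (tgt a) c'"
      "Act (tgt a) (sarr n c') y = lab a (Pl n) (sarr n c)" "run (tgt a) n1 (Act (tgt a) (tarr n1 c') y) w1 ys' l z"
      by auto
    then have y: "c' = c" "y = ?y" using deterministicD[OF det 1(1) c(1) 1(2) P(3)] sa by auto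
    then have n1: "n1 = n'" using basic_det[OF c(1)] 1(1) by blast
    have "run (tgt a) n' (lab b (Pl n') x) w1 ys' l z" using 1(4) y n1 P(4) by simp
    then have "prefix w1 w" using descend d(2) rig unfolding rigid_def by blast
    then show ?thesis using Cons y by simp
  qed simp
  then have "rigid n (c # w) (tgt a) (lab a (Pl n) (sarr n c))" using det by (auto simp: rigid_def)
  then show ?case using represents_Cons[OF r c(1) i po] by blast
qed

text \<open>Representing objects of a word are isomorphic, so rigidity passes from the one built
  letter by letter to all of them.\<close>

lemma represents_rigid:
  assumes r: "represents n w V x zs"
  shows "rigid n w V x"
proof -
  note d = representsD[OF r]
  obtain m where "valid n w m" using d(3) run_valid by blast
  then obtain V' x' zs' where r': "represents n w V' x' zs'" and rig: "rigid n w V' x'"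
    using ex_rigid_representation by blast
  obtain u where u: "iso Chat u" "u \<in> hom Chat V V'" "lab u (Pl n) x = x'"
    using represents_unique[OF r r'] by metis
  have "deterministic V"
    using deterministic_inj[OF _ u(2)] C.iso_bij[OF u(1,2)] rig by (auto simp: rigid_def bij_betw_def)
  moreover have "prefix w' w" if "run V n x w' ys m z" for w' ys m z
    using run_map[OF u(2) that d(2)] u(3) rig by (auto simp: rigid_def)
  ultimately show ?thesis by (auto simp: rigid_def)
qed

lemma represents_word_unique:
  assumes r: "represents n w V x zs" and r': "represents n w' V x zs'"
  shows "w = w'"
  using represents_rigid[OF r] represents_rigid[OF r'] representsD(3)[OF r] representsD(3)[OF r']
  unfolding rigid_def by (metis prefix_order.antisym)

text \<open>A morphism transports the run along \<open>w\<close> into \<open>V'\<close>, where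
  rigidity makes \<open>w\<close> a prefix. Conversely an initial segment of the universal run of
  \<open>V'\<close> induces a morphism.\<close>

lemma represents_hom_iff_prefix:
  assumes r: "represents n w V x zs" and r': "represents n w' V' x' zs'"
  shows "(\<exists>k \<in> hom Chat V V'. lab k (Pl n) x = x') \<longleftrightarrow> prefix w w'"
proof
  assume "\<exists>k \<in> hom Chat V V'. lab k (Pl n) x = x'"
  then obtain k where k: "k \<in> hom Chat V V'" "lab k (Pl n) x = x'" by blast
  obtain m z where run: "run V n x w zs m z" using representsD(3)[OF r] by blast
  show "prefix w w'"
    using run_map[OF k(1) run representsD(2)[OF r]] k(2) represents_rigid[OF r'] by (auto simp: rigid_def)
next
  assume "prefix w w'"
  then obtain w2 where w2: "w' = w @ w2" by (auto simp: prefix_def)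
  obtain ys m z where "run V' n x' w ys m z" using representsD(3)[OF r'] unfolding w2 run_append by blast
  then show "\<exists>k \<in> hom Chat V V'. lab k (Pl n) x = x'"
    using representsD(4)[OF r representsD(1,2)[OF r']] by blast
qed

text \<open>Both morphisms send the universal run to runs along \<open>w\<close> from
  \<open>x'\<close>, and a deterministic presheaf has at most one of these.\<close>

lemma represents_hom_unique:
  assumes r: "represents n w V x zs" and r': "represents n w' V' x' zs'"
    and k: "k \<in> hom Chat V V'" "lab k (Pl n) x = x'" and l: "l \<in> hom Chat V V'" "lab l (Pl n) x = x'"
  shows "k = l"
proof -
  obtain m z where run: "run V n x w zs m z" using representsD(3)[OF r] by blast
  note rk = run_map[OF k(1) run representsD(2)[OF r], unfolded k(2)]
  note rl = run_map[OF l(1) run representsD(2)[OF r], unfolded l(2)]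
  have "deterministic V'" using represents_rigid[OF r'] by (simp add: rigid_def)
  then have "map2 (lab k) w zs = map2 (lab l) w zs" using run_unique rk rl by blast
  then show ?thesis
    by (intro ex1_unique[OF representsD(4)[OF r representsD(1,2)[OF r'] rl]]) (use k l in auto)
qed


section \<open>Extended moves between players\<close>

text \<open>By Yoneda such a map is an arrow between players in the base category, where only
  identities exist. Hence the map to [n] that comes with an object of \<open>\<V> n\<close> is an
  identity, and a position has at most one identification with a player.\<close>

lemma player_hom: "f \<in> hom Chat (player m) (player n) \<Longrightarrow> m = n \<and> f = Ide Chat (player n)"
proof -
  assume f: "f \<in> hom Chat (player m) (player n)"
  have "lab f (Pl m) (pt m) \<in> hom \<C> (Pl m) (Pl n)" using lab_in[OF f pt_in] by simp
  then have e: "m = n" "lab f (Pl m) (pt m) = pt n" using hom_Pl by blast+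
  have "f = Ide Chat (player n)"
    by (rule C.yo_hom_eqI[of _ "Pl n" "player n"])
      (use f e lab_ide[OF pt_in] in \<open>simp_all add: C.Psh_ide_hom C.presheaf_yo\<close>)
  with e show ?thesis by blast
qed

lemma d_hom: "i \<in> {1..n} \<Longrightarrow> carr Star [Gd n i] (Pl n) \<in> hom \<C> Star (Pl n)"
  by (auto simp: hom_Star_Pl)

lemma d_map_hom: "i \<in> {1..n} \<Longrightarrow> d_map n i \<in> hom Chat (yo \<C> Star) (player n)"
  unfolding d_map_def by (rule C.yo_map_hom[OF d_hom])

lemma ide_Star_in: "Ide \<C> Star \<in> El (yo \<C> Star) Star"
  using C.ide_hom[of Star] by simp

lemma lab_d_map: "i \<in> {1..n} \<Longrightarrow> lab (d_map n i) Star (Ide \<C> Star) = carr Star [Gd n i] (Pl n)"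
  unfolding d_map_def using C.lab_yo_map[OF d_hom] C.comp_ide[OF d_hom] C.ide_hom[of Star] by simp

section \<open>A model of the interface\<close>

text \<open>A concrete coproduct of \<open>n\<close> copies of the representable of
  \<open>Star\<close>: the part of [n] that lives at \<open>Star\<close>, whose elements are the
  distinct arrows \<open>d_1, ..., d_n\<close>.\<close>

definition channels :: "nat \<Rightarrow> cpsh" where
  "channels n = \<lparr>El = \<lambda>x. if x = Star then hom \<C> Star (Pl n) else {},
     Act = \<lambda>f. if f \<in> Arr \<C> then \<lambda>e \<in> (if tgt f = Star then hom \<C> Star (Pl n) else {}). e else (\<lambda>_. undefined)\<rparr>"

lemma El_channels [simp]: "El (channels n) x = (if x = Star then hom \<C> Star (Pl n) else {})"
  by (simp add: channels_def)

lemma Act_channels: "f \<in> hom \<C> x Star \<Longrightarrow> e \<in> hom \<C> Star (Pl n) \<Longrightarrow> Act (channels n) f e = e"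
  by (simp add: channels_def hom_iff)

lemma presheaf_channels: "presheaf \<C> (channels n)"
proof (rule C.presheafI)
  show "Act (channels n) f \<in> extensional (El (channels n) (tgt f))" if "f \<in> Arr \<C>" for f
    using that by (simp add: channels_def)
  show "Act (channels n) f e \<in> El (channels n) x" if "f \<in> hom \<C> x y" "e \<in> El (channels n) y" for f x y e
    using that hom_to_Star[of f x] Act_channels[of f x e n] by (auto split: if_splits)
  show "Act (channels n) (Ide \<C> x) e = e" if "e \<in> El (channels n) x" for x e
    using that Act_channels[of "Ide \<C> Star" Star e n] C.ide_hom[of Star] by (auto split: if_splits)
  show "Act (channels n) (Comp \<C> g f) e = Act (channels n) f (Act (channels n) g e)"
    if "f \<in> hom \<C> x y" "g \<in> hom \<C> y z" "e \<in> El (channels n) z" for f g x y z e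
  proof -
    have z: "z = Star" "e \<in> hom \<C> Star (Pl n)" using that(3) by (auto split: if_splits)
    then have g: "g \<in> hom \<C> y Star" "y = Star" using that(2) hom_to_Star by auto
    then have f: "f \<in> hom \<C> x Star" using that(1) by simp
    show ?thesis
      using Act_channels[OF f z(2)] Act_channels[OF g(1) z(2)]
        Act_channels[OF C.comp_hom[OF f g(1)[unfolded g(2)]] z(2)] by simp
  qed
qed (auto simp: channels_def)

lemma channels_homI:
  assumes "presheaf \<C> Q" "\<And>e. e \<in> hom \<C> Star (Pl n) \<Longrightarrow> F e \<in> El Q Star"
  shows "Arrow (channels n) (\<lambda>x. restrict F (El (channels n) x)) Q \<in> hom Chat (channels n) Q"
proof (rule Psh_homI[OF presheaf_channels assms(1), where \<phi> = "\<lambda>_. F"])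
  show "F e \<in> El Q x" if "e \<in> El (channels n) x" for x e
    using that assms(2) by (auto split: if_splits)
  show "F (Act (channels n) h e) = Act Q h (F e)" if "h \<in> hom \<C> x y" "e \<in> El (channels n) y" for h x y e
  proof -
    have y: "y = Star" "e \<in> hom \<C> Star (Pl n)" using that(2) by (auto split: if_splits)
    then have h: "x = Star" "h = Ide \<C> Star" "h \<in> hom \<C> x Star" using that(1) hom_to_Star by blast+
    show ?thesis
      using Act_channels[OF h(3) y(2)] Act_ide[OF assms(1) assms(2)[OF y(2)]] h by simp
  qed
qed

definition channel_incl :: "nat \<Rightarrow> cmor" where
  "channel_incl n = Arrow (channels n) (\<lambda>x. restrict (\<lambda>e. e) (El (channels n) x)) (player n)"

lemma channel_incl_hom: "channel_incl n \<in> hom Chat (channels n) (player n)"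
  unfolding channel_incl_def by (rule channels_homI) (simp_all add: C.presheaf_yo)

definition coproj :: "nat \<Rightarrow> nat \<Rightarrow> cmor" where
  "coproj n i = C.elem_map Star (channels n) (carr Star [Gd n i] (Pl n))"

lemma coproj_hom: "i \<in> {1..n} \<Longrightarrow> coproj n i \<in> hom Chat (yo \<C> Star) (channels n)"
  unfolding coproj_def using C.elem_map_hom[OF presheaf_channels] d_hom by simp

lemma lab_coproj: "i \<in> {1..n} \<Longrightarrow> lab (coproj n i) Star (Ide \<C> Star) = carr Star [Gd n i] (Pl n)"
  unfolding coproj_def using C.lab_elem_map_ide[OF presheaf_channels] d_hom by simp

lemma channels_coproduct: "is_coproduct Chat {1..n} (\<lambda>_. yo \<C> Star) (channels n) (coproj n)"
  unfolding is_coproduct_def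
proof (intro conjI ballI allI impI)
  show "channels n \<in> Obj Chat" by (simp add: presheaf_channels)
  show "coproj n i \<in> hom Chat (yo \<C> Star) (channels n)" if "i \<in> {1..n}" for i using coproj_hom[OF that] .
  fix Q g assume "Q \<in> Obj Chat" and g: "\<forall>i\<in>{1..n}. g i \<in> hom Chat (yo \<C> Star) Q"
  then have Q: "presheaf \<C> Q" by simp
  define F where "F e = lab (g (inv_into {1..n} (\<lambda>i. carr Star [Gd n i] (Pl n)) e)) Star (Ide \<C> Star)" for e
  have F: "F (carr Star [Gd n i] (Pl n)) = lab (g i) Star (Ide \<C> Star)" if "i \<in> {1..n}" for i
    unfolding F_def by (simp only: inv_into_f_f[OF inj_Gd that])
  have FQ: "F e \<in> El Q Star" if "e \<in> hom \<C> Star (Pl n)" for e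
    using that F lab_in[OF _ ide_Star_in] g unfolding hom_Star_Pl by fastforce
  define u where "u = Arrow (channels n) (\<lambda>x. restrict F (El (channels n) x)) Q"
  have u: "u \<in> hom Chat (channels n) Q" unfolding u_def by (rule channels_homI[OF Q FQ])
  have comp_iff: "v \<odot> coproj n i = g i \<longleftrightarrow> lab v Star (carr Star [Gd n i] (Pl n)) = lab (g i) Star (Ide \<C> Star)"
    if i: "i \<in> {1..n}" and v: "v \<in> hom Chat (channels n) Q" for v i
  proof -
    have e: "lab (v \<odot> coproj n i) Star (Ide \<C> Star) = lab v Star (carr Star [Gd n i] (Pl n))"
      using lab_comp[OF coproj_hom[OF i] ide_Star_in] lab_coproj[OF i] by simp
    show ?thesis
      using C.yo_hom_eqI[OF Ch.comp_hom[OF coproj_hom[OF i] v] bspec[OF g i]] e by auto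
  qed
  show "\<exists>!u. u \<in> hom Chat (channels n) Q \<and> (\<forall>i\<in>{1..n}. u \<odot> coproj n i = g i)"
  proof (rule ex1I[of _ u])
    show "u \<in> hom Chat (channels n) Q \<and> (\<forall>i\<in>{1..n}. u \<odot> coproj n i = g i)"
    proof (intro conjI ballI u)
      fix i assume i: "i \<in> {1..n}"
      show "u \<odot> coproj n i = g i" unfolding comp_iff[OF i u] using F[OF i] d_hom[OF i] by (simp add: u_def)
    qed
    fix v assume v: "v \<in> hom Chat (channels n) Q \<and> (\<forall>i\<in>{1..n}. v \<odot> coproj n i = g i)"
    show "v = u"
    proof (rule Psh_ext[of _ _ "channels n" Q])
      fix x e assume "e \<in> El (channels n) x"
      then have x: "x = Star" "e \<in> hom \<C> Star (Pl n)" by (auto split: if_splits)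
      then obtain i where i: "i \<in> {1..n}" "e = carr Star [Gd n i] (Pl n)" unfolding hom_Star_Pl by blast
      show "lab v x e = lab u x e"
        using comp_iff[OF i(1), of v] v i x F[OF i(1)] by (simp add: u_def)
    qed (use u v in auto)
  qed
qed

lemma coproductD:
  assumes "is_coproduct D J A P e"
  shows "P \<in> Obj D" "\<And>i. i \<in> J \<Longrightarrow> e i \<in> hom D (A i) P"
    "\<And>Q g. Q \<in> Obj D \<Longrightarrow> (\<And>i. i \<in> J \<Longrightarrow> g i \<in> hom D (A i) Q) \<Longrightarrow>
      \<exists>!u. u \<in> hom D P Q \<and> (\<forall>i\<in>J. Comp D u (e i) = g i)"
  using assms unfolding is_coproduct_def by blast+

text \<open>An arbitrary coproduct is compared with the model \<open>channels n\<close>, for which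
  the induced map to [n] is the inclusion.\<close>

lemma interface_structure:
  assumes co: "is_coproduct Chat {1..n} (\<lambda>_. yo \<C> Star) J e"
    and \<delta>: "\<delta> \<in> hom Chat J (player n)" "\<And>i. i \<in> {1..n} \<Longrightarrow> \<delta> \<odot> e i = d_map n i"
  shows "x \<noteq> Star \<Longrightarrow> El J x = {}" and "bij_betw (lab \<delta> Star) (El J Star) (hom \<C> Star (Pl n))"
proof -
  note c = coproductD[OF co] and c0 = coproductD[OF channels_coproduct[of n]]
  obtain v where v: "v \<in> hom Chat J (channels n)" "\<And>i. i \<in> {1..n} \<Longrightarrow> v \<odot> e i = coproj n i"
    using c(3)[OF c0(1), of "coproj n"] c0(2) by blast
  obtain w where w: "w \<in> hom Chat (channels n) J" "\<And>i. i \<in> {1..n} \<Longrightarrow> w \<odot> coproj n i = e i"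
    using c0(3)[OF c(1), of e] c(2) by blast
  show "El J x = {}" if "x \<noteq> Star" using lab_in[OF v(1), of _ x] that by auto
  have wv: "w \<odot> v = Ide Chat J"
  proof (rule ex1_unique[OF c(3)[OF c(1), of e]])
    show "w \<odot> v \<in> hom Chat J J \<and> (\<forall>i\<in>{1..n}. (w \<odot> v) \<odot> e i = e i)"
      using Ch.comp_hom[OF v(1) w(1)] Ch.comp_assoc[OF c(2) v(1) w(1)] v(2) w(2) by simp
    show "Ide Chat J \<in> hom Chat J J \<and> (\<forall>i\<in>{1..n}. Ide Chat J \<odot> e i = e i)"
      using Ch.ide_hom[OF c(1)] Ch.ide_comp[OF c(2)] by simp
  qed (rule c(2))
  have \<delta>v: "\<delta> = channel_incl n \<odot> v"
  proof (rule ex1_unique[OF c(3)[of "player n" "d_map n"]])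
    show "\<delta> \<in> hom Chat J (player n) \<and> (\<forall>i\<in>{1..n}. \<delta> \<odot> e i = d_map n i)" using \<delta> by blast
    have "(channel_incl n \<odot> v) \<odot> e i = d_map n i" if i: "i \<in> {1..n}" for i
    proof -
      have "channel_incl n \<odot> coproj n i = d_map n i"
      proof (rule C.yo_hom_eqI[OF Ch.comp_hom[OF coproj_hom[OF i] channel_incl_hom] d_map_hom[OF i]])
        show "lab (channel_incl n \<odot> coproj n i) Star (Ide \<C> Star) = lab (d_map n i) Star (Ide \<C> Star)"
          using lab_comp[OF coproj_hom[OF i] ide_Star_in] lab_coproj[OF i] lab_d_map[OF i] d_hom[OF i]
          by (simp add: channel_incl_def)
      qed
      then show ?thesis using Ch.comp_assoc[OF c(2)[OF i] v(1) channel_incl_hom] v(2)[OF i] by simp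
    qed
    then show "channel_incl n \<odot> v \<in> hom Chat J (player n) \<and> (\<forall>i\<in>{1..n}. (channel_incl n \<odot> v) \<odot> e i = d_map n i)"
      using Ch.comp_hom[OF v(1) channel_incl_hom] by blast
  qed (simp_all add: C.presheaf_yo d_map_hom)
  show "bij_betw (lab \<delta> Star) (El J Star) (hom \<C> Star (Pl n))"
  proof (rule bij_betw_imageI)
    have lv: "lab \<delta> Star j = lab v Star j" if "j \<in> El J Star" for j
      using lab_comp[OF v(1) that, of "channel_incl n"] lab_in[OF v(1) that] \<delta>v by (simp add: channel_incl_def)
    have "lab w Star (lab v Star j) = j" if "j \<in> El J Star" for j
      using lab_comp[OF v(1) that, of w] lab_ide[OF that, of \<C>] wv by simp
    then show "inj_on (lab \<delta> Star) (El J Star)" by (intro inj_onI) (metis lv)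
    have "carr Star [Gd n i] (Pl n) \<in> lab \<delta> Star ` El J Star" if i: "i \<in> {1..n}" for i
      using lab_comp[OF c(2)[OF i] ide_Star_in, of \<delta>] \<delta>(2)[OF i] lab_d_map[OF i] lab_in[OF c(2)[OF i] ide_Star_in]
      by (metis image_eqI)
    then show "lab \<delta> Star ` El J Star = hom \<C> Star (Pl n)"
      using lab_in[OF \<delta>(1), of _ Star] unfolding hom_Star_Pl[symmetric] by (auto simp: hom_Star_Pl)
  qed
qed

text \<open>Pushing a move out along \<open>z: J \<rightarrow> Z\<close> gives an initial position isomorphic to a player only
  if \<open>z\<close> is an isomorphism.\<close>

lemma extended_move_player:
  assumes em: "extended_move (l, r)" and u: "iso Chat u" "u \<in> hom Chat (src l) (player k)"
  obtains c k' x y m where "basic k c k'" "iso Chat x" "x \<in> hom Chat (player k) (src l)"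
    "iso Chat y" "y \<in> hom Chat (player k') (src r)" "iso Chat m" "m \<in> hom Chat (yo \<C> c) (tgt l)"
    "l \<odot> x = m \<odot> smap k c" "r \<odot> y = m \<odot> tmap k' c"
    "l \<in> hom Chat (src l) (tgt l)" "r \<in> hom Chat (src r) (tgt l)"
proof -
  from em obtain n c n' s t J e \<delta> \<delta>' z x x' m m' y y' where
     c: "basic n c n'" and st: "basic_cospan n c n' = (s, t)"
     and co: "is_coproduct Chat {1..n} (\<lambda>_. yo \<C> Star) J e"
     and \<delta>: "\<delta> \<in> hom Chat J (player n)" "\<forall>i \<in> {1..n}. \<delta> \<odot> e i = d_map n i"
     and \<delta>': "\<delta>' \<in> hom Chat J (player n')"
     and z: "z \<in> Arr Chat" "src z = J"
     and pox: "is_pushout Chat \<delta> z x x'"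
     and pom: "is_pushout Chat (s \<odot> \<delta>) z m m'"
     and poy: "is_pushout Chat \<delta>' z y y'"
     and l: "l \<in> hom Chat (tgt x) (tgt m)" "l \<odot> x = m \<odot> s"
     and r: "r \<in> hom Chat (tgt y) (tgt m)" "r \<odot> y = m \<odot> t"
    unfolding extended_move_def fst_conv snd_conv by blast
  define Z where "Z = tgt z"
  have z': "z \<in> hom Chat J Z" using z by (simp add: hom_iff Z_def)
  have s: "s = smap n c" "t = tmap n' c"
    using st by (simp_all add: basic_cospan_def sarr_def tarr_def)
  have sh: "s \<in> hom Chat (player n) (yo \<C> c)" unfolding s by (rule smap_hom[OF c])
  have sr: "src l = tgt x" "tgt l = tgt m" "src r = tgt y" using l(1) r(1) by (auto simp: hom_iff)
  have x: "x \<in> hom Chat (player n) (tgt x)" and x': "x' \<in> hom Chat Z (tgt x)"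
    using pox \<delta>(1) z' by (auto simp: is_pushout_def hom_iff)
  have m: "m \<in> hom Chat (yo \<C> c) (tgt m)"
    using pom Ch.comp_hom[OF \<delta>(1) sh] by (auto simp: is_pushout_def hom_iff)
  have y: "y \<in> hom Chat (player n') (tgt y)"
    using poy \<delta>' by (auto simp: is_pushout_def hom_iff)
  have u': "u \<in> hom Chat (tgt x) (player k)" using u(2) sr by simp
  \<comment> \<open>Maps between players are identities, so \<open>u\<close> after \<open>x\<close>
    is one; since \<open>u\<close> is invertible, \<open>x\<close> is its inverse and therefore
    bijective at every stage.\<close>
  have n: "n = k" "u \<odot> x = Ide Chat (player k)" using player_hom[OF Ch.comp_hom[OF x u']] by auto
  have bx: "bij_betw (lab x a) (El (player n) a) (El (tgt x) a)" for a
  proof -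
    obtain v where v: "v \<in> hom Chat (player k) (tgt x)" "v \<odot> u = Ide Chat (tgt x)" "iso Chat v"
      using iso_inverseE[OF u(1) u'] by metis
    have "x = v" using Ch.comp_assoc[OF x u' v(1)] v(2) n(2) Ch.comp_ide[OF v(1)] Ch.ide_comp[OF x] by simp
    then show ?thesis using C.iso_bij[OF v(3)] x by blast
  qed
  have J: "El J a = {}" if "a \<noteq> Star" for a using interface_structure(1)[OF co \<delta>(1)] \<delta>(2) that by blast
  have b\<delta>: "bij_betw (lab \<delta> Star) (El J Star) (El (player n) Star)"
    using interface_structure(2)[OF co \<delta>(1)] \<delta>(2) by simp
  have inj: "inj_on (lab \<delta> a) (El J a)" for a
    using J[of a] b\<delta> by (cases "a = Star") (auto simp: bij_betw_def)
  \<comment> \<open>As \<open>x\<close> is onto, the image in the pushout of an element of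
    \<open>Z\<close> also comes from the player; by adhesivity the element comes from the interface.
    So \<open>Z\<close> adds nothing to \<open>J\<close>.\<close>
  have surj: "\<exists>j \<in> El J a. \<zeta> = lab z a j" if \<zeta>: "\<zeta> \<in> El Z a" for \<zeta> a
  proof -
    have "lab x' a \<zeta> \<in> El (tgt x) a" using lab_in[OF x' \<zeta>] .
    then obtain b where b: "b \<in> El (player n) a" "lab x a b = lab x' a \<zeta>"
      using bx[of a] unfolding bij_betw_def by (metis imageE)
    show ?thesis using pushout_amalg[OF pox \<delta>(1) z' inj b(1) \<zeta> b(2)] by blast
  qed
  have sq: "lab x a (lab \<delta> a j) = lab x' a (lab z a j)" if "j \<in> El J a" for j a
    using lab_comp[OF \<delta>(1) that, of x] lab_comp[OF z' that, of x'] pox by (simp add: is_pushout_def)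
  have "bij_betw (lab z a) (El J a) (El Z a)" for a
  proof (rule bij_betw_imageI)
    \<comment> \<open>Channels merged by \<open>z\<close> would be merged by \<open>x\<close> after
      \<open>\<delta>\<close> as well, which is injective.\<close>
    show "inj_on (lab z a) (El J a)"
    proof (rule inj_onI)
      fix j j' assume j: "j \<in> El J a" "j' \<in> El J a" "lab z a j = lab z a j'"
      then have "lab \<delta> a j = lab \<delta> a j'"
        using sq[OF j(1)] sq[OF j(2)] lab_in[OF \<delta>(1) j(1)] lab_in[OF \<delta>(1) j(2)] bx[of a]
        unfolding bij_betw_def by (metis inj_onD)
      then show "j = j'" using inj_onD[OF inj] j by blast
    qed
    show "lab z a ` El J a = El Z a" using surj lab_in[OF z'] by blast
  qed
  then have zi: "iso Chat z" by (rule C.bij_iso[OF z'])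
  show ?thesis
    by (rule that[of c n' x y m])
      (use c n(1) x y m l r s sr Ch.pushout_of_iso[OF pox zi] Ch.pushout_of_iso[OF poy zi]
        Ch.pushout_of_iso[OF pom zi] in simp_all)
qed

text \<open>With the identity of the interface for \<open>z\<close>, all three pushouts are
  trivial.\<close>

lemma extended_move_basic:
  assumes c: "basic n c n'"
  shows "extended_move (smap n c, tmap n' c)"
proof -
  note c0 = coproductD[OF channels_coproduct[of n]]
  let ?s = "smap n c" and ?t = "tmap n' c"
  note s = smap_hom[OF c]
  note t = tmap_hom[OF c]
  have i': "i \<in> {1..n'}" if "i \<in> {1..n}" for i using that basic_le[OF c, of i] by simp
  have pp: "player k \<in> Obj Chat" "yo \<C> c \<in> Obj Chat" for k by (simp_all add: C.presheaf_yo)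
  obtain \<delta> where \<delta>: "\<delta> \<in> hom Chat (channels n) (player n)" "\<And>i. i \<in> {1..n} \<Longrightarrow> \<delta> \<odot> coproj n i = d_map n i"
    using c0(3)[OF pp(1), of "d_map n"] d_map_hom by blast
  obtain \<delta>' where \<delta>': "\<delta>' \<in> hom Chat (channels n) (player n')" "\<And>i. i \<in> {1..n} \<Longrightarrow> \<delta>' \<odot> coproj n i = d_map n' i"
    using c0(3)[OF pp(1), of "d_map n'"] d_map_hom i' by blast
  have sd: "?s \<odot> d_map n i = ?t \<odot> d_map n' i" if i: "i \<in> {1..n}" for i
  proof (rule C.yo_hom_eqI[OF Ch.comp_hom[OF d_map_hom[OF i] s] Ch.comp_hom[OF d_map_hom[OF i'[OF i]] t]])
    have p: "path Star [Gd n i] (Pl n)" "path (Pl n) [Gs c] c" "path Star [Gd n' i] (Pl n')" "path (Pl n') [Gt c] c"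
      using i i'[OF i] c by (auto intro!: edge_path edge.intros)
    have "crel Star c [Gs c, Gd n i] [Gt c, Gd n' i]" using crel.intros(1)[OF c] i by simp
    then have "Comp \<C> (sarr n c) (carr Star [Gd n i] (Pl n)) = Comp \<C> (tarr n' c) (carr Star [Gd n' i] (Pl n'))"
      unfolding sarr_def tarr_def C_comp[OF p(1,2)] C_comp[OF p(3,4)]
      using carr_eq_iff[OF path_append[OF p(2,1)]] ceq.intros(1) by simp
    then show "lab (?s \<odot> d_map n i) Star (Ide \<C> Star) = lab (?t \<odot> d_map n' i) Star (Ide \<C> Star)"
      using lab_comp[OF d_map_hom[OF i] ide_Star_in] lab_comp[OF d_map_hom[OF i'[OF i]] ide_Star_in]
        lab_d_map[OF i] lab_d_map[OF i'[OF i]] C.lab_yo_map[OF sarr_hom[OF c] d_hom[OF i]]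
        C.lab_yo_map[OF tarr_hom[OF c] d_hom[OF i'[OF i]]] by simp
  qed
  \<comment> \<open>Both legs must agree on the interface. On each channel this is the relation
    \<open>s d_i = t d_i\<close>, and the coproduct property assembles the channels.\<close>
  have sq: "?s \<odot> \<delta> = ?t \<odot> \<delta>'"
  proof (rule ex1_unique[OF c0(3)[OF pp(2), of "\<lambda>i. ?s \<odot> d_map n i"]])
    show "?s \<odot> \<delta> \<in> hom Chat (channels n) (yo \<C> c) \<and> (\<forall>i\<in>{1..n}. (?s \<odot> \<delta>) \<odot> coproj n i = ?s \<odot> d_map n i)"
      using Ch.comp_hom[OF \<delta>(1) s] Ch.comp_assoc[OF coproj_hom \<delta>(1) s] \<delta>(2) by simp
    show "?t \<odot> \<delta>' \<in> hom Chat (channels n) (yo \<C> c) \<and> (\<forall>i\<in>{1..n}. (?t \<odot> \<delta>') \<odot> coproj n i = ?s \<odot> d_map n i)"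
      using Ch.comp_hom[OF \<delta>'(1) t] Ch.comp_assoc[OF coproj_hom \<delta>'(1) t] \<delta>'(2) sd by simp
  qed (rule Ch.comp_hom[OF d_map_hom s])
  have pos: "position (channels n)"
  proof -
    have "(SIGMA x:UNIV. El (channels n) x) = {Star} \<times> hom \<C> Star (Pl n)" by (auto split: if_splits)
    then have "finite (SIGMA x:UNIV. El (channels n) x)" unfolding hom_Star_Pl by simp
    then show ?thesis
      unfolding position_def by (intro conjI presheaf_channels; (assumption | simp))
  qed
  let ?I = "\<lambda>P. Ide Chat P"
  have iJ: "?I (channels n) \<in> hom Chat (channels n) (channels n)" by (rule Ch.ide_hom[OF c0(1)])
  show ?thesis
    unfolding extended_move_def fst_conv snd_conv
  proof (intro exI conjI)
    show "basic_cospan n c n' = (?s, ?t)" by (simp add: basic_cospan_def sarr_def tarr_def)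
    show "is_coproduct Chat {1..n} (\<lambda>_. yo \<C> Star) (channels n) (coproj n)" by (rule channels_coproduct)
    show "\<forall>i\<in>{1..n}. \<delta> \<odot> coproj n i = d_map n i" "\<forall>i\<in>{1..n}. \<delta>' \<odot> coproj n i = d_map n' i"
      using \<delta>(2) \<delta>'(2) by auto
    show "?I (channels n) \<in> Arr Chat" "src (?I (channels n)) = channels n" "position (tgt (?I (channels n)))"
      using iJ pos by (auto simp: hom_iff)
    show "is_pushout Chat \<delta> (?I (channels n)) (?I (player n)) \<delta>"
      "is_pushout Chat \<delta>' (?I (channels n)) (?I (player n')) \<delta>'"
      "is_pushout Chat (?s \<odot> \<delta>) (?I (channels n)) (?I (yo \<C> c)) (?s \<odot> \<delta>)"
      using Ch.pushout_of_ide \<delta>(1) \<delta>'(1) Ch.comp_hom[OF \<delta>(1) s] by blast+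
    show "?s \<in> hom Chat (tgt (?I (player n))) (tgt (?I (yo \<C> c)))"
      "?t \<in> hom Chat (tgt (?I (player n'))) (tgt (?I (yo \<C> c)))"
      using s t Ch.ide_hom[OF pp(1)] Ch.ide_hom[OF pp(2)] by (simp_all add: hom_iff)
    show "?s \<odot> ?I (player n) = ?I (yo \<C> c) \<odot> ?s" "?t \<odot> ?I (player n') = ?I (yo \<C> c) \<odot> ?t"
      using Ch.comp_ide[OF s] Ch.ide_comp[OF s] Ch.comp_ide[OF t] Ch.ide_comp[OF t] by simp_all
    show "?s \<odot> \<delta> = ?s \<odot> \<delta>" "?t \<odot> \<delta>' = ?s \<odot> \<delta>" using sq by simp_all
  qed (fact c \<delta>(1) \<delta>'(1))+
qed


section \<open>Views\<close>

definition word_view :: "nat \<Rightarrow> cobj list \<Rightarrow> cmor \<Rightarrow> bool" where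
  "word_view n w i \<longleftrightarrow> i \<in> hom Chat (player n) (tgt i) \<and> (\<exists>zs. represents n w (tgt i) (lab i (Pl n) (pt n)) zs)"

text \<open>The final position of a play is only isomorphic to a player, whence \<open>e\<close>.
  The last conjunct places it at the end of the universal run, which is where the next move is
  glued.\<close>

definition play_word :: "nat \<Rightarrow> cobj list \<Rightarrow> nat \<Rightarrow> cmor \<Rightarrow> cmor \<Rightarrow> bool" where
  "play_word n w m l r \<longleftrightarrow> l \<in> hom Chat (player n) (tgt l) \<and> r \<in> hom Chat (src r) (tgt l) \<and>
    (\<exists>zs e. represents n w (tgt l) (lab l (Pl n) (pt n)) zs \<and> iso Chat e \<and> e \<in> hom Chat (player m) (src r) \<and>
       run (tgt l) n (lab l (Pl n) (pt n)) w zs m (lab (r \<odot> e) (Pl m) (pt m)))"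

text \<open>Absorbing the identifications \<open>e\<close> and \<open>k\<close> turns the pushout of
  \<open>r\<close> and \<open>l'\<close> into a pushout of \<open>smap m c\<close> along the end of
  the run, the situation of \<open>represents_snoc\<close>.\<close>

lemma play_word_snoc:
  assumes l: "l \<in> hom Chat (player n) V" and r: "r \<in> hom Chat Y V"
    and rep: "represents n w V (lab l (Pl n) (pt n)) zs" and e: "iso Chat e" "e \<in> hom Chat (player m) Y"
    and run: "run V n (lab l (Pl n) (pt n)) w zs m (lab (r \<odot> e) (Pl m) (pt m))"
    and c: "basic m c m'" and y: "iso Chat y" "y \<in> hom Chat (player m') Y'"
    and k: "iso Chat k" "k \<in> hom Chat (yo \<C> c) M" and l': "l' \<in> hom Chat Y M" and r': "r' \<in> hom Chat Y' M"
    and s: "l' \<odot> e = k \<odot> smap m c" and t: "r' \<odot> y = k \<odot> tmap m' c"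
    and po: "is_pushout Chat r l' p q"
  shows "play_word n (w @ [c]) m' (p \<odot> l) (q \<odot> r')"
proof -
  note sh = smap_hom[OF c]
  note th = tmap_hom[OF c]
  have p: "p \<in> hom Chat V (tgt p)" and q: "q \<in> hom Chat M (tgt p)"
    using po r l' by (auto simp: is_pushout_def hom_iff)
  have re: "r \<odot> e \<in> hom Chat (player m) V" by (rule Ch.comp_hom[OF e(2) r])
  have "is_pushout Chat (r \<odot> e) (k \<odot> smap m c) p q"
    using Ch.pushout_iso_source[OF po e(1), of "player m"] e(2) r s by (simp add: hom_iff)
  then have po': "is_pushout Chat (smap m c) (r \<odot> e) (q \<odot> k) p"
    by (rule Ch.pushout_iso_span[OF Ch.pushout_sym k sh])
  have qk: "q \<odot> k \<in> hom Chat (yo \<C> c) (tgt p)" by (rule Ch.comp_hom[OF k(2) q])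
  have pl: "p \<odot> l \<in> hom Chat (player n) (tgt p)" by (rule Ch.comp_hom[OF l p])
  have qr: "q \<odot> r' \<in> hom Chat Y' (tgt p)" by (rule Ch.comp_hom[OF r' q])
  have tg: "tgt (q \<odot> k) = tgt p" "tgt (p \<odot> l) = tgt p" "src (q \<odot> r') = Y'" using qk pl qr by (auto simp: hom_iff)
  note R = represents_snoc[OF rep run c re refl po', unfolded tg]
  have x: "lab (p \<odot> l) (Pl n) (pt n) = lab p (Pl n) (lab l (Pl n) (pt n))" by (rule lab_comp[OF l pt_in])
  have "(q \<odot> r') \<odot> y = (q \<odot> k) \<odot> tmap m' c"
    using Ch.comp_assoc[OF y(2) r' q] Ch.comp_assoc[OF th k(2) q] t by simp
  then have eq: "lab ((q \<odot> r') \<odot> y) (Pl m') (pt m') = lab (q \<odot> k) (Pl m') (tarr m' c)"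
    using lab_comp[OF th pt_in, of "q \<odot> k"] C.lab_yo_map[OF tarr_hom[OF c]] pt_in[of m'] C.comp_ide[OF tarr_hom[OF c]]
    by simp
  show ?thesis
    unfolding play_word_def tg x using pl qr R(1) R(2)[folded eq] y by blast
qed

lemma basic_play_word: "basic_play K \<Longrightarrow> src (fst K) = player n \<Longrightarrow> \<exists>w m. play_word n w m (fst K) (snd K)"
proof (induction rule: basic_play.induct)
  case (empty l)
  have l: "l \<in> hom Chat (player n) (tgt l)" using empty by (auto simp: iso_def hom_iff)
  note i = ide_yo[of "Pl n"]
  have "src l = player n" using l by (simp add: hom_iff)
  then have "play_word n [] n l l"
    unfolding play_word_def using l represents_Nil[OF empty(1) l] i Ch.comp_ide[OF l]
    by (intro conjI exI[of _ "[]"] exI[of _ "Ide Chat (player n)"]) auto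
  then show ?case by auto
next
  case (step l r l' r' p q)
  have "src l = player n" using step.prems by (simp add: Psh_def)
  then obtain w m where "play_word n w m l r" using step.IH by auto
  then obtain zs e where l: "l \<in> hom Chat (player n) (tgt l)" and r: "r \<in> hom Chat (src r) (tgt l)"
    and rep: "represents n w (tgt l) (lab l (Pl n) (pt n)) zs" and e: "iso Chat e" "e \<in> hom Chat (player m) (src r)"
    and run: "run (tgt l) n (lab l (Pl n) (pt n)) w zs m (lab (r \<odot> e) (Pl m) (pt m))"
    unfolding play_word_def by blast
  have src: "src l' = src r" using step.hyps by (simp add: is_pushout_def)
  obtain u where u: "u \<in> hom Chat (src r) (player m)" "e \<odot> u = Ide Chat (src r)" "iso Chat u"
    using iso_inverseE[OF e] by metis
  obtain c k' x y k where c: "basic m c k'" and x: "x \<in> hom Chat (player m) (src r)"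
    and y: "iso Chat y" "y \<in> hom Chat (player k') (src r')" and k: "iso Chat k" "k \<in> hom Chat (yo \<C> c) (tgt l')"
    and s: "l' \<odot> x = k \<odot> smap m c" and t: "r' \<odot> y = k \<odot> tmap k' c"
    and l': "l' \<in> hom Chat (src r) (tgt l')" and r': "r' \<in> hom Chat (src r') (tgt l')"
    using extended_move_player[OF step.hyps(2) u(3), of m] u(1) src by metis
  \<comment> \<open>The identification of the position with [m] obtained from the move has to be the
    one already carried by the play; it is, as players have no other endomorphism than the
    identity.\<close>
  have "u \<odot> x = Ide Chat (player m)" using player_hom[OF Ch.comp_hom[OF x u(1)]] by blast
  then have "x = e"
    using Ch.comp_assoc[OF x u(1) e(2)] u(2) Ch.ide_comp[OF x] Ch.comp_ide[OF e(2)] by simp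
  then have "play_word n (w @ [c]) k' (p \<odot> l) (q \<odot> r')"
    using play_word_snoc[OF l r rep e run c y k l' r' _ t step.hyps(3)] s by blast
  then show ?case by auto
qed

text \<open>Plays are extended at their end, so the induction removes the last letter, unlike the
  one for rigidity.\<close>

lemma play_exists:
  "valid n w m \<Longrightarrow> \<exists>l r. basic_play (l, r) \<and> src r = player m \<and> play_word n w m l r"
proof (induction w arbitrary: m rule: rev_induct)
  case Nil
  then have m: "m = n" by simp
  let ?i = "Ide Chat (player n)"
  note i = ide_yo[of "Pl n"]
  have "finite {(Star, f) |f. f \<in> hom \<C> Star (Pl n)}" by (simp add: hom_Star_Pl)
  moreover have "(SIGMA x:UNIV. El (player n) x) \<subseteq> {(Star, f) |f. f \<in> hom \<C> Star (Pl n)} \<union> {(Pl n, pt n)}"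
    using hom_Pl by auto
  ultimately have "finite (SIGMA x:UNIV. El (player n) x)" by (meson finite.emptyI finite.insertI finite_UnI finite_subset)
  then have "position (player n)"
    unfolding position_def using hom_Pl by (intro conjI C.presheaf_yo allI impI; (assumption | fastforce))
  then have b: "basic_play (?i, ?i)" using i by (intro basic_play.empty) (simp_all add: hom_iff)
  have "src ?i = player n" using i(1) by (simp add: hom_iff)
  moreover have "play_word n [] n ?i ?i"
    using represents_Nil[OF i(2,1)] i Ch.comp_ide[OF i(1)]
    unfolding play_word_def by (intro conjI exI[of _ "[]"] exI[of _ ?i]) (auto simp: hom_iff)
  ultimately show ?case using b m by blast
next
  case (snoc c w)
  then obtain k where k: "valid n w k" "basic k c m" unfolding valid_append by auto
  then obtain l r where b: "basic_play (l, r)" "src r = player k" and pw: "play_word n w k l r"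
    using snoc.IH by blast
  then obtain zs e where l: "l \<in> hom Chat (player n) (tgt l)" and r: "r \<in> hom Chat (player k) (tgt l)"
    and rep: "represents n w (tgt l) (lab l (Pl n) (pt n)) zs" and e: "iso Chat e" "e \<in> hom Chat (player k) (player k)"
    and run: "run (tgt l) n (lab l (Pl n) (pt n)) w zs k (lab (r \<odot> e) (Pl k) (pt k))"
    unfolding play_word_def by (metis b(2))
  let ?s = "smap k c" and ?t = "tmap m c"
  note sh = smap_hom[OF k(2)]
  note th = tmap_hom[OF k(2)]
  obtain p q where po: "is_pushout Chat r ?s p q" using pushout_ex[OF r sh] by blast
  note i = ide_yo
  have ee: "e = Ide Chat (player k)" using player_hom[OF e(2)] by blast
  have "play_word n (w @ [c]) m (p \<odot> l) (q \<odot> ?t)"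
    by (rule play_word_snoc[OF l r rep e run k(2) i(2,1) i(2,1) sh th _ _ po])
      (simp_all add: ee Ch.comp_ide[OF sh] Ch.ide_comp[OF sh] Ch.comp_ide[OF th] Ch.ide_comp[OF th])
  moreover have "basic_play (p \<odot> l, q \<odot> ?t)"
    by (rule basic_play.step[OF b(1) extended_move_basic[OF k(2)] po])
  moreover have "src (q \<odot> ?t) = player m" using th by (simp add: Psh_def hom_iff)
  ultimately show ?case by blast
qed

lemma extended_move_typed: "extended_move (l, r) \<Longrightarrow> l \<in> Arr Chat \<and> r \<in> Arr Chat \<and> tgt l = tgt r"
  unfolding extended_move_def hom_iff fst_conv snd_conv by auto

lemma basic_play_typed: "basic_play K \<Longrightarrow> fst K \<in> Arr Chat \<and> snd K \<in> Arr Chat \<and> tgt (fst K) = tgt (snd K)"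
proof (induction rule: basic_play.induct)
  case (empty l)
  then show ?case by (simp add: iso_def)
next
  case (step l r l' r' p q)
  have h: "l \<in> hom Chat (src l) (tgt l)" "p \<in> hom Chat (tgt l) (tgt p)"
    "r' \<in> hom Chat (src r') (tgt l')" "q \<in> hom Chat (tgt l') (tgt p)"
    using step extended_move_typed[OF step.hyps(2)] by (auto simp: is_pushout_def hom_iff)
  show ?case using Ch.comp_hom[OF h(1,2)] Ch.comp_hom[OF h(3,4)] by (simp add: hom_iff)
qed

text \<open>Only the last step of the play changes: its pushout is replaced by the isomorphic
  one.\<close>

lemma basic_play_iso:
  assumes "basic_play (l, r)" and u: "iso Chat u" "u \<in> hom Chat (tgt l) W"
  shows "basic_play (u \<odot> l, u \<odot> r)"
  using assms(1)
proof (cases rule: basic_play.cases)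
  case empty
  have l: "l \<in> hom Chat (src l) (tgt l)" using empty by (simp add: iso_def hom_iff)
  have "src (u \<odot> l) = src l" by (simp add: Psh_def)
  then show ?thesis
    using empty basic_play.empty[OF Ch.iso_comp[OF _ u(1) l u(2)]] by simp
next
  case (step l0 r0 l' r' p q)
  have h: "l0 \<in> hom Chat (src l0) (tgt l0)" "p \<in> hom Chat (tgt l0) (tgt p)"
    "r' \<in> hom Chat (src r') (tgt l')" "q \<in> hom Chat (tgt l') (tgt p)"
    using step basic_play_typed[OF step(3)] extended_move_typed[OF step(4)]
    by (auto simp: is_pushout_def hom_iff)
  have u': "u \<in> hom Chat (tgt p) W" using u(2) step(1) by (simp add: Psh_def)
  have "basic_play ((u \<odot> p) \<odot> l0, (u \<odot> q) \<odot> r')"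
    by (rule basic_play.step[OF step(3,4) Ch.pushout_iso_target[OF step(5) u(1) u']])
  then show ?thesis
    using Ch.comp_assoc[OF h(1,2) u'] Ch.comp_assoc[OF h(3,4) u'] step(1,2) by simp
qed

text \<open>From left to right the word is read off the play. Conversely some play has the word of
  \<open>i\<close>, and uniqueness of representing objects transports it onto
  \<open>i\<close>.\<close>

lemma view_iff: "view i \<and> src i = player n \<longleftrightarrow> (\<exists>w. word_view n w i)"
proof
  assume i: "view i \<and> src i = player n"
  then obtain r where "basic_play (i, r)" unfolding view_def by blast
  from basic_play_word[OF this] i show "\<exists>w. word_view n w i"
    unfolding play_word_def word_view_def by fastforce
next
  assume "\<exists>w. word_view n w i"
  then obtain w zs where i: "i \<in> hom Chat (player n) (tgt i)" and r: "represents n w (tgt i) (lab i (Pl n) (pt n)) zs"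
    unfolding word_view_def by blast
  obtain m where "valid n w m" using representsD(3)[OF r] run_valid by blast
  then obtain l s where b: "basic_play (l, s)" and "play_word n w m l s" using play_exists by blast
  then obtain zs' where l: "l \<in> hom Chat (player n) (tgt l)" and r': "represents n w (tgt l) (lab l (Pl n) (pt n)) zs'"
    unfolding play_word_def by blast
  obtain u where u: "iso Chat u" "u \<in> hom Chat (tgt l) (tgt i)" "lab u (Pl n) (lab l (Pl n) (pt n)) = lab i (Pl n) (pt n)"
    using represents_unique[OF r' r] by metis
  have "u \<odot> l = i"
    by (rule C.yo_hom_eqI[OF Ch.comp_hom[OF l u(2)] i]) (simp add: lab_comp[OF l pt_in] u(3))
  then have "basic_play (i, u \<odot> s)" using basic_play_iso[OF b u(1,2)] by simp
  then show "view i \<and> src i = player n" using i unfolding view_def by (auto simp: hom_iff)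
qed


subsection \<open>The category of views\<close>

lemma V_obj_iff: "v \<in> Obj (\<V> n) \<longleftrightarrow> snd v = Ide Chat (player n) \<and> (\<exists>w. word_view n w (fst v))"
proof
  assume "v \<in> Obj (\<V> n)"
  then have v: "view (fst v)" "snd v \<in> hom Chat (src (fst v)) (player n)" by (auto simp: \<V>_def Let_def)
  then obtain m where m: "src (fst v) = player m" by (auto simp: view_def)
  then have "m = n" "snd v = Ide Chat (player n)" using player_hom[of "snd v" m n] v(2) by auto
  then show "snd v = Ide Chat (player n) \<and> (\<exists>w. word_view n w (fst v))" using view_iff v(1) m by auto
next
  assume v: "snd v = Ide Chat (player n) \<and> (\<exists>w. word_view n w (fst v))"
  then have "view (fst v)" "src (fst v) = player n" using view_iff by blast+
  moreover have "snd v \<in> hom Chat (player n) (player n)" using v ide_yo(1) by simp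
  ultimately show "v \<in> Obj (\<V> n)" by (auto simp: \<V>_def Let_def split: prod.splits)
qed

definition word_of :: "nat \<Rightarrow> vobj \<Rightarrow> cobj list" where
  "word_of n v = (THE w. word_view n w (fst v))"

lemma word_view_unique: "word_view n w i \<Longrightarrow> word_view n w' i \<Longrightarrow> w = w'"
  unfolding word_view_def using represents_word_unique by blast

lemma word_of_eq: "word_view n w (fst v) \<Longrightarrow> word_of n v = w"
  unfolding word_of_def using word_view_unique by blast

lemma word_view_word_of: "v \<in> Obj (\<V> n) \<Longrightarrow> word_view n (word_of n v) (fst v)"
  using V_obj_iff word_of_eq by metis

lemma V_obj_hom: "v \<in> Obj (\<V> n) \<Longrightarrow> fst v \<in> hom Chat (player n) (tgt (fst v))"
  using word_view_word_of unfolding word_view_def by blast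

text \<open>The component between the initial players is forced to be an identity by
  \<open>player_hom\<close>; what remains is a morphism under [n].\<close>

lemma V_arr_iff: "a \<in> hom (\<V> n) v v' \<longleftrightarrow> v \<in> Obj (\<V> n) \<and> v' \<in> Obj (\<V> n) \<and>
    (\<exists>k. a = Arrow v (Ide Chat (player n), k) v' \<and> k \<in> hom Chat (tgt (fst v)) (tgt (fst v')) \<and> k \<odot> fst v = fst v')"
proof -
  let ?I = "Ide Chat (player n)"
  have "a \<in> hom (\<V> n) v v' \<longleftrightarrow> v \<in> Obj (\<V> n) \<and> v' \<in> Obj (\<V> n) \<and> (\<exists>h k. a = Arrow v (h, k) v' \<and>
    h \<in> hom Chat (src (fst v)) (src (fst v')) \<and> k \<in> hom Chat (tgt (fst v)) (tgt (fst v')) \<and>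
    k \<odot> fst v = fst v' \<odot> h \<and> snd v' \<odot> h = snd v)" (is "_ \<longleftrightarrow> ?R")
    by (cases v; cases v') (auto simp: hom_iff \<V>_def Let_def)
  also have "?R \<longleftrightarrow> v \<in> Obj (\<V> n) \<and> v' \<in> Obj (\<V> n) \<and>
    (\<exists>k. a = Arrow v (?I, k) v' \<and> k \<in> hom Chat (tgt (fst v)) (tgt (fst v')) \<and> k \<odot> fst v = fst v')" (is "_ \<longleftrightarrow> ?S")
  proof
    assume R: ?R
    then obtain h k where h: "a = Arrow v (h, k) v'" "h \<in> hom Chat (src (fst v)) (src (fst v'))"
      "k \<in> hom Chat (tgt (fst v)) (tgt (fst v'))" "k \<odot> fst v = fst v' \<odot> h" by blast
    have v: "fst v \<in> hom Chat (player n) (tgt (fst v))" "fst v' \<in> hom Chat (player n) (tgt (fst v'))"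
      using R V_obj_hom by blast+
    then have "h = ?I" using h(2) player_hom[of h n n] by (simp add: hom_iff)
    then show ?S using R h Ch.comp_ide[OF v(2)] by auto
  next
    assume S: ?S
    then have v: "fst v \<in> hom Chat (player n) (tgt (fst v))" "fst v' \<in> hom Chat (player n) (tgt (fst v'))"
      using V_obj_hom by blast+
    note i = ide_yo(1)[of "Pl n"]
    have "snd v = ?I" "snd v' = ?I" "src (fst v) = player n" "src (fst v') = player n"
      using S v V_obj_iff by (auto simp: hom_iff)
    then show ?R using S Ch.comp_ide[OF v(2)] i Ch.comp_ide[OF i] by auto
  qed
  finally show ?thesis .
qed

text \<open>The remaining component fixes the initial player, so
  \<open>represents_hom_unique\<close> applies. All later equations between composites of views rest
  on this.\<close>

lemma V_thin:
  assumes "a \<in> hom (\<V> n) v v'" "b \<in> hom (\<V> n) v v'"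
  shows "a = b"
proof -
  have v: "v \<in> Obj (\<V> n)" "v' \<in> Obj (\<V> n)" using assms V_arr_iff by blast+
  obtain k where k: "a = Arrow v (Ide Chat (player n), k) v'" "k \<in> hom Chat (tgt (fst v)) (tgt (fst v'))" "k \<odot> fst v = fst v'"
    using assms(1) V_arr_iff by blast
  obtain l where l: "b = Arrow v (Ide Chat (player n), l) v'" "l \<in> hom Chat (tgt (fst v)) (tgt (fst v'))" "l \<odot> fst v = fst v'"
    using assms(2) V_arr_iff by blast
  obtain zs zs' where r: "represents n (word_of n v) (tgt (fst v)) (lab (fst v) (Pl n) (pt n)) zs"
    "represents n (word_of n v') (tgt (fst v')) (lab (fst v') (Pl n) (pt n)) zs'"
    using word_view_word_of v unfolding word_view_def by blast
  have "k = l"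
    using represents_hom_unique[OF r k(2) _ l(2)] lab_comp[OF V_obj_hom[OF v(1)] pt_in] k(3) l(3) by metis
  then show ?thesis using k l by simp
qed

lemma V_arr_ex:
  assumes v: "v \<in> Obj (\<V> n)" "v' \<in> Obj (\<V> n)"
  shows "(\<exists>a. a \<in> hom (\<V> n) v v') \<longleftrightarrow> prefix (word_of n v) (word_of n v')"
proof -
  obtain zs zs' where r: "represents n (word_of n v) (tgt (fst v)) (lab (fst v) (Pl n) (pt n)) zs"
    "represents n (word_of n v') (tgt (fst v')) (lab (fst v') (Pl n) (pt n)) zs'"
    using word_view_word_of v unfolding word_view_def by blast
  have "k \<odot> fst v = fst v' \<longleftrightarrow> lab k (Pl n) (lab (fst v) (Pl n) (pt n)) = lab (fst v') (Pl n) (pt n)"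
    if k: "k \<in> hom Chat (tgt (fst v)) (tgt (fst v'))" for k
    using C.yo_hom_eqI[OF Ch.comp_hom[OF V_obj_hom[OF v(1)] k] V_obj_hom[OF v(2)]]
      lab_comp[OF V_obj_hom[OF v(1)] pt_in, of k] by auto
  then show ?thesis using represents_hom_iff_prefix[OF r] v unfolding V_arr_iff by auto
qed

lemma V_obj_ex:
  assumes "valid n w m"
  shows "\<exists>v \<in> Obj (\<V> n). word_of n v = w"
proof -
  obtain l r where "play_word n w m l r" using play_exists[OF assms] by blast
  then have l: "word_view n w l" unfolding play_word_def word_view_def by blast
  then have "(l, Ide Chat (player n)) \<in> Obj (\<V> n)" unfolding V_obj_iff by auto
  then show ?thesis using word_of_eq[of n w "(l, Ide Chat (player n))"] l by (intro bexI) auto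
qed

lemma word_of_valid: "v \<in> Obj (\<V> n) \<Longrightarrow> \<exists>m. valid n (word_of n v) m"
  using word_view_word_of representsD(3) run_valid unfolding word_view_def by metis

lemma V_ide: "v \<in> Obj (\<V> n) \<Longrightarrow> Ide (\<V> n) v \<in> hom (\<V> n) v v"
proof -
  assume v: "v \<in> Obj (\<V> n)"
  have "src (fst v) = player n" "tgt (fst v) \<in> Obj Chat" using V_obj_hom[OF v] Ch.arr_obj by (auto simp: hom_iff)
  then show ?thesis
    unfolding V_arr_iff using v Ch.ide_comp[OF V_obj_hom[OF v]] Ch.ide_hom by (auto simp: \<V>_def Let_def)
qed

lemma V_comp:
  assumes a: "a \<in> hom (\<V> n) x y" and b: "b \<in> hom (\<V> n) y z"
  shows "Comp (\<V> n) b a \<in> hom (\<V> n) x z"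
proof -
  obtain k where k: "a = Arrow x (Ide Chat (player n), k) y" "k \<in> hom Chat (tgt (fst x)) (tgt (fst y))" "k \<odot> fst x = fst y"
    and x: "x \<in> Obj (\<V> n)"
    using a V_arr_iff by blast
  obtain l where l: "b = Arrow y (Ide Chat (player n), l) z" "l \<in> hom Chat (tgt (fst y)) (tgt (fst z))" "l \<odot> fst y = fst z"
    and z: "z \<in> Obj (\<V> n)"
    using b V_arr_iff by blast
  note i = ide_yo(1)[of "Pl n"]
  have "Comp (\<V> n) b a = Arrow x (Ide Chat (player n), l \<odot> k) z"
    using k(1) l(1) Ch.comp_ide[OF i] by (simp add: \<V>_def Let_def)
  then show ?thesis
    unfolding V_arr_iff using x z Ch.comp_hom[OF k(2) l(2)] Ch.comp_assoc[OF V_obj_hom[OF x] k(2) l(2)] k(3) l(3)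
    by auto
qed

lemma id_view_obj: "id_view n \<in> Obj (\<V> n)" and word_of_id_view: "word_of n (id_view n) = []"
proof -
  note i = ide_yo[of "Pl n"]
  have w: "word_view n [] (fst (id_view n))"
    using represents_Nil[OF i(2,1)] i(1) unfolding word_view_def id_view_def by (auto simp: hom_iff)
  then show "id_view n \<in> Obj (\<V> n)" unfolding V_obj_iff by (auto simp: id_view_def)
  show "word_of n (id_view n) = []" using word_of_eq[OF w] .
qed

lemma from_id_hom:
  assumes "v \<in> Obj (\<V> n)"
  shows "from_id n v \<in> hom (\<V> n) (id_view n) v"
proof -
  have "tgt (fst (id_view n)) = player n"
    using ide_yo(1)[of "Pl n"] by (simp add: id_view_def hom_iff)
  then show ?thesis
    unfolding V_arr_iff from_id_def
    using assms id_view_obj V_obj_hom[OF assms] Ch.comp_ide[OF V_obj_hom[OF assms]]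
    by (auto simp: id_view_def)
qed

subsection \<open>Prepending a move to a view\<close>

definition move :: "nat \<Rightarrow> cobj \<Rightarrow> nat \<Rightarrow> cospan set" where
  "move n c n' = {K. cospan_iso K (basic_cospan n c n')}"

lemma Moves_iff: "M \<in> Moves n \<longleftrightarrow> (\<exists>c n'. basic n c n' \<and> M = move n c n')"
  unfolding Moves_def move_def by auto

lemma basic_cospan_in_move:
  assumes c: "basic n c n'"
  shows "basic_cospan n c n' \<in> move n c n'"
proof -
  note s = smap_hom[OF c]
  note t = tmap_hom[OF c]
  note i = ide_yo[of c]
  have b: "basic_cospan n c n' = (smap n c, tmap n' c)"
    by (simp add: basic_cospan_def sarr_def tarr_def)
  show ?thesis
    unfolding move_def cospan_iso_def b mem_Collect_eq fst_conv snd_conv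
    using s t i Ch.ide_comp[OF s] Ch.ide_comp[OF t]
    by (intro conjI exI[of _ "Ide Chat (yo \<C> c)"]) (auto simp: hom_iff)
qed

lemma moveE:
  assumes c: "basic n c n'" and K: "K \<in> move n c n'"
  obtains k where "iso Chat k" "k \<in> hom Chat (yo \<C> c) (tgt (fst K))"
    "fst K = k \<odot> smap n c" "snd K = k \<odot> tmap n' c"
    "fst K \<in> hom Chat (player n) (tgt (fst K))" "snd K \<in> hom Chat (player n') (tgt (fst K))"
proof -
  note s = smap_hom[OF c]
  note t = tmap_hom[OF c]
  from K obtain u where u: "iso Chat u" "src u = tgt (fst K)" "tgt u = tgt (smap n c)"
     "u \<odot> fst K = smap n c" "u \<odot> snd K = tmap n' c"
    and a: "fst K \<in> Arr Chat" "snd K \<in> Arr Chat" "tgt (fst K) = tgt (snd K)"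
    unfolding move_def cospan_iso_def by (auto simp: basic_cospan_def sarr_def tarr_def)
  have uh: "u \<in> hom Chat (tgt (fst K)) (yo \<C> c)" using u s by (simp add: hom_iff iso_def)
  have src: "src (fst K) = player n" "src (snd K) = player n'"
    using arg_cong[OF u(4), of src] arg_cong[OF u(5), of src] s t by (simp_all add: Psh_def hom_iff)
  have K1: "fst K \<in> hom Chat (player n) (tgt (fst K))" and K2: "snd K \<in> hom Chat (player n') (tgt (fst K))"
    using a src by (simp_all add: hom_iff)
  obtain k where k: "iso Chat k" "k \<in> hom Chat (yo \<C> c) (tgt (fst K))" "k \<odot> u = Ide Chat (tgt (fst K))"
    using iso_inverseE[OF u(1) uh] by metis
  show ?thesis
    using that[OF k(1,2) _ _ K1 K2] Ch.comp_assoc[OF K1 uh k(2)] Ch.comp_assoc[OF K2 uh k(2)] k(3) u(4,5)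
      Ch.ide_comp[OF K1] Ch.ide_comp[OF K2] by simp
qed

lemma player_inj: "player m = player n \<Longrightarrow> m = n"
  using player_hom[of "Ide Chat (player m)" m n] ide_yo(1) by simp

lemma move_cod_move:
  assumes c: "basic n c n'"
  shows "move_cod (move n c n') = n'"
  unfolding move_cod_def
proof (rule the_equality)
  have "src (snd K) = player n'" if "K \<in> move n c n'" for K
    using moveE[OF c that] by (metis hom_iff)
  then show "\<exists>K\<in>move n c n'. src (snd K) = player n'" "\<And>m. \<exists>K\<in>move n c n'. src (snd K) = player m \<Longrightarrow> m = n'"
    using basic_cospan_in_move[OF c] player_inj by metis+
qed

text \<open>The map \<open>snd v\<close> to the player is an identity and disappears from the span
  chosen in \<open>po\<close>.\<close>

lemma po_pushout:
  assumes c: "basic n c n'" and v: "v \<in> Obj (\<V> n')"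
  defines "M \<equiv> move n c n'"
  shows "is_pushout Chat (snd (rep M)) (fst v) (fst (po M v)) (snd (po M v))"
    and "rep M \<in> move n c n'"
proof -
  show r: "rep M \<in> move n c n'"
    unfolding rep_def M_def using basic_cospan_in_move[OF c] by (rule someI)
  obtain X where k: "snd (rep M) \<in> hom Chat (player n') X" using moveE[OF c r] by metis
  have e: "snd (rep M) \<odot> snd v = snd (rep M)" using v V_obj_iff Ch.comp_ide[OF k] by simp
  obtain p q where "is_pushout Chat (snd (rep M)) (fst v) p q" using pushout_ex[OF k V_obj_hom[OF v]] by blast
  then show "is_pushout Chat (snd (rep M)) (fst v) (fst (po M v)) (snd (po M v))"
    unfolding po_def e using someI[of "\<lambda>pq. is_pushout Chat (snd (rep M)) (fst v) (fst pq) (snd pq)" "(p, q)"] by simp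
qed

text \<open>Once the isomorphism between the chosen representative and the basic cospan is absorbed,
  the chosen pushout is one along \<open>tmap\<close>, and \<open>represents_Cons\<close> yields the
  word.\<close>

lemma vcomp_obj:
  assumes c: "basic n c n'" and v: "v \<in> Obj (\<V> n')"
  shows "vcomp v (move n c n') \<in> Obj (\<V> n)" "word_of n (vcomp v (move n c n')) = c # word_of n' v"
proof -
  let ?M = "move n c n'"
  let ?p = "fst (po ?M v)" and ?q = "snd (po ?M v)"
  note po = po_pushout[OF c v]
  obtain k where k: "iso Chat k" "k \<in> hom Chat (yo \<C> c) (tgt (fst (rep ?M)))"
    "fst (rep ?M) = k \<odot> smap n c" "snd (rep ?M) = k \<odot> tmap n' c"
    "fst (rep ?M) \<in> hom Chat (player n) (tgt (fst (rep ?M)))" "snd (rep ?M) \<in> hom Chat (player n') (tgt (fst (rep ?M)))"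
    using moveE[OF c po(2)] by metis
  note s = smap_hom[OF c]
  note t = tmap_hom[OF c]
  have po': "is_pushout Chat (tmap n' c) (fst v) (?p \<odot> k) ?q"
    by (rule Ch.pushout_iso_span[OF po(1)[unfolded k(4)] k(1,2) t])
  obtain zs where r: "represents n' (word_of n' v) (tgt (fst v)) (lab (fst v) (Pl n') (pt n')) zs"
    using word_view_word_of[OF v] unfolding word_view_def by blast
  have p: "?p \<in> hom Chat (tgt (fst (rep ?M))) (tgt ?p)"
    using po(1) k(6) by (auto simp: is_pushout_def hom_iff)
  have pk: "?p \<odot> k \<in> hom Chat (yo \<C> c) (tgt ?p)" by (rule Ch.comp_hom[OF k(2) p])
  have f: "fst (vcomp v ?M) = (?p \<odot> k) \<odot> smap n c"
    using Ch.comp_assoc[OF s k(2) p] k(3) by (simp add: vcomp_def)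
  have fh: "fst (vcomp v ?M) \<in> hom Chat (player n) (tgt ?p)" unfolding f by (rule Ch.comp_hom[OF s pk])
  have "lab (fst (vcomp v ?M)) (Pl n) (pt n) = lab (?p \<odot> k) (Pl n) (sarr n c)"
    unfolding f using lab_comp[OF s pt_in] C.lab_yo_map[OF sarr_hom[OF c]] pt_in[of n] C.comp_ide[OF sarr_hom[OF c]] by simp
  moreover have "tgt (fst (vcomp v ?M)) = tgt (?p \<odot> k)" using fh pk by (simp add: hom_iff)
  ultimately have w: "word_view n (c # word_of n' v) (fst (vcomp v ?M))"
    unfolding word_view_def using represents_Cons[OF r c V_obj_hom[OF v] refl po'] fh by (auto simp: hom_iff)
  moreover have "snd (vcomp v ?M) = Ide Chat (player n)" using k(5) by (simp add: vcomp_def hom_iff)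
  ultimately show "vcomp v ?M \<in> Obj (\<V> n)" unfolding V_obj_iff by blast
  show "word_of n (vcomp v ?M) = c # word_of n' v" using word_of_eq[OF w] .
qed

lemma vcomp_arr_hom:
  assumes c: "basic n c n'" and a: "a \<in> hom (\<V> n') v v'"
  shows "vcomp_arr a (move n c n') \<in> hom (\<V> n) (vcomp v (move n c n')) (vcomp v' (move n c n'))"
proof -
  let ?M = "move n c n'"
  obtain k where k: "a = Arrow v (Ide Chat (player n'), k) v'" "k \<in> hom Chat (tgt (fst v)) (tgt (fst v'))" "k \<odot> fst v = fst v'"
    and v: "v \<in> Obj (\<V> n')" "v' \<in> Obj (\<V> n')"
    using a V_arr_iff by blast
  let ?p = "fst (po ?M v)" and ?q = "snd (po ?M v)" and ?p' = "fst (po ?M v')" and ?q' = "snd (po ?M v')"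
  note po = po_pushout[OF c v(1)] and po' = po_pushout[OF c v(2)]
  obtain X where r1: "fst (rep ?M) \<in> hom Chat (player n) X" and r2: "snd (rep ?M) \<in> hom Chat (player n') X"
    using moveE[OF c po(2)] by metis
  note i = V_obj_hom[OF v(1)] and i' = V_obj_hom[OF v(2)]
  have p: "?p \<in> hom Chat X (tgt ?p)" using po(1) r2 by (auto simp: is_pushout_def hom_iff)
  have p': "?p' \<in> hom Chat X (tgt ?p')" and q': "?q' \<in> hom Chat (tgt (fst v')) (tgt ?p')"
    and sq: "?p' \<odot> snd (rep ?M) = ?q' \<odot> fst v'"
    using po'(1) r2 i' by (auto simp: is_pushout_def hom_iff)
  have "?p' \<odot> snd (rep ?M) = (?q' \<odot> k) \<odot> fst v" using sq Ch.comp_assoc[OF i k(2) q'] k(3) by simp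
  then have "\<exists>!u. u \<in> hom Chat (tgt ?p) (tgt ?p') \<and> u \<odot> ?p = ?p' \<and> u \<odot> ?q = ?q' \<odot> k"
    by (rule pushout_univ[OF po(1) r2 i p p' Ch.comp_hom[OF k(2) q']])
  from theI'[OF this] obtain u where
    u: "u = (THE u. u \<in> hom Chat (tgt ?p) (tgt ?p') \<and> u \<odot> ?p = ?p' \<and> u \<odot> ?q = ?q' \<odot> k)"
      "u \<in> hom Chat (tgt ?p) (tgt ?p')" "u \<odot> ?p = ?p'" by blast
  have ar: "vcomp_arr a ?M = Arrow (vcomp v ?M) (Ide Chat (player n), u) (vcomp v' ?M)"
    using k(1) r1 by (simp add: vcomp_arr_def Let_def u(1) hom_iff split: prod.splits)
  have t: "tgt (fst (vcomp v ?M)) = tgt ?p" "tgt (fst (vcomp v' ?M)) = tgt ?p'"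
    using Ch.comp_hom[OF r1 p] Ch.comp_hom[OF r1 p'] by (simp_all add: vcomp_def hom_iff)
  have "u \<odot> fst (vcomp v ?M) = fst (vcomp v' ?M)"
    using Ch.comp_assoc[OF r1 p u(2)] u(3) by (simp add: vcomp_def)
  then show ?thesis
    unfolding V_arr_iff ar t using vcomp_obj(1)[OF c v(1)] vcomp_obj(1)[OF c v(2)] u(2) by auto
qed


section \<open>Presheaves of finite ordinals\<close>

text \<open>\<open>rank\<close> and \<open>enum\<close> extend \<open>rank_in\<close> and
  \<open>nth_in\<close> to arbitrary linear orders, since they are also applied to lists in
  lexicographic order.\<close>

definition rank :: "'a::linorder set \<Rightarrow> 'a \<Rightarrow> nat" where
  "rank A x = card {y \<in> A. y < x}"

definition enum :: "'a::linorder set \<Rightarrow> nat \<Rightarrow> 'a" where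
  "enum A j = sorted_list_of_set A ! j"

lemma rank_iso:
  assumes "bij_betw f A B" "\<And>x y. x \<in> A \<Longrightarrow> y \<in> A \<Longrightarrow> x < y \<Longrightarrow> f x < f y" "x \<in> A"
  shows "rank B (f x) = rank A x"
proof -
  have lt: "f y < f x \<longleftrightarrow> y < x" if "y \<in> A" for y
    using assms(2)[OF that assms(3)] assms(2)[OF assms(3) that] by (metis linorder_cases order.asym)
  have "{y \<in> B. y < f x} = f ` {y \<in> A. y < x}"
    using assms(1) lt by (auto simp: bij_betw_def)
  moreover have "inj_on f {y \<in> A. y < x}"
    using assms(1) by (auto simp: bij_betw_def intro: inj_on_subset)
  ultimately show ?thesis unfolding rank_def by (simp add: card_image)
qed

lemma rank_lessThan: "j < k \<Longrightarrow> rank {..<k} j = j" for k :: nat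
proof -
  assume "j < k"
  then have "{y \<in> {..<k}. y < j} = {..<j}" by auto
  then show ?thesis by (simp add: rank_def)
qed

lemma rank_strict_mono: "finite A \<Longrightarrow> x \<in> A \<Longrightarrow> y \<in> A \<Longrightarrow> x < y \<Longrightarrow> rank A x < rank A y"
  unfolding rank_def by (rule psubset_card_mono) auto

lemma rank_mono: "finite A \<Longrightarrow> x \<le> y \<Longrightarrow> rank A x \<le> rank A y"
  unfolding rank_def by (rule card_mono) auto

lemma rank_less: "finite A \<Longrightarrow> x \<in> A \<Longrightarrow> rank A x < card A"
  unfolding rank_def by (rule psubset_card_mono) auto

lemma rank_inj: "finite A \<Longrightarrow> x \<in> A \<Longrightarrow> y \<in> A \<Longrightarrow> rank A x = rank A y \<Longrightarrow> x = y"
  by (metis linorder_cases order.irrefl rank_strict_mono)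

lemma enum_in: "finite A \<Longrightarrow> j < card A \<Longrightarrow> enum A j \<in> A"
  unfolding enum_def by (metis length_sorted_list_of_set nth_mem set_sorted_list_of_set)

lemma enum_strict_mono: "finite A \<Longrightarrow> i < j \<Longrightarrow> j < card A \<Longrightarrow> enum A i < enum A j"
  unfolding enum_def using strict_sorted_list_of_set[of A]
  by (auto simp: sorted_wrt_iff_nth_less)

lemma bij_enum: "finite A \<Longrightarrow> bij_betw (enum A) {..<card A} A"
proof -
  assume A: "finite A"
  have "inj_on (enum A) {..<card A}"
    by (rule inj_onI) (metis A enum_strict_mono lessThan_iff linorder_cases order.irrefl)
  moreover have "enum A ` {..<card A} \<subseteq> A" using enum_in[OF A] by auto
  ultimately show ?thesis
    using A card_subset_eq[of A "enum A ` {..<card A}"] by (simp add: bij_betw_def card_image)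
qed

lemma rank_enum: "finite A \<Longrightarrow> j < card A \<Longrightarrow> rank A (enum A j) = j"
  using rank_iso[OF bij_enum, of A j] enum_strict_mono[of A] rank_lessThan[of j "card A"] by simp

lemma enum_rank: "finite A \<Longrightarrow> x \<in> A \<Longrightarrow> enum A (rank A x) = x"
  using rank_inj[OF _ enum_in[OF _ rank_less] _ rank_enum[OF _ rank_less]] by blast

section \<open>Skeletal copies of presheaves of finite linear orders\<close>

text \<open>A presheaf of finite linear orders, with values \<open>F\<close> and restrictions
  \<open>R\<close>, transported to ordinals along \<open>rank\<close> and \<open>enum\<close>.
  Residuals and the unfolding of a coalgebra are both of this form, with fibres and with lists of
  choices for \<open>F\<close>.\<close>

definition normal :: "('o, 'd) cat \<Rightarrow> ('o \<Rightarrow> 'a::linorder set) \<Rightarrow> (('o, 'd) arrow \<Rightarrow> 'a \<Rightarrow> 'a) \<Rightarrow> ('o, 'd, nat) psh" where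
  "normal D F R = \<lparr>El = \<lambda>x. if x \<in> Obj D then {..<card (F x)} else {},
     Act = \<lambda>a. if a \<in> Arr D
       then \<lambda>j \<in> {..<card (F (tgt a))}. rank (F (src a)) (R a (enum (F (tgt a)) j)) else (\<lambda>_. undefined)\<rparr>"

lemma El_normal: "El (normal D F R) x = (if x \<in> Obj D then {..<card (F x)} else {})"
  by (simp add: normal_def)

lemma Act_normal: "a \<in> hom D x y \<Longrightarrow> j < card (F y) \<Longrightarrow> Act (normal D F R) a j = rank (F x) (R a (enum (F y) j))"
  by (simp add: normal_def hom_iff)

lemma normal_OPsh:
  assumes D: "category D" and fin: "\<And>x. x \<in> Obj D \<Longrightarrow> finite (F x)"
    and R: "\<And>a x y e. a \<in> hom D x y \<Longrightarrow> e \<in> F y \<Longrightarrow> R a e \<in> F x"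
    and mono: "\<And>a x y e e'. a \<in> hom D x y \<Longrightarrow> e \<in> F y \<Longrightarrow> e' \<in> F y \<Longrightarrow> e \<le> e' \<Longrightarrow> R a e \<le> R a e'"
    and ide: "\<And>x e. x \<in> Obj D \<Longrightarrow> e \<in> F x \<Longrightarrow> R (Ide D x) e = e"
    and comp: "\<And>a b x y z e. a \<in> hom D x y \<Longrightarrow> b \<in> hom D y z \<Longrightarrow> e \<in> F z \<Longrightarrow> R (Comp D b a) e = R a (R b e)"
  shows "normal D F R \<in> OPsh D"
proof -
  let ?N = "normal D F R"
  note AN = Act_normal[where D = D and F = F and R = R]
  interpret category D by (rule D)
  have psh: "presheaf D ?N"
  proof (rule presheafI)
    show "El ?N x = {}" if "x \<notin> Obj D" for x using that by (simp add: El_normal)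
    show "Act ?N a = (\<lambda>_. undefined)" if "a \<notin> Arr D" for a using that by (simp add: normal_def)
    show "Act ?N a \<in> extensional (El ?N (tgt a))" if "a \<in> Arr D" for a
    proof -
      have "tgt a \<in> Obj D" using arr_obj[of a "src a" "tgt a"] that by (simp add: hom_iff)
      then show ?thesis using that by (simp add: normal_def)
    qed
    show "Act ?N a j \<in> El ?N x" if a: "a \<in> hom D x y" and j: "j \<in> El ?N y" for a x y j
    proof -
      have o: "x \<in> Obj D" "y \<in> Obj D" using arr_obj[OF a] by auto
      then have c: "j < card (F y)" using j by (simp add: El_normal)
      show ?thesis
        using AN[OF a c] rank_less[OF fin[OF o(1)] R[OF a enum_in[OF fin[OF o(2)] c]]] o
        by (simp add: El_normal)
    qed
    show "Act ?N (Ide D x) j = j" if j: "j \<in> El ?N x" for x j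
    proof -
      have x: "x \<in> Obj D" "j < card (F x)" using j by (auto simp: El_normal split: if_splits)
      then show ?thesis
        using AN[OF ide_hom[OF x(1)]] ide[OF x(1)] enum_in[OF fin] rank_enum[OF fin] by simp
    qed
    show "Act ?N (Comp D b a) j = Act ?N a (Act ?N b j)"
      if a: "a \<in> hom D x y" and b: "b \<in> hom D y z" and j: "j \<in> El ?N z" for a b x y z j
    proof -
      have o: "y \<in> Obj D" "z \<in> Obj D" "j < card (F z)" using j arr_obj[OF b] by (auto simp: El_normal)
      have e: "enum (F z) j \<in> F z" using enum_in[OF fin] o by blast
      have f: "finite (F y)" using fin o by blast
      show ?thesis
        using AN[OF comp_hom[OF a b] o(3)] AN[OF b o(3)] comp[OF a b e]
          AN[OF a rank_less[OF f R[OF b e]]] enum_rank[OF f R[OF b e]] by simp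
    qed
  qed
  have "mono_on (El ?N (tgt a)) (Act ?N a)" if "a \<in> Arr D" for a
  proof (rule mono_onI)
    fix i j assume h: "i \<in> El ?N (tgt a)" "j \<in> El ?N (tgt a)" "i \<le> j"
    have a: "a \<in> hom D (src a) (tgt a)" using that by (simp add: hom_iff)
    have o: "src a \<in> Obj D" "tgt a \<in> Obj D" using arr_obj[OF a] by auto
    have c: "i < card (F (tgt a))" "j < card (F (tgt a))" using h o by (auto simp: El_normal)
    have "enum (F (tgt a)) i \<le> enum (F (tgt a)) j"
      using enum_strict_mono[OF fin[OF o(2)] _ c(2), of i] h(3) by (cases "i = j") auto
    then show "Act ?N a i \<le> Act ?N a j"
      using AN[OF a c(1)] AN[OF a c(2)] mono[OF a] enum_in[OF fin[OF o(2)]] c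
        rank_mono[OF fin[OF o(1)]] by simp
  qed
  then show ?thesis using psh by (auto simp: OPsh_def El_normal)
qed

lemma OPsh_El: "S \<in> OPsh D \<Longrightarrow> x \<in> Obj D \<Longrightarrow> El S x = {..<card (El S x)}"
  by (auto simp: OPsh_def)

lemma OPsh_presheaf: "S \<in> OPsh D \<Longrightarrow> presheaf D S"
  by (simp add: OPsh_def)

lemma OPsh_eqI:
  assumes "presheaf D S" "presheaf D T" "\<And>x. x \<in> Obj D \<Longrightarrow> El S x = El T x"
    "\<And>a x y j. a \<in> hom D x y \<Longrightarrow> j \<in> El S y \<Longrightarrow> Act S a j = Act T a j"
  shows "S = T"
proof -
  have El: "El S x = El T x" for x using assms(1-3) by (cases "x \<in> Obj D") (auto simp: presheaf_def)
  have "Act S a = Act T a" for a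
  proof (cases "a \<in> Arr D")
    case True
    then have "Act S a \<in> extensional (El S (tgt a))" "Act T a \<in> extensional (El S (tgt a))"
      using assms(1,2) El by (auto simp: presheaf_def PiE_iff)
    then show ?thesis
      using assms(4)[of a "src a" "tgt a"] True by (auto simp: hom_iff intro: extensionalityI)
  qed (use assms(1,2) in \<open>auto simp: presheaf_def\<close>)
  then show ?thesis using El by (intro psh.equality) auto
qed

text \<open>A natural order isomorphism onto \<open>F\<close> becomes an equality of ordinal-valued
  presheaves, because an order isomorphism preserves ranks and the rank of an element in an ordinal
  is the element itself.\<close>

lemma normal_eqI:
  assumes S: "S \<in> OPsh D" and N: "normal D F R \<in> OPsh D" and D: "category D"
    and fin: "\<And>x. x \<in> Obj D \<Longrightarrow> finite (F x)"
    and R: "\<And>a x y e. a \<in> hom D x y \<Longrightarrow> e \<in> F y \<Longrightarrow> R a e \<in> F x"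
    and bij: "\<And>x. x \<in> Obj D \<Longrightarrow> bij_betw (\<theta> x) (El S x) (F x)"
    and mono: "\<And>x j k. x \<in> Obj D \<Longrightarrow> j \<in> El S x \<Longrightarrow> k \<in> El S x \<Longrightarrow> j < k \<Longrightarrow> \<theta> x j < \<theta> x k"
    and nat: "\<And>a x y j. a \<in> hom D x y \<Longrightarrow> j \<in> El S y \<Longrightarrow> \<theta> x (Act S a j) = R a (\<theta> y j)"
  shows "S = normal D F R"
proof (rule OPsh_eqI[OF OPsh_presheaf[OF S] OPsh_presheaf[OF N]])
  show El: "El S x = El (normal D F R) x" if x: "x \<in> Obj D" for x
    using OPsh_El[OF S x] bij_betw_same_card[OF bij[OF x]] x by (simp add: El_normal)
  have rk: "rank (F x) (\<theta> x j) = j" if x: "x \<in> Obj D" and j: "j \<in> El S x" for x j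
    using rank_iso[OF bij[OF x] mono[OF x] j] OPsh_El[OF S x] rank_lessThan[of j "card (El S x)"] j by auto
  fix a x y j assume a: "a \<in> hom D x y" and j: "j \<in> El S y"
  have o: "x \<in> Obj D" "y \<in> Obj D" using category.arr_obj[OF D a] by auto
  have "\<theta> y j \<in> F y" using bij[OF o(2)] j by (auto simp: bij_betw_def)
  then have "enum (F y) j = \<theta> y j" using enum_rank[OF fin[OF o(2)]] rk[OF o(2) j] by metis
  moreover have "j < card (F y)" using El[OF o(2)] j o(2) by (simp add: El_normal)
  moreover have "Act S a j \<in> El S x" using Act_in[OF OPsh_presheaf[OF S] a j] .
  ultimately show "Act S a j = Act (normal D F R) a j"
    using Act_normal[OF a] nat[OF a j] rk[OF o(1)] by metis
qed

text \<open>The sizes of the fibres give by summation the number of arguments with value below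
  \<open>i\<close>, and for a monotone map these arguments form an initial segment, so their number
  decides whether \<open>h j < i\<close>.\<close>

lemma fibres_determine:
  fixes h h' :: "nat \<Rightarrow> nat"
  assumes "mono_on {..<k} h" "h ` {..<k} \<subseteq> {..<I}" "mono_on {..<k'} h'" "h' ` {..<k'} \<subseteq> {..<I}"
    and fib: "\<And>i. i < I \<Longrightarrow> card {j \<in> {..<k}. h j = i} = card {j \<in> {..<k'}. h' j = i}"
  shows "k = k'" and "j < k \<Longrightarrow> h j = h' j"
proof -
  have sum: "card {j \<in> {..<k}. h j < i} = (\<Sum>l<i. card {j \<in> {..<k}. h j = l})" for h :: "nat \<Rightarrow> nat" and k i
  proof (induction i)
    case (Suc i)
    have "{j \<in> {..<k}. h j < Suc i} = {j \<in> {..<k}. h j < i} \<union> {j \<in> {..<k}. h j = i}" by auto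
    then have "card {j \<in> {..<k}. h j < Suc i} = card {j \<in> {..<k}. h j < i} + card {j \<in> {..<k}. h j = i}"
      by (simp add: card_Un_disjoint disjoint_iff)
    then show ?case using Suc by simp
  qed simp
  have eq: "card {j \<in> {..<k}. h j < i} = card {j \<in> {..<k'}. h' j < i}" if "i \<le> I" for i
    unfolding sum using fib that by (intro sum.cong) auto
  have init: "h j < i \<longleftrightarrow> j < card {l \<in> {..<k}. h l < i}" if m: "mono_on {..<k} h" and j: "j < k"
    for h :: "nat \<Rightarrow> nat" and k i j
  proof
    assume "h j < i"
    moreover have "h l \<le> h j" if "l \<le> j" for l using mono_onD[OF m, of l j] that j by simp
    ultimately have "{..j} \<subseteq> {l \<in> {..<k}. h l < i}" using j by (auto intro: le_less_trans)
    from card_mono[OF _ this] show "j < card {l \<in> {..<k}. h l < i}" by simp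
  next
    assume c: "j < card {l \<in> {..<k}. h l < i}"
    show "h j < i"
    proof (rule ccontr)
      assume "\<not> h j < i"
      moreover have "h j \<le> h l" if "j \<le> l" "l < k" for l using mono_onD[OF m, of j l] that j by simp
      ultimately have "{l \<in> {..<k}. h l < i} \<subseteq> {..<j}" by (auto simp: not_less) (meson leD leI order_trans)
      from card_mono[OF _ this] c show False by simp
    qed
  qed
  have all: "{j \<in> {..<k}. h j < I} = {..<k}" "{j \<in> {..<k'}. h' j < I} = {..<k'}" using assms(2,4) by auto
  show k: "k = k'" using eq[of I] unfolding all by simp
  show "h j = h' j" if j: "j < k"
  proof -
    have "h j < i \<longleftrightarrow> h' j < i" if "i \<le> I" for i
      using init[OF assms(1) j] init[OF assms(3), of j] j k eq[OF that] by simp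
    moreover have "h j < I" "h' j < I" using assms(2,4) j k by auto
    ultimately show ?thesis by (metis Suc_leI lessI less_antisym linorder_neqE_nat not_less_iff_gr_or_eq)
  qed
qed


section \<open>The coalgebra of strategies\<close>

text \<open>The axioms equate parallel arrows and so follow from thinness.\<close>

lemma V_category: "category (\<V> n)"
proof (rule category.intro)
  fix a b d x y z w
  show "x \<in> Obj (\<V> n) \<and> y \<in> Obj (\<V> n)" if "a \<in> hom (\<V> n) x y" using that V_arr_iff by blast
  then show "Comp (\<V> n) (Ide (\<V> n) y) a = a" "Comp (\<V> n) a (Ide (\<V> n) x) = a" if "a \<in> hom (\<V> n) x y"
    using that V_thin V_comp V_ide by metis+
  show "Comp (\<V> n) (Comp (\<V> n) d b) a = Comp (\<V> n) d (Comp (\<V> n) b a)"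
    if "a \<in> hom (\<V> n) x y" "b \<in> hom (\<V> n) y z" "d \<in> hom (\<V> n) z w"
    by (rule V_thin[OF V_comp[OF that(1) V_comp[OF that(2,3)]] V_comp[OF V_comp[OF that(1,2)] that(3)]])
qed (fact V_ide V_comp)+

lemma Strat_Act_in: "S \<in> Strat n \<Longrightarrow> a \<in> hom (\<V> n) u v \<Longrightarrow> j \<in> El S v \<Longrightarrow> Act S a j \<in> El S u"
  unfolding Strat_def by (rule Act_in[OF OPsh_presheaf])

text \<open>Thinness allows any parallel arrow \<open>d\<close> in place of the composite, so no
  composite has to be computed.\<close>

lemma Strat_commute:
  assumes "S \<in> Strat n" "a \<in> hom (\<V> n) u v" "b \<in> hom (\<V> n) v w" "d \<in> hom (\<V> n) u w" "j \<in> El S w"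
  shows "Act S a (Act S b j) = Act S d j"
  using Act_comp[OF OPsh_presheaf assms(2,3,5)] assms(1) V_thin[OF V_comp[OF assms(2,3)] assms(4)]
  unfolding Strat_def by simp

lemma Strat_endo:
  assumes "S \<in> Strat n" "a \<in> hom (\<V> n) v v" "j \<in> El S v"
  shows "Act S a j = j"
proof -
  have "v \<in> Obj (\<V> n)" using assms(2) V_arr_iff by blast
  then have "a = Ide (\<V> n) v" using V_thin[OF assms(2) V_ide] by blast
  then show ?thesis using Act_ide[OF OPsh_presheaf assms(3)] assms(1) unfolding Strat_def by simp
qed

lemma Strat_mono:
  assumes "S \<in> Strat n" "a \<in> hom (\<V> n) u v"
  shows "mono_on (El S v) (Act S a)"
  using assms unfolding Strat_def OPsh_def by (auto simp: hom_iff)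

lemma Strat_El: "S \<in> Strat n \<Longrightarrow> v \<in> Obj (\<V> n) \<Longrightarrow> El S v = {..<card (El S v)}"
  unfolding Strat_def by (rule OPsh_El)

lemma Strat_finite: "S \<in> Strat n \<Longrightarrow> v \<in> Obj (\<V> n) \<Longrightarrow> finite (El S v)"
  using Strat_El by (metis finite_lessThan)

text \<open>Views with the same word are isomorphic, and the only automorphism of a finite ordinal is the identity.\<close>

lemma Strat_same_word:
  assumes S: "S \<in> Strat n" and a: "a \<in> hom (\<V> n) u v" and w: "word_of n u = word_of n v"
  shows "El S u = El S v" and "j \<in> El S v \<Longrightarrow> Act S a j = j"
proof -
  have o: "u \<in> Obj (\<V> n)" "v \<in> Obj (\<V> n)" using a V_arr_iff by blast+
  obtain b where b: "b \<in> hom (\<V> n) v u" using V_arr_ex[OF o(2,1)] w by auto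
  have bij: "bij_betw (Act S a) (El S v) (El S u)"
  proof (rule bij_betw_byWitness[of _ "Act S b"])
    show "\<forall>j\<in>El S v. Act S b (Act S a j) = j"
      using Strat_commute[OF S b a V_ide[OF o(2)]] Strat_endo[OF S V_ide[OF o(2)]] by simp
    show "\<forall>j\<in>El S u. Act S a (Act S b j) = j"
      using Strat_commute[OF S a b V_ide[OF o(1)]] Strat_endo[OF S V_ide[OF o(1)]] by simp
  qed (use Strat_Act_in[OF S a] Strat_Act_in[OF S b] in auto)
  show eq: "El S u = El S v"
    using bij_betw_same_card[OF bij] Strat_El[OF S o(1)] Strat_El[OF S o(2)] by simp
  assume j: "j \<in> El S v"
  \<comment> \<open>A monotone bijection is strictly monotone and hence preserves ranks; in an
    ordinal ranks are the elements themselves.\<close>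
  have "Act S a i < Act S a k" if "i \<in> El S v" "k \<in> El S v" "i < k" for i k
    using mono_onD[OF Strat_mono[OF S a] that(1,2)] that bij by (metis bij_betw_imp_inj_on inj_onD le_neq_implies_less less_imp_le order.irrefl)
  from rank_iso[OF bij this j] have "rank (El S u) (Act S a j) = rank (El S v) j" by blast
  moreover have rk: "rank (El S v) i = i" if "i \<in> El S v" for i
    using Strat_El[OF S o(2)] that rank_lessThan[of i "card (El S v)"] by auto
  ultimately show "Act S a j = j" using rk[OF j] rk[of "Act S a j"] Strat_Act_in[OF S a j] eq by simp
qed

section \<open>Residuals of strategies\<close>

lemma from_id_fibre_map:
  assumes S: "S \<in> Strat n" and c: "basic n c n'" and a: "a \<in> hom (\<V> n') u v"
    and j: "j \<in> fibre n S i (move n c n') v"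
  shows "Act S (vcomp_arr a (move n c n')) j \<in> fibre n S i (move n c n') u"
proof -
  let ?M = "move n c n'"
  have o: "u \<in> Obj (\<V> n')" "v \<in> Obj (\<V> n')" using a V_arr_iff by blast+
  note b = vcomp_arr_hom[OF c a]
  have j: "j \<in> El S (vcomp v ?M)" "Act S (from_id n (vcomp v ?M)) j = i" using j by (auto simp: fibre_def)
  show ?thesis
    using Strat_Act_in[OF S b j(1)] j(2)
      Strat_commute[OF S from_id_hom[OF vcomp_obj(1)[OF c o(1)]] b from_id_hom[OF vcomp_obj(1)[OF c o(2)]] j(1)]
    by (simp add: fibre_def)
qed

lemma residual_normal:
  assumes c: "basic n c n'"
  shows "residual n S i (move n c n') =
    normal (\<V> n') (fibre n S i (move n c n')) (\<lambda>a. Act S (vcomp_arr a (move n c n')))"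
  by (simp add: residual_def normal_def move_cod_move[OF c] rank_in_def rank_def nth_in_def enum_def fun_eq_iff
      cong: restrict_cong if_cong)

lemma fibre_finite:
  assumes S: "S \<in> Strat n" and c: "basic n c n'" and v: "v \<in> Obj (\<V> n')"
  shows "finite (fibre n S i (move n c n') v)"
  by (rule finite_subset[OF _ Strat_finite[OF S vcomp_obj(1)[OF c v]]]) (auto simp: fibre_def)

lemma residual_Strat:
  assumes S: "S \<in> Strat n" and c: "basic n c n'"
  shows "residual n S i (move n c n') \<in> Strat n'"
  unfolding residual_normal[OF c] Strat_def
proof (rule normal_OPsh[OF V_category])
  let ?M = "move n c n'"
  have fi: "j \<in> El S (vcomp v ?M)" if "j \<in> fibre n S i ?M v" for v j using that by (simp add: fibre_def)
  show "finite (fibre n S i ?M v)" if "v \<in> Obj (\<V> n')" for v using fibre_finite[OF S c that] .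
  show "Act S (vcomp_arr a ?M) j \<in> fibre n S i ?M u" if "a \<in> hom (\<V> n') u v" "j \<in> fibre n S i ?M v" for a u v j
    using from_id_fibre_map[OF S c that] .
  show "Act S (vcomp_arr a ?M) j \<le> Act S (vcomp_arr a ?M) k"
    if "a \<in> hom (\<V> n') u v" "j \<in> fibre n S i ?M v" "k \<in> fibre n S i ?M v" "j \<le> k" for a u v j k
    using mono_onD[OF Strat_mono[OF S vcomp_arr_hom[OF c that(1)]]] fi that by blast
  show "Act S (vcomp_arr (Ide (\<V> n') v) ?M) j = j" if "v \<in> Obj (\<V> n')" "j \<in> fibre n S i ?M v" for v j
    using Strat_endo[OF S vcomp_arr_hom[OF c V_ide]] fi that by blast
  show "Act S (vcomp_arr (Comp (\<V> n') b a) ?M) j = Act S (vcomp_arr a ?M) (Act S (vcomp_arr b ?M) j)"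
    if a: "a \<in> hom (\<V> n') u v" and b: "b \<in> hom (\<V> n') v w" and j: "j \<in> fibre n S i ?M w" for a b u v w j
    using Strat_commute[OF S vcomp_arr_hom[OF c a] vcomp_arr_hom[OF c b] vcomp_arr_hom[OF c V_comp[OF a b]] fi[OF j]]
    by simp
qed

lemma Strat_coalgebra: "coalgebra Strat strat_str"
proof -
  have "residual n S i M \<in> Strat (move_cod M)" if "S \<in> Strat n" "M \<in> Moves n" for n S i M
    using residual_Strat[OF that(1)] that(2) by (auto simp: Moves_iff move_cod_move)
  then show ?thesis unfolding coalgebra_def FF_def strat_str_def Let_def by auto
qed

abbreviation strat_hom :: "(nat \<Rightarrow> 'x set) \<Rightarrow> (nat \<Rightarrow> 'x \<Rightarrow> nat \<times> (nat \<Rightarrow> cospan set \<Rightarrow> 'x)) \<Rightarrow>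
    (nat \<Rightarrow> 'x \<Rightarrow> strategy) \<Rightarrow> bool" where
  "strat_hom X \<gamma> \<equiv> coalgebra_hom X \<gamma> Strat strat_str"

lemma coalgebra_homD:
  assumes X: "coalgebra X \<gamma>" and f: "strat_hom X \<gamma> f" and x: "x \<in> X n"
  shows "f n x \<in> Strat n" and "El (f n x) (id_view n) = {..<fst (\<gamma> n x)}"
    and "i < fst (\<gamma> n x) \<Longrightarrow> basic n c n' \<Longrightarrow> snd (\<gamma> n x) i (move n c n') \<in> X n'"
    and "i < fst (\<gamma> n x) \<Longrightarrow> basic n c n' \<Longrightarrow>
      residual n (f n x) i (move n c n') = f n' (snd (\<gamma> n x) i (move n c n'))"
proof -
  show S: "f n x \<in> Strat n" using f x unfolding coalgebra_hom_def by (blast dest: PiE_mem)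
  obtain I \<phi> where g: "\<gamma> n x = (I, \<phi>)" by fastforce
  have "\<gamma> n x \<in> FF X n" using X x unfolding coalgebra_def by blast
  then have \<phi>: "\<phi> i M \<in> X (move_cod M)" if "i < I" "M \<in> Moves n" for i M
    using that unfolding FF_def g by (auto dest!: PiE_mem)
  have str: "strat_str n (f n x) = FF_map f n (\<gamma> n x)" using f x unfolding coalgebra_hom_def by blast
  then have I: "card (El (f n x) (id_view n)) = I"
    and r: "(\<lambda>i\<in>{..<I}. \<lambda>M\<in>Moves n. residual n (f n x) i M) = (\<lambda>i\<in>{..<I}. \<lambda>M\<in>Moves n. f (move_cod M) (\<phi> i M))"
    unfolding strat_str_def FF_map_def Let_def g by auto
  show "El (f n x) (id_view n) = {..<fst (\<gamma> n x)}" using Strat_El[OF S id_view_obj] I g by simp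
  assume i: "i < fst (\<gamma> n x)" and c: "basic n c n'"
  have M: "move n c n' \<in> Moves n" using c Moves_iff by blast
  show "snd (\<gamma> n x) i (move n c n') \<in> X n'" using \<phi>[OF _ M] i g move_cod_move[OF c] by simp
  show "residual n (f n x) i (move n c n') = f n' (snd (\<gamma> n x) i (move n c n'))"
    using fun_cong[OF fun_cong[OF r, of i], of "move n c n'"] i M g move_cod_move[OF c] by simp
qed


subsection \<open>Uniqueness\<close>

text \<open>The fibres at \<open>v0\<close> have the sizes of the values at \<open>v\<close> of the
  images of the successors of \<open>x\<close>. When these agree, \<open>fibres_determine\<close>
  makes the two monotone maps to the value at the identity view equal, and the fibres become equal
  as sets.\<close>

lemma hom_fibre_agree:
  assumes X: "coalgebra X \<gamma>" and f: "strat_hom X \<gamma> f" and g: "strat_hom X \<gamma> g"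
    and x: "x \<in> X n" and c: "basic n c n'" and v: "v \<in> Obj (\<V> n')"
    and eq: "\<forall>y \<in> X n'. El (f n' y) v = El (g n' y) v"
  defines "v0 \<equiv> vcomp v (move n c n')"
  shows "El (f n x) v0 = El (g n x) v0"
    and "j \<in> El (f n x) v0 \<Longrightarrow> Act (f n x) (from_id n v0) j = Act (g n x) (from_id n v0) j"
    and "fibre n (f n x) i (move n c n') v = fibre n (g n x) i (move n c n') v"
proof -
  let ?M = "move n c n'" and ?I = "fst (\<gamma> n x)"
  note F = coalgebra_homD[OF X f x] and G = coalgebra_homD[OF X g x]
  have o: "v0 \<in> Obj (\<V> n)" unfolding v0_def by (rule vcomp_obj(1)[OF c v])
  note a = from_id_hom[OF o]
  define k where "k = card (El (f n x) v0)"
  define k' where "k' = card (El (g n x) v0)"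
  have k: "El (f n x) v0 = {..<k}" and k': "El (g n x) v0 = {..<k'}"
    unfolding k_def k'_def using Strat_El[OF F(1) o] Strat_El[OF G(1) o] by auto
  \<comment> \<open>The homomorphism law says that the image of a successor is a residual, whose
    value at \<open>v\<close> is the ordinal of the fibre.\<close>
  have card: "card (fibre n (h n x) i ?M v) = card (El (h n' (snd (\<gamma> n x) i ?M)) v)"
    if h: "strat_hom X \<gamma> h" and i: "i < ?I" for h i
    using coalgebra_homD(4)[OF X h x i c] residual_normal[OF c, of "h n x" i]
      El_normal[of "\<V> n'" "fibre n (h n x) i ?M" _ v] v by (metis card_lessThan)
  have fib: "card {j \<in> {..<k}. Act (f n x) (from_id n v0) j = i} = card {j \<in> {..<k'}. Act (g n x) (from_id n v0) j = i}"
    if "i < ?I" for i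
    using card[OF f that] card[OF g that] bspec[OF eq F(3)[OF that c]]
    unfolding fibre_def k[unfolded v0_def] k'[unfolded v0_def] v0_def by simp
  have r: "Act (f n x) (from_id n v0) ` {..<k} \<subseteq> {..<?I}" "Act (g n x) (from_id n v0) ` {..<k'} \<subseteq> {..<?I}"
    using Strat_Act_in[OF F(1) a] Strat_Act_in[OF G(1) a] F(2) G(2) k k' by auto
  note D = fibres_determine[OF Strat_mono[OF F(1) a, unfolded k] r(1) Strat_mono[OF G(1) a, unfolded k'] r(2) fib]
  show El: "El (f n x) v0 = El (g n x) v0" using D(1) k k' by simp
  show Act: "Act (f n x) (from_id n v0) j = Act (g n x) (from_id n v0) j" if "j \<in> El (f n x) v0" for j
    using D(2) that k by simp
  show "fibre n (f n x) i ?M v = fibre n (g n x) i ?M v"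
    unfolding fibre_def v0_def[symmetric] using El Act by auto
qed

text \<open>The induction on the word is carried out on composites with a move; a view with the word
  \<open>c # w\<close> is merely isomorphic to such a composite, and \<open>Strat_same_word\<close>
  bridges the gap.\<close>

lemma hom_El_agree:
  assumes X: "coalgebra X \<gamma>" and f: "strat_hom X \<gamma> f" and g: "strat_hom X \<gamma> g"
  shows "x \<in> X n \<Longrightarrow> v \<in> Obj (\<V> n) \<Longrightarrow> El (f n x) v = El (g n x) v"
proof (induction "word_of n v" arbitrary: n x v)
  case Nil
  note F = coalgebra_homD[OF X f Nil.prems(1)] and G = coalgebra_homD[OF X g Nil.prems(1)]
  show ?case
    using Strat_same_word(1)[OF F(1) from_id_hom[OF Nil.prems(2)]] Strat_same_word(1)[OF G(1) from_id_hom[OF Nil.prems(2)]]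
      F(2) G(2) Nil.hyps word_of_id_view by simp
next
  case (Cons c w)
  note F = coalgebra_homD[OF X f Cons.prems(1)] and G = coalgebra_homD[OF X g Cons.prems(1)]
  obtain n' m where c: "basic n c n'" "valid n' w m"
    using word_of_valid[OF Cons.prems(2)] Cons.hyps(2)[symmetric] by auto
  obtain v' where v': "v' \<in> Obj (\<V> n')" "word_of n' v' = w" using V_obj_ex[OF c(2)] by blast
  let ?v0 = "vcomp v' (move n c n')"
  have o: "?v0 \<in> Obj (\<V> n)" "word_of n ?v0 = word_of n v" using vcomp_obj[OF c(1) v'(1)] v'(2) Cons.hyps(2) by auto
  obtain e where e: "e \<in> hom (\<V> n) ?v0 v" using V_arr_ex[OF o(1) Cons.prems(2)] o(2) by auto
  have "El (f n x) ?v0 = El (g n x) ?v0"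
    by (rule hom_fibre_agree(1)[OF X f g Cons.prems(1) c(1) v'(1)]) (use Cons.hyps(1) v' in auto)
  then show ?case using Strat_same_word(1)[OF F(1) e o(2)] Strat_same_word(1)[OF G(1) e o(2)] by simp
qed

text \<open>The words of \<open>u\<close> and \<open>v\<close> either share the first letter, and
  then the action on each fibre is that of a residual, covered by the induction hypothesis; or
  \<open>u\<close> has the empty word, and then the action is the map to the identity view, covered
  by \<open>hom_fibre_agree\<close>.\<close>

lemma hom_Act_agree:
  assumes X: "coalgebra X \<gamma>" and f: "strat_hom X \<gamma> f" and g: "strat_hom X \<gamma> g"
  shows "x \<in> X n \<Longrightarrow> a \<in> hom (\<V> n) u v \<Longrightarrow> j \<in> El (f n x) v \<Longrightarrow> Act (f n x) a j = Act (g n x) a j"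
proof (induction "word_of n v" arbitrary: n x u v a j)
  case Nil
  note F = coalgebra_homD[OF X f Nil.prems(1)] and G = coalgebra_homD[OF X g Nil.prems(1)]
  have o: "u \<in> Obj (\<V> n)" "v \<in> Obj (\<V> n)" using Nil.prems(2) V_arr_iff by blast+
  have "word_of n u = word_of n v" using V_arr_ex[OF o] Nil.prems(2) Nil.hyps[symmetric] by auto
  then show ?case
    using Strat_same_word(2)[OF F(1) Nil.prems(2)] Strat_same_word(2)[OF G(1) Nil.prems(2)] Nil.prems(3)
      hom_El_agree[OF X f g Nil.prems(1) o(2)] by simp
next
  case (Cons c w)
  note x = Cons.prems(1) and a = Cons.prems(2) and j = Cons.prems(3)
  note F = coalgebra_homD[OF X f x] and G = coalgebra_homD[OF X g x]
  have o: "u \<in> Obj (\<V> n)" "v \<in> Obj (\<V> n)" using a V_arr_iff by blast+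
  obtain n' m where c: "basic n c n'" "valid n' w m"
    using word_of_valid[OF o(2)] Cons.hyps(2)[symmetric] by auto
  obtain v' where v': "v' \<in> Obj (\<V> n')" "word_of n' v' = w" using V_obj_ex[OF c(2)] by blast
  let ?M = "move n c n'"
  let ?v0 = "vcomp v' ?M"
  have o0: "?v0 \<in> Obj (\<V> n)" "word_of n ?v0 = word_of n v" using vcomp_obj[OF c(1) v'(1)] v'(2) Cons.hyps(2) by auto
  obtain e where e: "e \<in> hom (\<V> n) ?v0 v" using V_arr_ex[OF o0(1) o(2)] o0(2) by auto
  have j': "j \<in> El (g n x) v" using hom_El_agree[OF X f g x o(2)] j by simp
  have j0: "j \<in> El (f n x) ?v0" using Strat_same_word(1)[OF F(1) e o0(2)] j by simp
  have e_f: "Act (f n x) e j = j" and e_g: "Act (g n x) e j = j"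
    using Strat_same_word(2)[OF F(1) e o0(2) j] Strat_same_word(2)[OF G(1) e o0(2) j'] by auto
  have ElX: "\<forall>y \<in> X n'. El (f n' y) z = El (g n' y) z" if "z \<in> Obj (\<V> n')" for z
    using hom_El_agree[OF X f g _ that] by blast
  note A = hom_fibre_agree[OF X f g x c(1) v'(1) ElX[OF v'(1)]]
  note fid = from_id_hom[OF o0(1)]
  show ?case
  proof (cases "word_of n u")
    case Nil
    then obtain d where d: "d \<in> hom (\<V> n) (id_view n) u" using from_id_hom[OF o(1)] by blast
    have w: "word_of n (id_view n) = word_of n u" using Nil word_of_id_view by simp
    \<comment> \<open>The two routes from the identity view to \<open>v\<close>, through
      \<open>u\<close> and through \<open>?v0\<close>, agree by thinness; \<open>d\<close> and
      \<open>e\<close> join views with equal words and act trivially.\<close>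
    have "Act S a j = Act S (from_id n ?v0) j"
      if S: "S \<in> Strat n" and j: "j \<in> El S v" and ej: "Act S e j = j" for S
    proof -
      have "Act S a j = Act S d (Act S a j)" using Strat_same_word(2)[OF S d w] Strat_Act_in[OF S a j] by simp
      also have "\<dots> = Act S (Comp (\<V> n) a d) j" by (rule Strat_commute[OF S d a V_comp[OF d a] j])
      also have "\<dots> = Act S (from_id n ?v0) (Act S e j)" by (rule Strat_commute[OF S fid e V_comp[OF d a] j, symmetric])
      finally show ?thesis using ej by simp
    qed
    then show ?thesis
      using A(2)[OF j0] F(1) G(1) j j' e_f e_g by metis
  next
    case u: (Cons c' w1)
    have pre: "prefix (c' # w1) (c # w)" using V_arr_ex[OF o] a u Cons.hyps(2) by auto
    then have c': "c' = c" and w1: "prefix w1 w" by auto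
    obtain n1 m1 where "basic n c n1" "valid n1 w1 m1" using word_of_valid[OF o(1)] u c' by auto
    then have "valid n' w1 m1" using basic_det[OF c(1)] by blast
    then obtain u' where u': "u' \<in> Obj (\<V> n')" "word_of n' u' = w1" using V_obj_ex by blast
    let ?u0 = "vcomp u' ?M"
    have p0: "?u0 \<in> Obj (\<V> n)" "word_of n ?u0 = word_of n u" using vcomp_obj[OF c(1) u'(1)] u'(2) u c' by auto
    obtain d where d: "d \<in> hom (\<V> n) ?u0 u" using V_arr_ex[OF p0(1) o(1)] p0(2) by auto
    obtain a' where a': "a' \<in> hom (\<V> n') u' v'" using V_arr_ex[OF u'(1) v'(1)] u' v' w1 by auto
    let ?b = "vcomp_arr a' ?M"
    note b = vcomp_arr_hom[OF c(1) a']
    have red: "Act S a j = Act S ?b j" if S: "S \<in> Strat n" and j: "j \<in> El S v" and ej: "Act S e j = j" for S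
    proof -
      have "Act S a j = Act S d (Act S a j)" using Strat_same_word(2)[OF S d p0(2)] Strat_Act_in[OF S a j] by simp
      also have "\<dots> = Act S (Comp (\<V> n) a d) j" by (rule Strat_commute[OF S d a V_comp[OF d a] j])
      also have "\<dots> = Act S ?b (Act S e j)" by (rule Strat_commute[OF S b e V_comp[OF d a] j, symmetric])
      finally show ?thesis using ej by simp
    qed
    \<comment> \<open>\<open>j\<close> lies in the fibre over \<open>i\<close>; up to
      \<open>rank\<close>, the action of \<open>?b\<close> there is the action of \<open>a'\<close>
      in the residual at \<open>i\<close>, that is, in the image of the successor \<open>y\<close>.
      The induction hypothesis compares the two actions at the rank of \<open>j\<close>.\<close>
    define i where "i = Act (f n x) (from_id n ?v0) j"
    have i: "i < fst (\<gamma> n x)" using Strat_Act_in[OF F(1) fid j0] F(2) by (simp add: i_def)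
    let ?Fv = "fibre n (f n x) i ?M v'" and ?Fu = "fibre n (f n x) i ?M u'"
    have jf: "j \<in> ?Fv" using j0 by (simp add: fibre_def i_def)
    have eqv: "fibre n (g n x) i ?M v' = ?Fv" "fibre n (g n x) i ?M u' = ?Fu"
      using A(3)[of i] hom_fibre_agree(3)[OF X f g x c(1) u'(1) ElX[OF u'(1)], of i] by auto
    define y where "y = snd (\<gamma> n x) i ?M"
    have y: "y \<in> X n'" using F(3)[OF i c(1)] by (simp add: y_def)
    have fin: "finite ?Fv" "finite ?Fu" using fibre_finite[OF F(1) c(1)] v'(1) u'(1) by auto
    let ?r = "rank ?Fv j"
    have r: "?r < card ?Fv" by (rule rank_less[OF fin(1) jf])
    have res: "Act (h n' y) a' ?r = rank ?Fu (Act (h n x) ?b j)"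
      if h: "strat_hom X \<gamma> h" "fibre n (h n x) i ?M v' = ?Fv" "fibre n (h n x) i ?M u' = ?Fu" for h
      using coalgebra_homD(4)[OF X h(1) x i c(1)] residual_normal[OF c(1), of "h n x" i]
        Act_normal[OF a', of ?r "fibre n (h n x) i ?M" "\<lambda>a. Act (h n x) (vcomp_arr a ?M)"] h(2,3) r enum_rank[OF fin(1) jf]
      by (simp add: y_def)
    have "El (f n' y) v' = {..<card ?Fv}"
      unfolding y_def F(4)[OF i c(1), symmetric] residual_normal[OF c(1)] El_normal using v'(1) by simp
    then have "Act (f n' y) a' ?r = Act (g n' y) a' ?r"
      using Cons.hyps(1)[OF _ y a'] v'(2) r by simp
    then have "rank ?Fu (Act (f n x) ?b j) = rank ?Fu (Act (g n x) ?b j)"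
      using res[OF f refl refl] res[OF g eqv] by simp
    moreover have "Act (f n x) ?b j \<in> ?Fu" using from_id_fibre_map[OF F(1) c(1) a' jf] .
    moreover have "Act (g n x) ?b j \<in> ?Fu" using from_id_fibre_map[OF G(1) c(1) a', of j i] jf eqv by simp
    ultimately have "Act (f n x) ?b j = Act (g n x) ?b j" using rank_inj[OF fin(2)] by blast
    then show ?thesis using red[OF F(1) j e_f] red[OF G(1) j' e_g] by simp
  qed
qed

lemma hom_unique_coalgebra:
  assumes X: "coalgebra X \<gamma>" and f: "strat_hom X \<gamma> f" and g: "strat_hom X \<gamma> g"
  shows "f = g"
proof (intro ext)
  fix n x
  show "f n x = g n x"
  proof (cases "x \<in> X n")
    case True
    have "f n x \<in> OPsh (\<V> n)" "g n x \<in> OPsh (\<V> n)"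
      using coalgebra_homD(1)[OF X f True] coalgebra_homD(1)[OF X g True] by (auto simp: Strat_def)
    then show ?thesis
      using OPsh_eqI[OF OPsh_presheaf OPsh_presheaf] hom_El_agree[OF X f g True] hom_Act_agree[OF X f g True] by metis
  next
    case False
    have "f n \<in> extensional (X n)" "g n \<in> extensional (X n)"
      using f g unfolding coalgebra_hom_def by (auto simp: PiE_iff)
    then show ?thesis using False by (simp add: extensional_def)
  qed
qed

subsection \<open>Existence\<close>

text \<open>A letter determines the player it leads to, so the recursion over words can compute the
  index of the next state.\<close>

definition ncod :: "cobj \<Rightarrow> nat" where
  "ncod c = (THE n'. \<exists>n. basic n c n')"

lemma ncod_eq: "basic n c n' \<Longrightarrow> ncod c = n'"
  unfolding ncod_def using basic_det by blast

text \<open>An element of the unfolding of \<open>x\<close> at a word is recorded as the list of the indices chosen along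
  the word; such lists are ordered lexicographically, and restriction to a prefix truncates them.\<close>

fun paths :: "(nat \<Rightarrow> 'x \<Rightarrow> nat \<times> (nat \<Rightarrow> cospan set \<Rightarrow> 'x)) \<Rightarrow> nat \<Rightarrow> 'x \<Rightarrow> cobj list \<Rightarrow> nat list set" where
  "paths \<gamma> n x [] = (\<lambda>i. [i]) ` {..<fst (\<gamma> n x)}"
| "paths \<gamma> n x (c # w) = (\<Union>i<fst (\<gamma> n x). (#) i ` paths \<gamma> (ncod c) (snd (\<gamma> n x) i (move n c (ncod c))) w)"

lemma finite_paths: "finite (paths \<gamma> n x w)"
  by (induction w arbitrary: n x) auto

lemma length_paths: "p \<in> paths \<gamma> n x w \<Longrightarrow> length p = Suc (length w)"
  by (induction w arbitrary: n x p) auto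

lemma take_paths: "p \<in> paths \<gamma> n x (u @ w) \<Longrightarrow> take (Suc (length u)) p \<in> paths \<gamma> n x u"
proof (induction u arbitrary: n x p)
  case Nil
  then show ?case by (cases w) auto
qed fastforce

lemma take_mono: "p \<le> q \<Longrightarrow> take k p \<le> take k q" for p q :: "nat list"
proof (induction k arbitrary: p q)
  case (Suc k)
  then show ?case by (cases p; cases q) auto
qed simp

text \<open>The \<open>Suc\<close> accounts for the index chosen already at the identity view: a
  word of length k carries lists of length k + 1.\<close>

definition unfold_strat :: "(nat \<Rightarrow> 'x \<Rightarrow> nat \<times> (nat \<Rightarrow> cospan set \<Rightarrow> 'x)) \<Rightarrow> nat \<Rightarrow> 'x \<Rightarrow> strategy" where
  "unfold_strat \<gamma> n x =
    normal (\<V> n) (\<lambda>v. paths \<gamma> n x (word_of n v)) (\<lambda>a. take (Suc (length (word_of n (src a)))))"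

lemma take_arr:
  assumes "a \<in> hom (\<V> n) u v" "p \<in> paths \<gamma> n x (word_of n v)"
  shows "take (Suc (length (word_of n (src a)))) p \<in> paths \<gamma> n x (word_of n u)"
proof -
  have "prefix (word_of n u) (word_of n v)" using V_arr_ex assms(1) V_arr_iff by blast
  then show ?thesis using take_paths assms by (fastforce simp: prefix_def hom_iff)
qed

lemma unfolding_Strat: "unfold_strat \<gamma> n x \<in> Strat n"
  unfolding unfold_strat_def Strat_def
proof (rule normal_OPsh[OF V_category finite_paths take_arr])
  let ?t = "\<lambda>a. take (Suc (length (word_of n (src a)))) :: nat list \<Rightarrow> nat list"
  show "?t (Ide (\<V> n) v) p = p" if "v \<in> Obj (\<V> n)" "p \<in> paths \<gamma> n x (word_of n v)" for v p
    using V_ide[OF that(1)] length_paths[OF that(2)] by (simp add: hom_iff)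
  show "?t (Comp (\<V> n) b a) p = ?t a (?t b p)"
    if a: "a \<in> hom (\<V> n) u v" and b: "b \<in> hom (\<V> n) v z" for a b u v z p
  proof -
    have "prefix (word_of n u) (word_of n v)" using V_arr_ex a V_arr_iff by blast
    then have "length (word_of n u) \<le> length (word_of n v)" by (rule prefix_length_le)
    then show ?thesis using a b V_comp[OF a b] by (simp add: hom_iff min_def)
  qed
qed (auto intro: take_mono)

text \<open>The fibre over \<open>i\<close> consists of the positions of the lists that begin with
  \<open>i\<close>; removing this head is an order isomorphism onto the lists of the successor and
  commutes with truncation.\<close>

lemma residual_unfolding:
  assumes c: "basic n c n'" and i: "i < fst (\<gamma> n x)"
  shows "residual n (unfold_strat \<gamma> n x) i (move n c n') = unfold_strat \<gamma> n' (snd (\<gamma> n x) i (move n c n'))"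
proof -
  let ?M = "move n c n'" and ?S = "unfold_strat \<gamma> n x"
  define y where "y = snd (\<gamma> n x) i ?M"
  define P where "P v = paths \<gamma> n x (word_of n (vcomp v ?M))" for v
  define F where "F v = fibre n ?S i ?M v" for v
  \<comment> \<open>A position in the residual is read as a position in the fibre, that one as a
    list of choices, and the head of the list, which is \<open>i\<close>, is dropped.\<close>
  define \<theta> where "\<theta> v j = tl (enum (P v) (enum (F v) j))" for v j
  have S: "?S \<in> Strat n" by (rule unfolding_Strat)
  have P: "P v = (\<Union>l<fst (\<gamma> n x). (#) l ` paths \<gamma> n' (snd (\<gamma> n x) l ?M) (word_of n' v))" if "v \<in> Obj (\<V> n')" for v
    unfolding P_def vcomp_obj(2)[OF c that] by (simp add: ncod_eq[OF c])
  have finP: "finite (P v)" for v unfolding P_def by (rule finite_paths)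
  have ElP: "El ?S (vcomp v ?M) = {..<card (P v)}" if "v \<in> Obj (\<V> n')" for v
    using vcomp_obj(1)[OF c that] by (simp add: unfold_strat_def El_normal P_def)
  have ActP: "Act ?S a j = rank (paths \<gamma> n x (word_of n u)) (take (Suc (length (word_of n u))) (enum (paths \<gamma> n x (word_of n w)) j))"
    if "a \<in> hom (\<V> n) u w" "j < card (paths \<gamma> n x (word_of n w))" for a u w j
    using Act_normal[OF that(1), of j "\<lambda>v. paths \<gamma> n x (word_of n v)"] that unfolding unfold_strat_def by (simp add: hom_iff)
  have F: "F v = {j \<in> {..<card (P v)}. hd (enum (P v) j) = i}" if v: "v \<in> Obj (\<V> n')" for v
  proof -
    have "Act ?S (from_id n (vcomp v ?M)) j = hd (enum (P v) j)" if j: "j < card (P v)" for j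
    proof -
      have p: "enum (P v) j \<in> P v" by (rule enum_in[OF finP j])
      then obtain l q where lq: "enum (P v) j = l # q" "l < fst (\<gamma> n x)" unfolding P[OF v] by auto
      have "bij_betw (\<lambda>i. [i]) {..<fst (\<gamma> n x)} (paths \<gamma> n x [])" by (auto simp: bij_betw_def inj_on_def)
      then have "rank (paths \<gamma> n x []) [l] = l"
        using rank_iso[of "\<lambda>i. [i]" "{..<fst (\<gamma> n x)}" "paths \<gamma> n x []" l] lq(2) rank_lessThan[OF lq(2)] by simp
      then show ?thesis
        using ActP[OF from_id_hom[OF vcomp_obj(1)[OF c v]]] j lq word_of_id_view by (simp add: P_def)
    qed
    then show ?thesis unfolding F_def fibre_def ElP[OF v] by auto
  qed
  have finF: "finite (F v)" if "v \<in> Obj (\<V> n')" for v unfolding F[OF that] by simp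
  have ElR: "El (residual n ?S i ?M) v = {..<card (F v)}" if "v \<in> Obj (\<V> n')" for v
    using that unfolding residual_normal[OF c] by (simp add: El_normal F_def)
  have bF: "bij_betw (enum (P v)) (F v) ((#) i ` paths \<gamma> n' y (word_of n' v))" if v: "v \<in> Obj (\<V> n')" for v
  proof -
    note b = bij_enum[OF finP[of v]]
    have "enum (P v) ` F v = {p \<in> P v. hd p = i}"
      using b unfolding F[OF v] bij_betw_def by auto
    also have "\<dots> = (#) i ` paths \<gamma> n' y (word_of n' v)"
      unfolding P[OF v] y_def using i by auto
    finally show ?thesis
      using b unfolding bij_betw_def F[OF v] by (auto intro: inj_on_subset)
  qed
  have "residual n ?S i ?M = unfold_strat \<gamma> n' y"
    unfolding unfold_strat_def[of \<gamma> n' y]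
  proof (rule normal_eqI[where \<theta> = \<theta>])
    show "residual n ?S i ?M \<in> OPsh (\<V> n')" using residual_Strat[OF S c] by (simp add: Strat_def)
    show "normal (\<V> n') (\<lambda>v. paths \<gamma> n' y (word_of n' v)) (\<lambda>a. take (Suc (length (word_of n' (src a))))) \<in> OPsh (\<V> n')"
      using unfolding_Strat[of \<gamma> n' y] by (simp add: unfold_strat_def Strat_def)
    show "bij_betw (\<theta> v) (El (residual n ?S i ?M) v) (paths \<gamma> n' y (word_of n' v))" if v: "v \<in> Obj (\<V> n')" for v
    proof -
      have "bij_betw tl ((#) i ` paths \<gamma> n' y (word_of n' v)) (paths \<gamma> n' y (word_of n' v))"
        by (rule bij_betw_byWitness[of _ "(#) i"]) auto
      from bij_betw_trans[OF bij_betw_trans[OF bij_enum[OF finF[OF v]] bF[OF v]] this]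
      show ?thesis unfolding ElR[OF v] \<theta>_def comp_def .
    qed
    show "\<theta> v j < \<theta> v k" if v: "v \<in> Obj (\<V> n')" and j: "j \<in> El (residual n ?S i ?M) v" and k: "k \<in> El (residual n ?S i ?M) v" and jk: "j < k" for v j k
    proof -
      have jk': "j < card (F v)" "k < card (F v)" using j k ElR[OF v] by auto
      have e: "enum (F v) j \<in> F v" "enum (F v) k \<in> F v" using enum_in[OF finF[OF v]] jk' by auto
      have "enum (F v) j < enum (F v) k" using enum_strict_mono[OF finF[OF v] jk jk'(2)] .
      \<comment> \<open>Both lists begin with \<open>i\<close>, so their lexicographic comparison is
        decided by the tails.\<close>
      then have "enum (P v) (enum (F v) j) < enum (P v) (enum (F v) k)"
        using enum_strict_mono[OF finP[of v]] e(2) F[OF v] by auto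
      moreover obtain p q where "enum (P v) (enum (F v) j) = i # p" "enum (P v) (enum (F v) k) = i # q"
        using bF[OF v] e unfolding bij_betw_def by blast
      ultimately show ?thesis by (simp add: \<theta>_def)
    qed
    show "\<theta> u (Act (residual n ?S i ?M) a j) = take (Suc (length (word_of n' (src a)))) (\<theta> v j)"
      if a: "a \<in> hom (\<V> n') u v" and j: "j \<in> El (residual n ?S i ?M) v" for a u v j
    proof -
      have o: "u \<in> Obj (\<V> n')" "v \<in> Obj (\<V> n')" using a V_arr_iff by blast+
      have jc: "j < card (F v)" using j ElR[OF o(2)] by simp
      let ?j = "enum (F v) j"
      have jF: "?j \<in> F v" by (rule enum_in[OF finF[OF o(2)] jc])
      then have jP: "?j < card (P v)" using F[OF o(2)] by auto
      note b = vcomp_arr_hom[OF c a]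
      let ?q = "take (Suc (length (word_of n (vcomp u ?M)))) (enum (P v) ?j)"
      have q: "?q \<in> P u"
        using take_arr[OF b, of "enum (P v) ?j"] enum_in[OF finP jP] b unfolding P_def by (simp add: hom_iff)
      have "Act (residual n ?S i ?M) a j = rank (F u) (Act ?S (vcomp_arr a ?M) ?j)"
        unfolding residual_normal[OF c] F_def
        by (rule Act_normal[OF a, where F = "fibre n ?S i ?M"]) (use jc in \<open>simp add: F_def\<close>)
      moreover have "Act ?S (vcomp_arr a ?M) ?j \<in> F u"
        using from_id_fibre_map[OF S c a] jF unfolding F_def by blast
      ultimately have "enum (F u) (Act (residual n ?S i ?M) a j) = Act ?S (vcomp_arr a ?M) ?j"
        using enum_rank[OF finF[OF o(1)]] by simp
      also have "\<dots> = rank (P u) ?q" using ActP[OF b] jP unfolding P_def by simp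
      finally have "\<theta> u (Act (residual n ?S i ?M) a j) = tl ?q"
        unfolding \<theta>_def using enum_rank[OF finP q] by simp
      \<comment> \<open>Prepending the move lengthens the word of \<open>u\<close> by one letter,
        matching the index that \<open>tl\<close> removes.\<close>
      also have "\<dots> = take (Suc (length (word_of n' u))) (tl (enum (P v) ?j))"
        unfolding vcomp_obj(2)[OF c o(1)] by (simp add: tl_take)
      finally show ?thesis using a by (simp add: \<theta>_def hom_iff)
    qed
  qed (use V_category finite_paths take_arr in auto)
  then show ?thesis by (simp add: y_def)
qed

lemma unfolding_hom:
  assumes X: "coalgebra X \<gamma>"
  shows "strat_hom X \<gamma> (\<lambda>n. \<lambda>x \<in> X n. unfold_strat \<gamma> n x)"
  unfolding coalgebra_hom_def
proof (intro conjI allI ballI)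
  show "(\<lambda>x\<in>X n. unfold_strat \<gamma> n x) \<in> X n \<rightarrow>\<^sub>E Strat n" for n using unfolding_Strat by auto
  fix n x assume x: "x \<in> X n"
  obtain I \<phi> where g: "\<gamma> n x = (I, \<phi>)" by fastforce
  have "\<gamma> n x \<in> FF X n" using X x unfolding coalgebra_def by blast
  then have \<phi>: "\<phi> i M \<in> X (move_cod M)" if "i < I" "M \<in> Moves n" for i M
    using that unfolding FF_def g by (auto dest!: PiE_mem)
  have "card (paths \<gamma> n x []) = I" using g by (simp add: card_image inj_on_def)
  then have I: "card (El (unfold_strat \<gamma> n x) (id_view n)) = I"
    unfolding unfold_strat_def using id_view_obj word_of_id_view by (simp add: El_normal)
  have "residual n (unfold_strat \<gamma> n x) i M = (\<lambda>x \<in> X (move_cod M). unfold_strat \<gamma> (move_cod M) x) (\<phi> i M)"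
    if i: "i < I" and M: "M \<in> Moves n" for i M
  proof -
    obtain c n' where c: "basic n c n'" "M = move n c n'" using M Moves_iff by blast
    show ?thesis using residual_unfolding[OF c(1), of i \<gamma> x] i g \<phi>[OF i M] c move_cod_move[OF c(1)] by simp
  qed
  then show "strat_str n ((\<lambda>x\<in>X n. unfold_strat \<gamma> n x) x) = FF_map (\<lambda>n. \<lambda>x\<in>X n. unfold_strat \<gamma> n x) n (\<gamma> n x)"
    using x I unfolding strat_str_def FF_map_def Let_def g by (auto intro!: restrict_ext)
qed

theorem mainTheorem5:
  shows "coalgebra Strat strat_str \<and>
    (\<forall>(X :: nat \<Rightarrow> 'x set) \<gamma>. coalgebra X \<gamma> \<longrightarrow>
       (\<exists>!f. coalgebra_hom X \<gamma> Strat strat_str f))"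
  using Strat_coalgebra unfolding_hom hom_unique_coalgebra by blast

end
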